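(* Let $\mathcal A\subset C^\infty([0,\infty))$ together with the linear functional ⨍$:\mathcal A\to\mathbb C$ be an admissible Fréchet space (as defined in the context). Let $M$ be a compact oriented manifold of dimension $n$, and let $$\pi_*:\Omega^k\mathcal A_0([0,\infty)\times M)\longrightarrow\Omega^{k-1}(M)$$ be integration along the fiber. Then $\pi_*$ induces an isomorphism $$H^k\mathcal A_0([0,\infty)\times M)\longrightarrow H^{k-1}_{\mathrm{dR}}(M)$$ for all $k\ge 0$ (for $k=0$ this means $H^0\mathcal A_0([0,\infty)\times M)=\{0\}$). Here $H^k\mathcal A_0([0,\infty)\times M)$ denotes the $k$-th cohomology group of the complex $(\Omega^\bullet\mathcal A_0([0,\infty)\times M),d)$ with $d$ the exterior derivative.
   Context: Admissible Fréchet space: a Fréchet space $\mathcal A$ of smooth complex-valued functions on $[0,\infty)$ such that: (1) $C_c^\infty([0,\infty))\subset\mathcal A\subset C^\infty([0,\infty))$ with continuous embeddings. Here $C^\infty([0,\infty))$ has the usual Fréchet topology of uniform convergence of all derivatives on compact sets, and $C_c^\infty([0,\infty))$ (smooth compactly supported functions on $[0,\infty)$, not required to vanish near $0$) has the LF topology as inductive limit of the Fréchet spaces $\{f\in C^\infty([0,\infty)): \operatorname{supp} f\subset[0,N]\}$, $N\in\mathbb N$. Put $\mathcal A_0=\{f\in\mathcal A:\operatorname{supp} f\subset(0,\infty)\}$ (so these $f$ vanish near $0$). (2) The derivative $\frac{d}{dx}$ maps $\mathcal A$ into $\mathcal A$. (3) There is given a non-trivial linear functional ⨍$:\mathcal A\to\mathbb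 C$ such that (a) there is $\lambda\in\mathbb C$ with ⨍$f=\lambda\int_0^\infty f(x)\,dx$ for all $f\in C_c^\infty([0,\infty))$; (b) ⨍$f'=0$ for every $f\in\mathcal A_0$; (c) if $f\in\mathcal A_0$ and ⨍$f=0$, then the function $F(x)=\int_0^x f(y)\,dy$ belongs to $\mathcal A$. Forms: $\Omega^k\mathcal A_0([0,\infty)\times M)$ is the space of smooth $k$-forms on $[0,\infty)\times M$ (with coordinate $r$ on $[0,\infty)$), vanishing for $r<\varepsilon$ for some $\varepsilon>0$, which in local coordinates $x$ on any chart $U\subset M$ are of the form $\sum_I f_I\,dx_I+\sum_J g_J\,dx_J\wedge dr$ where $f_I(\cdot,p),g_J(\cdot,p)\in\mathcal A$ for each $p\in U$ and $p\mapsto f_I(\cdot,p)$, $p\mapsto g_J(\cdot,p)$ are smooth maps $U\to\mathcal A$. The exterior derivative preserves these spaces. Integration along the fiber $\pi_*$ is given locally by $\pi_*\big(f_1(r,p)\,\eta_1+f_2(r,p)\,\eta_2\wedge dr\big)=\big(⨍ f_2(\cdot,p)\big)\,\eta_2$, where $\eta_1\in\Omega^k(M)$, $\eta_2\in\Omega^{k-1}(M)$ (pulled back to $[0,\infty)\times M$ where appropriate); it commutes with exterior differentiation. $H_{\mathrm{dR}}^\bullet(M)$ is de Rham cohomology with complex coefficients, with $H^{-1}_{\mathrm{dR}}(M)=0$. *)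

theory Defs
  imports
    "HOL-Analysis.Analysis"
    "HOL-Algebra.Elementary_Groups"
    "HOL-Library.Function_Algebras"
    "Jordan_Normal_Form.Determinant"
begin

section \<open>Frechet spaces of functions\<close>

text \<open>
  All function spaces below are complex vector spaces under the pointwise operations.  The topology
  defined by a countable family of seminorms \<open>q\<close> on a space \<open>A\<close> of functions:
\<close>

definition seminorm_topology ::
    "('x \<Rightarrow> complex) set \<Rightarrow> (nat \<Rightarrow> ('x \<Rightarrow> complex) \<Rightarrow> real) \<Rightarrow> ('x \<Rightarrow> complex) topology" where
  "seminorm_topology A q = topology (\<lambda>U. U \<subseteq> A \<and>
     (\<forall>f\<in>U. \<exists>N. \<exists>e>0. \<forall>g\<in>A. (\<forall>j\<le>N. q j (g - f) < e) \<longrightarrow> g \<in> U))"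

lemma openin_seminorm_topology:
  "openin (seminorm_topology A q) U \<longleftrightarrow> U \<subseteq> A \<and>
     (\<forall>f\<in>U. \<exists>N. \<exists>e>0. \<forall>g\<in>A. (\<forall>j\<le>N. q j (g - f) < e) \<longrightarrow> g \<in> U)"
proof -
  let ?near = "\<lambda>U f. \<exists>N. \<exists>e>0. \<forall>g\<in>A. (\<forall>j\<le>(N::nat). q j (g - f) < (e::real)) \<longrightarrow> g \<in> U"
  have inter: "?near (S \<inter> T) f" if S: "?near S f" and T: "?near T f" for S T f
  proof -
    from S obtain M d where M: "d > 0" "\<And>g. g \<in> A \<Longrightarrow> \<forall>j\<le>M. q j (g - f) < d \<Longrightarrow> g \<in> S"
      by blast
    from T obtain N e where N: "e > 0" "\<And>g. g \<in> A \<Longrightarrow> \<forall>j\<le>N. q j (g - f) < e \<Longrightarrow> g \<in> T"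
      by blast
    have "\<forall>g\<in>A. (\<forall>j\<le>max M N. q j (g - f) < min d e) \<longrightarrow> g \<in> S \<inter> T"
      using M(2) N(2) by auto
    moreover have "min d e > 0"
      using M(1) N(1) by simp
    ultimately show ?thesis
      by blast
  qed
  have "istopology (\<lambda>U. U \<subseteq> A \<and> (\<forall>f\<in>U. ?near U f))"
    unfolding istopology_def
  proof (intro conjI allI impI)
    fix S T assume "S \<subseteq> A \<and> (\<forall>f\<in>S. ?near S f)" "T \<subseteq> A \<and> (\<forall>f\<in>T. ?near T f)"
    then have "S \<subseteq> A" and near: "?near S f" "?near T f" if "f \<in> S \<inter> T" for f
      using that by (fast, fast, fast)
    then show "S \<inter> T \<subseteq> A" by fast
    show "\<forall>f\<in>S \<inter> T. ?near (S \<inter> T) f"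
      by (intro ballI inter near)
  next
    fix K assume K: "\<forall>U\<in>K. U \<subseteq> A \<and> (\<forall>f\<in>U. ?near U f)"
    then show "\<Union>K \<subseteq> A" by blast
    show "\<forall>f\<in>\<Union>K. ?near (\<Union>K) f"
    proof
      fix f assume "f \<in> \<Union>K"
      then obtain U where U: "U \<in> K" "f \<in> U" by blast
      with K have "?near U f" by blast
      with U(1) show "?near (\<Union>K) f" by (meson UnionI)
    qed
  qed
  then show ?thesis
    unfolding seminorm_topology_def by simp
qed

definition complex_subspace :: "('x \<Rightarrow> complex) set \<Rightarrow> bool" where
  "complex_subspace A \<longleftrightarrow> 0 \<in> A \<and> (\<forall>f\<in>A. \<forall>g\<in>A. f + g \<in> A) \<and> (\<forall>a. \<forall>f\<in>A. (\<lambda>x. a * f x) \<in> A)"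

definition seminorm_on :: "('x \<Rightarrow> complex) set \<Rightarrow> (('x \<Rightarrow> complex) \<Rightarrow> real) \<Rightarrow> bool" where
  "seminorm_on A q \<longleftrightarrow> (\<forall>f\<in>A. \<forall>g\<in>A. q (f + g) \<le> q f + q g)
     \<and> (\<forall>a. \<forall>f\<in>A. q (\<lambda>x. a * f x) = cmod a * q f)"

definition frechet_space :: "('x \<Rightarrow> complex) topology \<Rightarrow> bool" where
  "frechet_space T \<longleftrightarrow> complex_subspace (topspace T) \<and>
     (\<exists>q. (\<forall>j. seminorm_on (topspace T) (q j))
        \<and> T = seminorm_topology (topspace T) q
        \<and> (\<forall>f\<in>topspace T. (\<forall>j. q j f = 0) \<longrightarrow> f = 0)
        \<and> (\<forall>s. range s \<subseteq> topspace T \<and>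
              (\<forall>j. \<forall>e>0. \<exists>N. \<forall>k\<ge>N. \<forall>l\<ge>N. q j (s k - s l) < e)
              \<longrightarrow> (\<exists>f. limitin T s f sequentially)))"

section \<open>Smooth functions on the half-line\<close>

text \<open>
  A function on \<open>[0,\<infinity>)\<close> is represented by its extension by \<open>0\<close> to the real line, so that
  equality of representatives is equality on \<open>[0,\<infinity>)\<close>.  The derivative at \<open>0\<close> is one-sided.
\<close>

definition ddx :: "(real \<Rightarrow> complex) \<Rightarrow> real \<Rightarrow> complex" where
  "ddx f = (\<lambda>x. if 0 \<le> x then vector_derivative f (at x within {0..}) else 0)"

definition smooth_half_line :: "(real \<Rightarrow> complex) set" where
  "smooth_half_line = {f. (\<forall>x<0. f x = 0) \<and>
     (\<forall>j. \<forall>x\<ge>0. (ddx ^^ j) f differentiable (at x within {0..}))}"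

definition supp :: "(real \<Rightarrow> complex) \<Rightarrow> real set" where
  "supp f = closure {x. f x \<noteq> 0}"

definition smooth_topology :: "(real \<Rightarrow> complex) topology" where
  "smooth_topology = seminorm_topology smooth_half_line
     (\<lambda>N f. SUP (j, x) \<in> {..N} \<times> {0..real N}. cmod ((ddx ^^ j) f x))"

definition compactly_supported :: "(real \<Rightarrow> complex) set" where
  "compactly_supported = {f \<in> smooth_half_line. compact (supp f)}"

definition supported_upto_topology :: "nat \<Rightarrow> (real \<Rightarrow> complex) topology" where
  "supported_upto_topology N = subtopology smooth_topology {f. supp f \<subseteq> {0..real N}}"

definition absolutely_convex :: "('x \<Rightarrow> complex) set \<Rightarrow> bool" where
  "absolutely_convex W \<longleftrightarrow>
     (\<forall>f\<in>W. \<forall>g\<in>W. \<forall>a b. cmod a + cmod b \<le> 1 \<longrightarrow> (\<lambda>x. a * f x + b * g x) \<in> W)"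

text \<open>
  The locally convex inductive limit: the basic neighbourhoods of \<open>0\<close> are the absolutely convex
  sets that meet every step of the union in a neighbourhood of \<open>0\<close> of that step.
\<close>

definition lf_neighbourhood :: "(real \<Rightarrow> complex) set \<Rightarrow> bool" where
  "lf_neighbourhood W \<longleftrightarrow> W \<subseteq> compactly_supported \<and> absolutely_convex W \<and>
     (\<forall>N. \<exists>V. openin (supported_upto_topology N) V \<and> 0 \<in> V \<and> V \<subseteq> W)"

definition lf_topology :: "(real \<Rightarrow> complex) topology" where
  "lf_topology = topology (\<lambda>U. U \<subseteq> compactly_supported \<and>
     (\<forall>f\<in>U. \<exists>W. lf_neighbourhood W \<and> (\<forall>g\<in>W. f + g \<in> U)))"

lemma openin_lf_topology:
  "openin lf_topology U \<longleftrightarrow> U \<subseteq> compactly_supported \<and>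
     (\<forall>f\<in>U. \<exists>W. lf_neighbourhood W \<and> (\<forall>g\<in>W. f + g \<in> U))"
proof -
  let ?near = "\<lambda>U f. \<exists>W. lf_neighbourhood W \<and> (\<forall>g\<in>W. f + g \<in> U)"
  have nbh: "lf_neighbourhood (V \<inter> W)" if V: "lf_neighbourhood V" and W: "lf_neighbourhood W" for V W
  proof -
    have "\<exists>B. openin (supported_upto_topology N) B \<and> 0 \<in> B \<and> B \<subseteq> V \<inter> W" for N
    proof -
      obtain B C where "openin (supported_upto_topology N) B" "0 \<in> B" "B \<subseteq> V"
        "openin (supported_upto_topology N) C" "0 \<in> C" "C \<subseteq> W"
        using V W unfolding lf_neighbourhood_def by metis
      then have "openin (supported_upto_topology N) (B \<inter> C)" "0 \<in> B \<inter> C" "B \<inter> C \<subseteq> V \<inter> W"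
        by auto
      then show ?thesis by blast
    qed
    moreover have "absolutely_convex (V \<inter> W)"
      using V W unfolding lf_neighbourhood_def absolutely_convex_def by blast
    ultimately show ?thesis
      using V unfolding lf_neighbourhood_def by blast
  qed
  have inter: "?near (S \<inter> T) f" if "?near S f" "?near T f" for S T f
    using that nbh by (meson IntD1 IntD2 IntI)
  have "istopology (\<lambda>U. U \<subseteq> compactly_supported \<and> (\<forall>f\<in>U. ?near U f))"
    unfolding istopology_def
  proof (intro conjI allI impI)
    fix S T
    assume "S \<subseteq> compactly_supported \<and> (\<forall>f\<in>S. ?near S f)"
      "T \<subseteq> compactly_supported \<and> (\<forall>f\<in>T. ?near T f)"
    then show "S \<inter> T \<subseteq> compactly_supported" "\<forall>f\<in>S \<inter> T. ?near (S \<inter> T) f"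
      using inter by (blast, blast)
  next
    fix K assume K: "\<forall>U\<in>K. U \<subseteq> compactly_supported \<and> (\<forall>f\<in>U. ?near U f)"
    then show "\<Union>K \<subseteq> compactly_supported" by blast
    show "\<forall>f\<in>\<Union>K. ?near (\<Union>K) f"
    proof
      fix f assume "f \<in> \<Union>K"
      then obtain U where U: "U \<in> K" "f \<in> U" by blast
      with K have "?near U f" by blast
      with U(1) show "?near (\<Union>K) f" by (meson UnionI)
    qed
  qed
  then show ?thesis
    unfolding lf_topology_def by simp
qed

section \<open>Admissible spaces\<close>

definition vanishing_near_0 :: "(real \<Rightarrow> complex) set \<Rightarrow> (real \<Rightarrow> complex) set" where
  "vanishing_near_0 A = {f \<in> A. supp f \<subseteq> {0<..}}"

text \<open>
  The Frechet space is the topology \<open>T\<close>, with underlying set \<open>topspace T\<close>.  No continuity of the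
  functional \<open>fint\<close> is required.
\<close>

definition admissible :: "(real \<Rightarrow> complex) topology \<Rightarrow> ((real \<Rightarrow> complex) \<Rightarrow> complex) \<Rightarrow> bool" where
  "admissible T fint \<longleftrightarrow>
     frechet_space T \<and>
     compactly_supported \<subseteq> topspace T \<and> topspace T \<subseteq> smooth_half_line \<and>
     continuous_map lf_topology T (\<lambda>f. f) \<and>
     continuous_map T smooth_topology (\<lambda>f. f) \<and>
     (\<forall>f\<in>topspace T. ddx f \<in> topspace T) \<and>
     (\<forall>f\<in>topspace T. \<forall>g\<in>topspace T. fint (f + g) = fint f + fint g) \<and>
     (\<forall>a. \<forall>f\<in>topspace T. fint (\<lambda>x. a * f x) = a * fint f) \<and>
     (\<exists>f\<in>topspace T. fint f \<noteq> 0) \<and>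
     (\<exists>c. \<forall>f\<in>compactly_supported. fint f = c * integral {0..} f) \<and>
     (\<forall>f\<in>vanishing_near_0 (topspace T). fint (ddx f) = 0) \<and>
     (\<forall>f\<in>vanishing_near_0 (topspace T). fint f = 0 \<longrightarrow>
        (\<lambda>x. if 0 \<le> x then integral {0..x} f else 0) \<in> topspace T)"

section \<open>Smooth maps in coordinates\<close>

text \<open>
  Points of \<open>\<real>\<^sup>N\<close> are the points of \<^term>\<open>Euclidean_space N\<close>, with coordinates \<open>x 0, \<dots>, x (N - 1)\<close>.
  The sets \<open>S\<close> that occur are open in \<open>\<real>\<^sup>N\<close>, or of the form \<open>V \<times> [0,\<infinity>)\<close> with \<open>V\<close> open, where
  derivatives at the boundary are one-sided.
\<close>

definition pd :: "(nat \<Rightarrow> real) set \<Rightarrow> nat \<Rightarrow> ((nat \<Rightarrow> real) \<Rightarrow> 'a::real_normed_vector) \<Rightarrow> (nat \<Rightarrow> real) \<Rightarrow> 'a"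
  where
  "pd S i f = (\<lambda>x. if x \<in> S
     then vector_derivative (\<lambda>t. f (x(i := t))) (at (x i) within {t. x(i := t) \<in> S}) else 0)"

definition smooth_coords ::
    "nat \<Rightarrow> (nat \<Rightarrow> real) set \<Rightarrow> ((nat \<Rightarrow> real) \<Rightarrow> 'a::real_normed_vector) \<Rightarrow> bool" where
  "smooth_coords N S f \<longleftrightarrow> (\<forall>is. set is \<subseteq> {..<N} \<longrightarrow>
     continuous_on S (foldr (pd S) is f) \<and>
     (\<forall>i<N. \<forall>x\<in>S. (\<lambda>t. foldr (pd S) is f (x(i := t)))
        differentiable (at (x i) within {t. x(i := t) \<in> S})))"

text \<open>
  Smooth maps from an open set \<open>V\<close> of \<open>\<real>\<^sup>n\<close> to a Frechet space \<open>T\<close> of functions: \<open>D is\<close> is the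
  iterated partial derivative along the directions listed in \<open>is\<close>, all limits being taken in \<open>T\<close>.
\<close>

definition smooth_into ::
    "nat \<Rightarrow> (nat \<Rightarrow> real) set \<Rightarrow> ('x \<Rightarrow> complex) topology \<Rightarrow> ((nat \<Rightarrow> real) \<Rightarrow> 'x \<Rightarrow> complex) \<Rightarrow> bool"
  where
  "smooth_into n V T F \<longleftrightarrow> (\<exists>D. (\<forall>x\<in>V. D [] x = F x) \<and>
     (\<forall>is. set is \<subseteq> {..<n} \<longrightarrow>
        continuous_map (subtopology (Euclidean_space n) V) T (D is) \<and>
        (\<forall>i<n. \<forall>x\<in>V. limitin T
           (\<lambda>h::real. \<lambda>r. (D is (x(i := x i + h)) r - D is x r) / complex_of_real h)
           (D (i # is) x) (at 0))))"

section \<open>Manifolds\<close>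

type_synonym 'p chart = "'p set \<times> ('p \<Rightarrow> nat \<Rightarrow> real)"

definition chart_image :: "'p chart \<Rightarrow> (nat \<Rightarrow> real) set" where
  "chart_image c = snd c ` fst c"

definition overlap :: "'p chart \<Rightarrow> 'p chart \<Rightarrow> (nat \<Rightarrow> real) set" where
  "overlap c d = snd c ` (fst c \<inter> fst d)"

definition transition :: "'p chart \<Rightarrow> 'p chart \<Rightarrow> (nat \<Rightarrow> real) \<Rightarrow> nat \<Rightarrow> real" where
  "transition c d = snd d \<circ> inv_into (fst c) (snd c)"

definition is_chart :: "nat \<Rightarrow> 'm topology \<Rightarrow> 'm chart \<Rightarrow> bool" where
  "is_chart n X c \<longleftrightarrow> openin X (fst c) \<and> openin (Euclidean_space n) (chart_image c) \<and>
     homeomorphic_map (subtopology X (fst c)) (subtopology (Euclidean_space n) (chart_image c)) (snd c)"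

definition compatible :: "nat \<Rightarrow> 'm chart \<Rightarrow> 'm chart \<Rightarrow> bool" where
  "compatible n c d \<longleftrightarrow>
     (\<forall>j<n. smooth_coords n (overlap c d) (\<lambda>x. transition c d x j)) \<and>
     (\<forall>j<n. smooth_coords n (overlap d c) (\<lambda>x. transition d c x j))"

text \<open>A smooth structure is a maximal atlas, i.e. the set \<open>S\<close> of all smooth charts.\<close>

definition smooth_manifold :: "nat \<Rightarrow> 'm topology \<Rightarrow> 'm chart set \<Rightarrow> bool" where
  "smooth_manifold n X S \<longleftrightarrow>
     Hausdorff_space X \<and> second_countable X \<and>
     (\<forall>c\<in>S. is_chart n X c) \<and> (\<Union>c\<in>S. fst c) = topspace X \<and>
     (\<forall>c\<in>S. \<forall>d\<in>S. compatible n c d) \<and>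
     (\<forall>c. is_chart n X c \<and> (\<forall>d\<in>S. compatible n c d) \<longrightarrow> c \<in> S)"

text \<open>
  The minor of the Jacobian matrix of the transition map \<open>y = transition c d x\<close> with rows \<open>J\<close> and
  columns \<open>I\<close>, i.e. the coefficient of \<open>dx\<^sub>I\<close> in the pullback of \<open>dy\<^sub>J\<close>.
\<close>

definition jacobian_minor :: "'p chart \<Rightarrow> 'p chart \<Rightarrow> nat set \<Rightarrow> nat set \<Rightarrow> (nat \<Rightarrow> real) \<Rightarrow> real" where
  "jacobian_minor c d J I x = Determinant.det (Matrix.mat (card J) (card I) (\<lambda>(a, b).
     pd (overlap c d) (sorted_list_of_set I ! b)
       (\<lambda>y. transition c d y (sorted_list_of_set J ! a)) x))"

text \<open>
  An orientation assigns to each chart \<open>c\<close> and each point of its domain a sign, locally constant in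
  the point, telling whether \<open>c\<close> is orientation preserving there.  In this form it also makes sense
  in dimension \<open>0\<close>, where it is a choice of sign at every point.
\<close>

definition orientation :: "nat \<Rightarrow> 'm topology \<Rightarrow> 'm chart set \<Rightarrow> ('m chart \<Rightarrow> 'm \<Rightarrow> real) \<Rightarrow> bool" where
  "orientation n X S sg \<longleftrightarrow>
     (\<forall>c\<in>S. sg c ` fst c \<subseteq> {-1, 1} \<and> continuous_map (subtopology X (fst c)) euclideanreal (sg c)) \<and>
     (\<forall>c\<in>S. \<forall>d\<in>S. \<forall>p \<in> fst c \<inter> fst d.
        sg c p = sgn (jacobian_minor c d {..<n} {..<n} (snd c p)) * sg d p)"

section \<open>Differential forms\<close>

text \<open>
  A complex-valued \<open>k\<close>-form on a manifold (possibly with boundary) with \<open>N\<close>-dimensional atlas \<open>S\<close> is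
  given by its local coordinate expressions \<open>\<Sum>\<^sub>I \<omega> c I dx\<^sub>I\<close>, one for each chart \<open>c\<close>, which agree on
  overlaps under pullback.  Here \<open>dx\<^sub>I\<close> is the wedge product of the \<open>dx\<^sub>i\<close>, \<open>i \<in> I\<close>, in increasing
  order.  Coefficients are \<open>0\<close> where they have no meaning, so that equal forms are equal functions.
\<close>

type_synonym 'p form = "'p chart \<Rightarrow> nat set \<Rightarrow> (nat \<Rightarrow> real) \<Rightarrow> complex"

definition diff_forms :: "nat \<Rightarrow> 'p chart set \<Rightarrow> nat \<Rightarrow> 'p form set" where
  "diff_forms N S k = {\<omega>.
     (\<forall>c I x. \<not> (c \<in> S \<and> I \<subseteq> {..<N} \<and> card I = k \<and> x \<in> chart_image c) \<longrightarrow> \<omega> c I x = 0) \<and>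
     (\<forall>c\<in>S. \<forall>I. I \<subseteq> {..<N} \<and> card I = k \<longrightarrow> smooth_coords N (chart_image c) (\<omega> c I)) \<and>
     (\<forall>c\<in>S. \<forall>d\<in>S. \<forall>I. I \<subseteq> {..<N} \<and> card I = k \<longrightarrow> (\<forall>x\<in>overlap c d.
        \<omega> c I x = (\<Sum>J | J \<subseteq> {..<N} \<and> card J = k.
          \<omega> d J (transition c d x) * complex_of_real (jacobian_minor c d J I x))))}"

text \<open>
  The sign moves \<open>dx\<^sub>i\<close> from the front of \<open>dx\<^sub>i \<and> dx\<^sub>I\<^sub>-\<^sub>i\<close> to its place in \<open>dx\<^sub>I\<close>.
\<close>

definition ext_d :: "nat \<Rightarrow> 'p chart set \<Rightarrow> 'p form \<Rightarrow> 'p form" where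
  "ext_d N S \<omega> = (\<lambda>c I x. if c \<in> S \<and> I \<subseteq> {..<N} \<and> x \<in> chart_image c
     then \<Sum>i\<in>I. (-1) ^ card {j\<in>I. j < i} * pd (chart_image c) i (\<omega> c (I - {i})) x else 0)"

section \<open>Cohomology\<close>

definition form_scale :: "complex \<Rightarrow> 'p form \<Rightarrow> 'p form" where
  "form_scale a \<omega> = (\<lambda>c I x. a * \<omega> c I x)"

definition cocycles :: "(nat \<Rightarrow> 'p form set) \<Rightarrow> ('p form \<Rightarrow> 'p form) \<Rightarrow> nat \<Rightarrow> 'p form set" where
  "cocycles \<Omega> d k = {\<omega> \<in> \<Omega> k. d \<omega> = 0}"

definition coboundaries :: "(nat \<Rightarrow> 'p form set) \<Rightarrow> ('p form \<Rightarrow> 'p form) \<Rightarrow> nat \<Rightarrow> 'p form set" where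
  "coboundaries \<Omega> d k = (case k of 0 \<Rightarrow> {0} | Suc j \<Rightarrow> d ` \<Omega> j)"

definition cocycle_group :: "(nat \<Rightarrow> 'p form set) \<Rightarrow> ('p form \<Rightarrow> 'p form) \<Rightarrow> nat \<Rightarrow> 'p form monoid" where
  "cocycle_group \<Omega> d k = \<lparr>carrier = cocycles \<Omega> d k, monoid.mult = (+), one = 0\<rparr>"

definition cohomology :: "(nat \<Rightarrow> 'p form set) \<Rightarrow> ('p form \<Rightarrow> 'p form) \<Rightarrow> nat \<Rightarrow> 'p form set monoid" where
  "cohomology \<Omega> d k = cocycle_group \<Omega> d k Mod coboundaries \<Omega> d k"

definition coho_class ::
    "(nat \<Rightarrow> 'p form set) \<Rightarrow> ('p form \<Rightarrow> 'p form) \<Rightarrow> nat \<Rightarrow> 'p form \<Rightarrow> 'p form set" where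
  "coho_class \<Omega> d k \<omega> = coboundaries \<Omega> d k #>\<^bsub>cocycle_group \<Omega> d k\<^esub> \<omega>"

text \<open>
  The map \<open>f\<close> on forms induces an isomorphism of complex vector spaces from the \<open>k\<close>-th cohomology of
  the complex \<open>(\<Omega>, d)\<close> to the \<open>l\<close>-th cohomology of the complex \<open>(\<Omega>', d')\<close>.
\<close>

definition induces_cohomology_iso ::
    "('p form \<Rightarrow> 'q form) \<Rightarrow> (nat \<Rightarrow> 'p form set) \<Rightarrow> ('p form \<Rightarrow> 'p form) \<Rightarrow> nat
      \<Rightarrow> (nat \<Rightarrow> 'q form set) \<Rightarrow> ('q form \<Rightarrow> 'q form) \<Rightarrow> nat \<Rightarrow> bool" where
  "induces_cohomology_iso f \<Omega> d k \<Omega>' d' l \<longleftrightarrow>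
     f ` cocycles \<Omega> d k \<subseteq> cocycles \<Omega>' d' l \<and>
     f ` coboundaries \<Omega> d k \<subseteq> coboundaries \<Omega>' d' l \<and>
     (\<exists>\<Phi> \<in> iso (cohomology \<Omega> d k) (cohomology \<Omega>' d' l). \<forall>\<omega>\<in>cocycles \<Omega> d k.
        \<Phi> (coho_class \<Omega> d k \<omega>) = coho_class \<Omega>' d' l (f \<omega>) \<and>
        (\<forall>a. \<Phi> (coho_class \<Omega> d k (form_scale a \<omega>)) = coho_class \<Omega>' d' l (form_scale a (f \<omega>))))"

section \<open>Forms on the half-cylinder over \<open>M\<close> and fiber integration\<close>

text \<open>
  The product of \<open>[0,\<infinity>)\<close> with an \<open>n\<close>-dimensional manifold has the atlas of product charts, in
  which \<open>r\<close> is the last coordinate, with index \<open>n\<close>.  The coefficient of \<open>dx\<^sub>J \<and> dr\<close> is thus the one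
  with index set \<open>insert n J\<close>.
\<close>

definition cyl_chart :: "nat \<Rightarrow> 'm chart \<Rightarrow> (real \<times> 'm) chart" where
  "cyl_chart n c = ({0..} \<times> fst c, \<lambda>(r, p). (snd c p)(n := r))"

definition forms_A0 ::
    "nat \<Rightarrow> 'm chart set \<Rightarrow> (real \<Rightarrow> complex) topology \<Rightarrow> nat \<Rightarrow> (real \<times> 'm) form set" where
  "forms_A0 n S T k = {\<omega> \<in> diff_forms (Suc n) (cyl_chart n ` S) k.
     (\<exists>\<epsilon>>0. \<forall>c\<in>S. \<forall>I y. y n < \<epsilon> \<longrightarrow> \<omega> (cyl_chart n c) I y = 0) \<and>
     (\<forall>c\<in>S. \<forall>I. I \<subseteq> {..<Suc n} \<and> card I = k \<longrightarrow>
        (\<forall>x\<in>chart_image c. (\<lambda>r. \<omega> (cyl_chart n c) I (x(n := r))) \<in> topspace T) \<and>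
        smooth_into n (chart_image c) T (\<lambda>x r. \<omega> (cyl_chart n c) I (x(n := r))))}"

definition fiber_integral ::
    "nat \<Rightarrow> 'm chart set \<Rightarrow> ((real \<Rightarrow> complex) \<Rightarrow> complex) \<Rightarrow> (real \<times> 'm) form \<Rightarrow> 'm form" where
  "fiber_integral n S fint \<omega> = (\<lambda>c J x. if c \<in> S \<and> J \<subseteq> {..<n} \<and> x \<in> chart_image c
     then fint (\<lambda>r. \<omega> (cyl_chart n c) (insert n J) (x(n := r))) else 0)"

end

theory Submission
  imports Defs
begin

text \<open>
  Choose \<open>e\<close> in the admissible space, vanishing near \<open>0\<close>, with \<open>fint e = 1\<close>.  On functions \<open>f\<close> that
  vanish near \<open>0\<close>, the operator \<open>P f = \<integral>\<^sub>0\<^sup>r (f - fint f \<cdot> e)\<close> satisfies \<open>(P f)' = f - fint f \<cdot> e\<close> and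
  \<open>P (f') = f\<close>.  Applying \<open>P\<close>, up to sign, to the coefficients of \<open>dx\<^sub>J \<and> dr\<close> gives an operator \<open>K\<close> with
  \<open>\<omega> = d K \<omega> + \<pi>\<^sub>* \<omega> \<and> e dr\<close> for every closed form \<open>\<omega>\<close>, while \<open>\<phi> \<mapsto> \<phi> \<and> e dr\<close> commutes with \<open>d\<close> and is
  a right inverse of \<open>\<pi>\<^sub>*\<close>.  These operators are compatible with changes of charts because
  the Jacobian of a change of product charts is block diagonal.

  Neither \<open>fint\<close> nor \<open>P\<close> is assumed continuous, but their values on smooth families must be smooth.
  The functions vanishing for \<open>r < \<epsilon>\<close> form a closed subspace, on which \<open>f \<mapsto> (P f, fint f)\<close> has a
  closed graph, so that it is continuous by the closed graph theorem for Frechet spaces.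
\<close>

section \<open>The closed graph theorem for spaces of functions\<close>

text \<open>The axioms (b) and (c) speak only of functions that vanish near 0, and these need not
  form a complete space. Fixing one \<epsilon> repairs this, and the definition of the forms
  supplies a single \<epsilon> for all charts and coefficients. The existence of \<open>e\<close>
  needs an argument, because \<open>fint\<close> is only known to be non-zero on the whole space:
  either it is a non-zero multiple of the integral on compactly supported functions, or it ignores
  what happens near 0. The coefficients of a form are smooth as maps into the Frechet space: their
  derivatives are limits of difference quotients there, so a linear operator that preserves limits
  commutes with the derivatives along M. For the coefficient of \<open>dx_I\<close> of a closed
  form, the formula is \<open>P\<close> applied to the coefficient of \<open>dx_I \<and> dr\<close>
  in the equation d \<omega> = 0: the term with the r-derivative returns the coefficient itself, by
  P (f') = f, and the other terms make up d K \<omega>. In degree 0 the same identity kills every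
  closed function.\<close>

locale seminormed_space =
  fixes A :: "('x \<Rightarrow> complex) set" and q :: "nat \<Rightarrow> ('x \<Rightarrow> complex) \<Rightarrow> real"
  assumes subspace: "complex_subspace A"
    and seminorm: "\<And>j. seminorm_on A (q j)"
begin

lemma zero_mem [simp, intro]: "0 \<in> A"
  using subspace unfolding complex_subspace_def by blast

lemma add_mem [intro]: "f \<in> A \<Longrightarrow> g \<in> A \<Longrightarrow> f + g \<in> A"
  using subspace unfolding complex_subspace_def by blast

lemma scale_mem [intro]: "f \<in> A \<Longrightarrow> (\<lambda>x. a * f x) \<in> A"
  using subspace unfolding complex_subspace_def by blast

lemma diff_mem [intro]: "f \<in> A \<Longrightarrow> g \<in> A \<Longrightarrow> f - g \<in> A"
proof -
  assume "f \<in> A" "g \<in> A"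
  then have "f + (\<lambda>x. (-1) * g x) \<in> A"
    by blast
  moreover have "f + (\<lambda>x. (-1) * g x) = f - g"
    by auto
  ultimately show ?thesis by simp
qed

lemma seminorm_add: "f \<in> A \<Longrightarrow> g \<in> A \<Longrightarrow> q j (f + g) \<le> q j f + q j g"
  using seminorm unfolding seminorm_on_def by blast

lemma seminorm_scale: "f \<in> A \<Longrightarrow> q j (\<lambda>x. a * f x) = cmod a * q j f"
  using seminorm unfolding seminorm_on_def by blast

lemma seminorm_zero [simp]: "q j 0 = 0"
proof -
  have "(\<lambda>x. 0 * (0 :: 'x \<Rightarrow> complex) x) = 0"
    by auto
  then show ?thesis
    using seminorm_scale[OF zero_mem, of j 0] by simp
qed

lemma seminorm_diff_commute:
  assumes "f \<in> A" "g \<in> A" shows "q j (f - g) = q j (g - f)"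
proof -
  have "(\<lambda>x. (-1) * (f - g) x) = g - f"
    by auto
  then show ?thesis
    using seminorm_scale[OF diff_mem[OF assms], of j "-1"] by simp
qed

lemma seminorm_triangle:
  assumes "f \<in> A" "g \<in> A" "h \<in> A" shows "q j (f - h) \<le> q j (f - g) + q j (g - h)"
proof -
  have "(f - g) + (g - h) = f - h"
    by auto
  then show ?thesis
    using seminorm_add[of "f - g" "g - h" j] assms by auto
qed

lemma seminorm_diff:
  assumes "f \<in> A" "g \<in> A" shows "q j (f - g) \<le> q j f + q j g"
  using seminorm_triangle[of f 0 g j] seminorm_diff_commute[of 0 g j] assms by simp

lemma seminorm_nonneg:
  assumes "f \<in> A" shows "0 \<le> q j f"
  using seminorm_diff[OF assms assms, of j] by simp

lemma seminorm_reverse_triangle: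
  assumes "f \<in> A" "g \<in> A" shows "\<bar>q j f - q j g\<bar> \<le> q j (f - g)"
  using seminorm_triangle[of f g 0 j] seminorm_triangle[of g f 0 j] seminorm_diff_commute[of f g j] assms
  by auto

lemma topspace_seminorm_topology [simp]: "topspace (seminorm_topology A q) = A"
proof -
  have "openin (seminorm_topology A q) A"
    unfolding openin_seminorm_topology by (auto intro: exI[of _ 1])
  then show ?thesis
    by (metis openin_seminorm_topology openin_topspace openin_subset subset_antisym)
qed

lemma openin_ball:
  assumes "f \<in> A"
  shows "openin (seminorm_topology A q) {g \<in> A. q j (g - f) < e}"
  unfolding openin_seminorm_topology
proof (intro conjI ballI)
  fix g assume "g \<in> {g \<in> A. q j (g - f) < e}"
  then have g: "g \<in> A" "q j (g - f) < e"
    by auto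
  have "h \<in> {g \<in> A. q j (g - f) < e}" if "h \<in> A" "\<forall>i\<le>j. q i (h - g) < e - q j (g - f)" for h
    using that seminorm_triangle[of h g f j] g(1) assms by force
  then show "\<exists>N. \<exists>d>0. \<forall>h\<in>A. (\<forall>i\<le>N. q i (h - g) < d) \<longrightarrow> h \<in> {g \<in> A. q j (g - f) < e}"
    using g(2) by (intro exI[of _ j] exI[of _ "e - q j (g - f)"]) auto
qed auto

text \<open>A basic neighbourhood uses finitely many seminorms, which is why convergence in each one
  suffices. Membership in \<open>A\<close> is required separately, since the seminorms carry no
  information off \<open>A\<close>.\<close>

lemma limitin_seminorm_topology:
  "limitin (seminorm_topology A q) f l F \<longleftrightarrow>
    l \<in> A \<and> eventually (\<lambda>x. f x \<in> A) F \<and> (\<forall>j. ((\<lambda>x. q j (f x - l)) \<longlongrightarrow> 0) F)"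
  (is "?L \<longleftrightarrow> ?R")
proof
  assume L: ?L
  then have l: "l \<in> A"
    using limitin_topspace by fastforce
  have ev: "eventually (\<lambda>x. f x \<in> A \<and> q j (f x - l) < e) F" if "e > 0" for j e
    using limitinD[OF L openin_ball[OF l, of j e]] l that by simp
  have "((\<lambda>x. q j (f x - l)) \<longlongrightarrow> 0) F" for j
  proof (rule tendstoI)
    fix e :: real assume "e > 0"
    from ev[OF this, of j] show "eventually (\<lambda>x. dist (q j (f x - l)) 0 < e) F"
      by eventually_elim (use l seminorm_nonneg[OF diff_mem] in \<open>auto simp: dist_real_def\<close>)
  qed
  moreover have "eventually (\<lambda>x. f x \<in> A) F"
    by (rule eventually_mono[OF ev[where e = 1 and j = 0]]) auto
  ultimately show ?R
    using l by simp
next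
  assume R: ?R
  show ?L
    unfolding limitin_def
  proof (intro conjI allI impI)
    show "l \<in> topspace (seminorm_topology A q)"
      using R by simp
    fix U assume "openin (seminorm_topology A q) U \<and> l \<in> U"
    then obtain N e where e: "e > 0" "\<And>g. g \<in> A \<Longrightarrow> \<forall>j\<le>N. q j (g - l) < e \<Longrightarrow> g \<in> U"
      unfolding openin_seminorm_topology by blast
    have "eventually (\<lambda>x. q j (f x - l) < e) F" for j
      using R order_tendstoD(2)[of _ 0 F e] e(1) by blast
    then have "eventually (\<lambda>x. \<forall>j\<in>{..N}. q j (f x - l) < e) F"
      by (intro eventually_ball_finite) auto
    then show "eventually (\<lambda>x. f x \<in> U) F"
      using R[THEN conjunct2, THEN conjunct1] by eventually_elim (use e(2) in auto)
  qed
qed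

end

locale complete_seminormed_space = seminormed_space +
  assumes complete: "\<And>s. range s \<subseteq> A \<Longrightarrow>
    (\<And>j e. e > 0 \<Longrightarrow> \<exists>N. \<forall>k\<ge>N. \<forall>l\<ge>N. q j (s k - s l) < e) \<Longrightarrow>
    \<exists>f\<in>A. \<forall>j. (\<lambda>k. q j (s k - f)) \<longlonglongrightarrow> 0"
begin

text \<open>The Baire category theorem in elementary form: one \<open>E m\<close> is dense in some
  ball. Otherwise every ball contains a smaller one that misses \<open>E m\<close>; with radii
  halving and more and more seminorms under control, the centres form a Cauchy sequence, and its
  limit lies in no \<open>E m\<close>.\<close>

lemma baire:
  assumes cover: "A \<subseteq> (\<Union>m::nat. E m)"
  shows "\<exists>m. \<exists>f\<in>A. \<exists>N. \<exists>d>0. \<forall>g\<in>A. (\<forall>i\<le>N. q i (g - f) < d) \<longrightarrow>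
    (\<forall>N'. \<forall>d'>0. \<exists>h\<in>A. h \<in> E m \<and> (\<forall>i\<le>N'. q i (h - g) \<le> d'))"
proof (rule ccontr)
  assume contra: "\<not> ?thesis"
  have escape: "\<exists>g\<in>A. \<exists>N' d'. (\<forall>i\<le>N. q i (g - f) < d) \<and> d' > 0 \<and>
      (\<forall>h\<in>A. (\<forall>i\<le>N'. q i (h - g) \<le> d') \<longrightarrow> h \<notin> E m)"
    if "f \<in> A" "d > 0" for m f N d
    using contra that by (metis (no_types, lifting))
  \<comment> \<open>A triple stands for a ball: its centre, the last seminorm index and the radius.
    In \<open>step\<close> the index grows and the radius halves, so that in the end every seminorm
    is controlled.\<close>
  define good where "good = (\<lambda>(f, N, d). f \<in> A \<and> (d::real) > 0 \<and> (N::nat) \<ge> 0)"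
  define step where "step = (\<lambda>m (f, N, d) (g, N', d').
    N' \<ge> Suc N \<and> d' \<le> d / 2 \<and>
    (\<forall>h\<in>A. (\<forall>i\<le>N'. q i (h - g) \<le> d') \<longrightarrow> h \<notin> E m \<and> (\<forall>i\<le>N. q i (h - f) \<le> d)))"
  have "\<exists>y. good y \<and> step m x y" if "good x" for x m
  proof -
    obtain f N d where x: "x = (f, N, d)"
      by (cases x)
    with that have f: "f \<in> A" "d > 0"
      unfolding good_def by auto
    obtain g N' d' where g: "g \<in> A" "\<And>i. i \<le> N \<Longrightarrow> q i (g - f) < d" "d' > 0"
      "\<And>h. h \<in> A \<Longrightarrow> \<forall>i\<le>N'. q i (h - g) \<le> d' \<Longrightarrow> h \<notin> E m"
      using escape[OF f, of N m] by blast
    \<comment> \<open>The largest distance between the two centres in the old seminorms; a ball of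
      radius \<open>d - M\<close> about \<open>g\<close> stays inside the ball about
      \<open>f\<close>.\<close>
    define M where "M = Max ((\<lambda>i. q i (g - f)) ` {..N})"
    have M: "q i (g - f) \<le> M" if "i \<le> N" for i
      unfolding M_def using that by (intro Max_ge) auto
    have "M < d"
      unfolding M_def using g(2) by (subst Max_less_iff) auto
    define d'' where "d'' = min (d / 2) (min d' (d - M))"
    have d'': "d'' > 0" "d'' \<le> d / 2" "d'' \<le> d'" "d'' \<le> d - M"
      unfolding d''_def using \<open>d > 0\<close> \<open>d' > 0\<close> \<open>M < d\<close> by (simp_all add: min_def)
    have "q i (h - f) \<le> d" if "h \<in> A" "\<forall>i\<le>max (Suc N) N'. q i (h - g) \<le> d''" "i \<le> N" for h i
    proof -
      have "q i (h - g) \<le> d''"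
        using that by (meson le_SucI max.coboundedI1)
      then show ?thesis
        using seminorm_triangle[of h g f i] that(1) g(1) f(1) M[OF that(3)] d''(4) by linarith
    qed
    moreover have "h \<notin> E m" if "h \<in> A" "\<forall>i\<le>max (Suc N) N'. q i (h - g) \<le> d''" for h
    proof (rule g(4)[OF that(1)], intro allI impI)
      fix i assume "i \<le> N'"
      then have "q i (h - g) \<le> d''"
        using that(2) by (simp add: max.coboundedI2)
      then show "q i (h - g) \<le> d'"
        using d''(3) by linarith
    qed
    ultimately have "good (g, max (Suc N) N', d'')" "step m x (g, max (Suc N) N', d'')"
      unfolding good_def step_def x using g(1) d'' by auto
    then show ?thesis
      by blast
  qed
  moreover have "good (0, 0, 1)"
    unfolding good_def by auto
  ultimately obtain z where z: "\<And>m. good (z m)" "\<And>m. step m (z m) (z (Suc m))"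
    using dependent_nat_choice[of "\<lambda>m. good" step] by metis
  define f where "f m = fst (z m)" for m
  define N where "N m = fst (snd (z m))" for m
  define d where "d m = snd (snd (z m))" for m
  have zeq: "z m = (f m, N m, d m)" for m
    by (simp add: f_def N_def d_def)
  have fA: "f m \<in> A" and dpos: "d m > 0" for m
    using z(1)[of m] unfolding good_def zeq by auto
  have step: "Suc (N m) \<le> N (Suc m)" "d (Suc m) \<le> d m / 2" for m
    using z(2)[of m] unfolding step_def zeq by auto
  have stepE: "h \<notin> E m" if "h \<in> A" "\<forall>i\<le>N (Suc m). q i (h - f (Suc m)) \<le> d (Suc m)" for h m
    using z(2)[of m] that unfolding step_def zeq by auto
  have stepin: "\<forall>i\<le>N m. q i (h - f m) \<le> d m"
    if "h \<in> A" "\<forall>i\<le>N (Suc m). q i (h - f (Suc m)) \<le> d (Suc m)" for h m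
    using z(2)[of m] that unfolding step_def zeq by auto
  have nested: "\<forall>i\<le>N m. q i (h - f m) \<le> d m"
    if "h \<in> A" "\<forall>i\<le>N (m + k). q i (h - f (m + k)) \<le> d (m + k)" for h m k
    using that(2)
  proof (induction k)
    case (Suc k)
    then show ?case
      using stepin[OF that(1), of "m + k"] unfolding add_Suc_right by blast
  qed simp
  have near: "q i (f l - f m) \<le> d m" if "i \<le> N m" "m \<le> l" for i m l
    using nested[OF fA[of l], of m "l - m"] that dpos[of l] by (simp add: less_imp_le)
  have Nge: "N m \<ge> m" for m
  proof (induction m)
    case (Suc m)
    then show ?case
      using step(1)[of m] by linarith
  qed simp
  have dle: "d m \<le> d 0 * (1 / 2) ^ m" for m
  proof (induction m)
    case (Suc m)
    then show ?case
      using step(2)[of m] by simp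
  qed simp
  have "(\<lambda>m. d 0 * (1 / 2) ^ m) \<longlonglongrightarrow> 0"
    by (intro tendsto_mult_right_zero LIMSEQ_power_zero) auto
  then have dlim: "d \<longlonglongrightarrow> 0"
    by (intro tendsto_sandwich[OF _ _ tendsto_const, of 0 d sequentially] always_eventually)
       (use dpos dle less_imp_le in auto)
  have "\<exists>M. \<forall>k\<ge>M. \<forall>l\<ge>M. q j (f k - f l) < e" if e: "e > 0" for j e
  proof -
    obtain M where M: "M \<ge> j" "d M < e / 2"
    proof -
      have "eventually (\<lambda>m. d m < e / 2) sequentially"
        using order_tendstoD(2)[OF dlim, of "e / 2"] e by simp
      then have "eventually (\<lambda>m. m \<ge> j \<and> d m < e / 2) sequentially"
        using eventually_ge_at_top[of j] by eventually_elim auto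
      then show thesis
        using that eventually_happens' sequentially_bot by blast
    qed
    have "q j (f k - f l) < e" if "k \<ge> M" "l \<ge> M" for k l
    proof -
      have "j \<le> N M"
        using Nge[of M] M(1) by linarith
      then show ?thesis
        using near[of j M k] near[of j M l] that M(2) seminorm_triangle[of "f k" "f M" "f l" j] seminorm_diff_commute[of "f l" "f M" j] fA
        by force
    qed
    then show ?thesis by blast
  qed
  then obtain h where h: "h \<in> A" "\<And>j. (\<lambda>k. q j (f k - h)) \<longlonglongrightarrow> 0"
    using complete[of f] fA by blast
  \<comment> \<open>The balls are given by weak inequalities, so the limit of the centres stays in
    each of them.\<close>
  have "q i (h - f m) \<le> d m" if "i \<le> N m" for i m
  proof -
    have "(\<lambda>k. q i (f k - h) + d m) \<longlonglongrightarrow> 0 + d m"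
      by (intro tendsto_intros h(2))
    moreover have "eventually (\<lambda>k. q i (h - f m) \<le> q i (f k - h) + d m) sequentially"
      using eventually_ge_at_top[of m]
    proof eventually_elim
      case (elim k)
      show ?case
        using near[OF that elim] seminorm_triangle[of h "f k" "f m" i]
          seminorm_diff_commute[of h "f k" i] h(1) fA by force
    qed
    ultimately show ?thesis
      using tendsto_lowerbound[of _ "0 + d m"] by (metis add.left_neutral sequentially_bot)
  qed
  then have "h \<notin> E m" for m
    using stepE[OF h(1)] by blast
  with cover h(1) show False
    by blast
qed

end

text \<open>Banach's argument. The Baire theorem gives almost continuity: a small \<open>u\<close>
  is approximated by some \<open>h\<close> with \<open>L h\<close> small. Repeating this on the
  remainder writes \<open>u\<close> as a series whose images have a geometric majorant. The series
  of images converges by completeness of \<open>B\<close>, and the closed graph identifies its sum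
  with \<open>L u\<close>.\<close>

lemma closed_graph:
  fixes L :: "('x \<Rightarrow> complex) \<Rightarrow> ('y \<Rightarrow> complex)"
  assumes "complete_seminormed_space A p" and "complete_seminormed_space B q"
    and maps: "\<And>f. f \<in> A \<Longrightarrow> L f \<in> B"
    and add: "\<And>f g. f \<in> A \<Longrightarrow> g \<in> A \<Longrightarrow> L (f + g) = L f + L g"
    and scale: "\<And>a f. f \<in> A \<Longrightarrow> L (\<lambda>x. a * f x) = (\<lambda>x. a * L f x)"
    and graph: "\<And>s x y. range s \<subseteq> A \<Longrightarrow> x \<in> A \<Longrightarrow> y \<in> B \<Longrightarrow>
       (\<And>j. (\<lambda>k. p j (s k - x)) \<longlonglongrightarrow> 0) \<Longrightarrow> (\<And>j. (\<lambda>k. q j (L (s k) - y)) \<longlonglongrightarrow> 0) \<Longrightarrow> L x = y"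
    and "e > 0"
  shows "\<exists>N. \<exists>d>0. \<forall>f\<in>A. (\<forall>i\<le>N. p i f < d) \<longrightarrow> q j (L f) \<le> e"
proof -
  interpret X: complete_seminormed_space A p by fact
  interpret Y: complete_seminormed_space B q by fact
  have diff: "L (f - g) = L f - L g" if "f \<in> A" "g \<in> A" for f g
  proof -
    have "L (f - g) + L g = L f"
      using add[OF X.diff_mem[OF that] that(2)] by simp
    then show ?thesis
      by (metis add_diff_cancel)
  qed
  have dense: "\<exists>N. \<exists>d>0. \<forall>u\<in>A. (\<forall>i\<le>N. p i u < d) \<longrightarrow>
      (\<forall>N'. \<forall>d'>0. \<exists>h\<in>A. (\<forall>j\<le>J. q j (L h) < e) \<and> (\<forall>i\<le>N'. p i (u - h) < d'))"
    if "e > 0" for J e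
  proof -
    \<comment> \<open>The half in the bound leaves room for the difference of two elements of
      \<open>E m\<close>.\<close>
    define E where "E m = {f. \<forall>j\<le>J. q j (L f) < real (Suc m) * (e / 2)}" for m
    have "A \<subseteq> (\<Union>m. E m)"
    proof
      fix f assume "f \<in> A"
      define M where "M = Max ((\<lambda>j. q j (L f)) ` {..J})"
      have M: "q j (L f) \<le> M" if "j \<le> J" for j
        unfolding M_def using that by (intro Max_ge) auto
      obtain m where "M / (e / 2) < real m"
        using reals_Archimedean2 by blast
      then have "M < real m * (e / 2)"
        using \<open>e > 0\<close> by (simp add: field_simps)
      also have "\<dots> \<le> real (Suc m) * (e / 2)"
        using \<open>e > 0\<close> by (intro mult_right_mono) auto
      finally have "f \<in> E m"
        unfolding E_def using M by force
      then show "f \<in> (\<Union>m. E m)"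
        by blast
    qed
    from X.baire[OF this] obtain m f N d where f: "f \<in> A" "d > 0"
      and approx: "\<And>g N' d'. g \<in> A \<Longrightarrow> \<forall>i\<le>N. p i (g - f) < d \<Longrightarrow> d' > 0 \<Longrightarrow>
        \<exists>h\<in>A. h \<in> E m \<and> (\<forall>i\<le>N'. p i (h - g) \<le> d')"
      by metis
    define b where "b = real (Suc m)"
    have b: "b \<ge> 1" "cmod (complex_of_real b) = b" "cmod (complex_of_real (1 / b)) = 1 / b"
      unfolding b_def by (auto simp flip: of_nat_Suc simp: norm_divide)
    have "\<exists>h\<in>A. (\<forall>j\<le>J. q j (L h) < e) \<and> (\<forall>i\<le>N'. p i (u - h) < d')"
      if u: "u \<in> A" "\<forall>i\<le>N. p i u < d / b" and "d' > 0" for u N' d'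
    proof -
      \<comment> \<open>Both \<open>?g\<close> and \<open>f\<close> lie in the ball where
        \<open>E m\<close> is dense. The difference of their approximants, divided by
        \<open>b\<close>, approximates \<open>u\<close>, and this division turns the bound
        \<open>b * e\<close> on the image into \<open>e\<close>.\<close>
      let ?g = "f + (\<lambda>x. complex_of_real b * u x)"
      have g: "?g \<in> A"
        using f u by blast
      have "?g - f = (\<lambda>x. complex_of_real b * u x)"
        by auto
      then have "p i (?g - f) < d" if "i \<le> N" for i
        using u that b X.seminorm_scale[OF u(1), of i "complex_of_real b"]
        by (auto simp: field_simps)
      then obtain h1 where h1: "h1 \<in> A" "h1 \<in> E m" "\<And>i. i \<le> N' \<Longrightarrow> p i (h1 - ?g) \<le> d' / 3"
        using approx[OF g, of "d' / 3" N'] \<open>d' > 0\<close> by auto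
      obtain h2 where h2: "h2 \<in> A" "h2 \<in> E m" "\<And>i. i \<le> N' \<Longrightarrow> p i (h2 - f) \<le> d' / 3"
        using approx[OF f(1), of "d' / 3" N'] \<open>d' > 0\<close> f(2) by auto
      let ?h = "\<lambda>x. complex_of_real (1 / b) * (h1 - h2) x"
      have h: "?h \<in> A"
        using h1(1) h2(1) by blast
      have "q j (L ?h) < e" if "j \<le> J" for j
      proof -
        have "q j (L ?h) = (1 / b) * q j (L h1 - L h2)"
          unfolding scale[OF X.diff_mem[OF h1(1) h2(1)]] diff[OF h1(1) h2(1)]
          using Y.seminorm_scale[OF Y.diff_mem[OF maps[OF h1(1)] maps[OF h2(1)]], of j "complex_of_real (1 / b)"]
          unfolding b(3) .
        also have "\<dots> \<le> (1 / b) * (q j (L h1) + q j (L h2))"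
          using b(1) h1(1) h2(1) by (intro mult_left_mono Y.seminorm_diff maps) auto
        also have "\<dots> < (1 / b) * (b * (e / 2) + b * (e / 2))"
          using b(1) h1(2) h2(2) that unfolding E_def b_def[symmetric]
          by (intro mult_strict_left_mono add_strict_mono) auto
        also have "\<dots> = e"
          using b(1) by (simp add: field_simps)
        finally show ?thesis .
      qed
      moreover have "p i (u - ?h) < d'" if "i \<le> N'" for i
      proof -
        have "u - ?h = (\<lambda>x. complex_of_real (1 / b) * ((h2 - f) - (h1 - ?g)) x)"
          using b(1) by (auto simp: fun_eq_iff field_simps)
        then have "p i (u - ?h) = (1 / b) * p i ((h2 - f) - (h1 - ?g))"
          using b(3) X.seminorm_scale[of "(h2 - f) - (h1 - ?g)" i] h1(1) h2(1) g f(1)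
          by (metis X.diff_mem)
        also have "\<dots> \<le> (1 / b) * (p i (h2 - f) + p i (h1 - ?g))"
          using b(1) h1(1) h2(1) g f(1) by (intro mult_left_mono X.seminorm_diff) auto
        also have "\<dots> \<le> 1 * (d' / 3 + d' / 3)"
          using b(1) h1(1,3) h2(1,3) that g f(1)
          by (intro mult_mono add_mono) (auto intro!: add_nonneg_nonneg X.seminorm_nonneg)
        also have "\<dots> < d'"
          using \<open>d' > 0\<close> by simp
        finally show ?thesis .
      qed
      ultimately show ?thesis
        using h by blast
    qed
    moreover have "d / b > 0"
      using f(2) b(1) by simp
    ultimately show ?thesis
      by blast
  qed
  \<comment> \<open>Summed over all \<open>k\<close>, these tolerances give
    \<open>e\<close>.\<close>
  define e' where "e' k = e / 2 ^ Suc k" for k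
  have "\<forall>k. \<exists>N d. d > 0 \<and> (\<forall>u\<in>A. (\<forall>i\<le>N. p i u < d) \<longrightarrow>
      (\<forall>N'. \<forall>d'>0. \<exists>h\<in>A. (\<forall>i\<le>j + k. q i (L h) < e' k) \<and> (\<forall>i\<le>N'. p i (u - h) < d')))"
    using dense[of "e' k" "j + k" for k] \<open>e > 0\<close> unfolding e'_def by (metis divide_pos_pos zero_less_numeral zero_less_power)
  then obtain N d where d: "\<And>k. d k > (0::real)"
    and approx: "\<And>k u N' d'. u \<in> A \<Longrightarrow> \<forall>i\<le>N k. p i u < d k \<Longrightarrow> d' > 0 \<Longrightarrow>
      \<exists>h\<in>A. (\<forall>i\<le>j + k. q i (L h) < e' k) \<and> (\<forall>i\<le>(N'::nat). p i (u - h) < d')"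
    by metis
  have "q j (L u) \<le> e" if u: "u \<in> A" "\<forall>i\<le>N 0. p i u < d 0" for u
  proof -
    \<comment> \<open>The sequence \<open>v\<close> consists of the remainders left after
      subtracting the approximants chosen so far. The clause for \<open>k = 0\<close> pins down the
      start, and the second half of \<open>R\<close> makes the remainders tend to 0.\<close>
    define P where "P k v \<longleftrightarrow> v \<in> A \<and> (\<forall>i\<le>N k. p i v < d k) \<and> (k = 0 \<longrightarrow> v = u)" for k v
    define R where "R k v w \<longleftrightarrow> (\<forall>i\<le>j + k. q i (L (v - w)) < e' k) \<and> (\<forall>i\<le>k. p i w < 1 / real (Suc k))"
      for k v w
    have "\<exists>w. P (Suc k) w \<and> R k v w" if "P k v" for k v
    proof -
      have v: "v \<in> A" "\<forall>i\<le>N k. p i v < d k"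
        using that unfolding P_def by auto
      obtain h where h: "h \<in> A" "\<And>i. i \<le> j + k \<Longrightarrow> q i (L h) < e' k"
        "\<And>i. i \<le> max k (N (Suc k)) \<Longrightarrow> p i (v - h) < min (d (Suc k)) (1 / real (Suc k))"
        using approx[OF v, of "min (d (Suc k)) (1 / real (Suc k))" "max k (N (Suc k))"] d[of "Suc k"]
        by (auto simp del: of_nat_Suc)
      have "v - (v - h) = h"
        by simp
      then have "P (Suc k) (v - h)" "R k v (v - h)"
        unfolding P_def R_def using h v by auto
      then show ?thesis by blast
    qed
    moreover have "P 0 u"
      unfolding P_def using u by auto
    ultimately obtain v where v: "\<And>k. P k (v k)" "\<And>k. R k (v k) (v (Suc k))"
      using dependent_nat_choice[of P R] by metis
    have v0: "v 0 = u" and vA: "v k \<in> A" for k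
      using v(1) unfolding P_def by auto
    have vstep: "q i (L (v k - v (Suc k))) < e' k" if "i \<le> j + k" for i k
      using v(2) that unfolding R_def by blast
    have vlim: "(\<lambda>k. p i (v k)) \<longlonglongrightarrow> 0" for i
    proof -
      have "(\<lambda>k. 1 / real k) \<longlonglongrightarrow> 0"
        by (rule lim_1_over_n)
      moreover have "eventually (\<lambda>k. p i (v k) \<le> 1 / real k) sequentially"
        using eventually_gt_at_top[of i]
      proof eventually_elim
        case (elim k)
        then obtain k' where "k = Suc k'"
          by (cases k) auto
        then show ?case
          using v(2)[of k'] elim unfolding R_def by (simp add: less_imp_le del: of_nat_Suc)
      qed
      ultimately show ?thesis
        using tendsto_sandwich[OF _ _ tendsto_const, of 0 "\<lambda>k. p i (v k)" sequentially "\<lambda>k. 1 / real k" ]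
          X.seminorm_nonneg[OF vA] by (auto intro!: always_eventually)
    qed
    have tele: "q i (L (v m) - L (v (m + k))) \<le> e / 2 ^ m * (1 - 1 / 2 ^ k)" if "i \<le> j + m" for i m k
    proof (induction k)
      case (Suc k)
      have "q i (L (v m) - L (v (m + Suc k))) \<le> q i (L (v m) - L (v (m + k))) + q i (L (v (m + k)) - L (v (m + Suc k)))"
        by (intro Y.seminorm_triangle maps vA)
      also have "\<dots> \<le> e / 2 ^ m * (1 - 1 / 2 ^ k) + e' (m + k)"
        using vstep[of i "m + k"] that unfolding add_Suc_right diff[OF vA vA]
        by (intro add_mono Suc.IH) simp
      also have "\<dots> = e / 2 ^ m * (1 - 1 / 2 ^ Suc k)"
        by (simp add: e'_def field_simps power_add)
      finally show ?case .
    qed (simp add: zero_fun_def[symmetric])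
    have tele': "q i (L (v m) - L (v l)) \<le> e / 2 ^ m" if "i \<le> j + m" "m \<le> l" for i m l
    proof -
      have "q i (L (v m) - L (v l)) \<le> e / 2 ^ m * (1 - 1 / 2 ^ (l - m))"
        using tele[OF that(1), of "l - m"] that(2) by simp
      also have "\<dots> \<le> e / 2 ^ m * 1"
        using \<open>e > 0\<close> by (intro mult_left_mono) auto
      finally show ?thesis by simp
    qed
    \<comment> \<open>The partial sums of the series: they tend to \<open>u\<close>, and their
      images are Cauchy by the geometric bound.\<close>
    define s where "s k = u - v k" for k
    have Ls: "L (s k) = L u - L (v k)" for k
      unfolding s_def using u vA by (simp add: diff)
    have cauchy: "\<exists>M. \<forall>k\<ge>M. \<forall>l\<ge>M. q i (L (s k) - L (s l)) < e0" if e0: "e0 > 0" for i e0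
    proof -
      obtain M0 where M0: "2 * e * (1 / 2) ^ M0 < e0"
      proof -
        have "(\<lambda>m. 2 * e * (1 / 2) ^ m) \<longlonglongrightarrow> 0"
          by (intro tendsto_mult_right_zero LIMSEQ_power_zero) auto
        then have "eventually (\<lambda>m. 2 * e * (1 / 2) ^ m < e0) sequentially"
          using order_tendstoD(2) e0 by blast
        then show thesis
          using that eventually_happens' sequentially_bot by blast
      qed
      define M where "M = max M0 i"
      have "(1 / 2 :: real) ^ M \<le> (1 / 2) ^ M0"
        unfolding M_def by (intro power_decreasing) auto
      then have "2 * e * (1 / 2) ^ M \<le> 2 * e * (1 / 2) ^ M0"
        using \<open>e > 0\<close> by (intro mult_left_mono) auto
      with M0 have "2 * e * (1 / 2) ^ M < e0"
        by linarith
      then have M: "2 * (e / 2 ^ M) < e0"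
        by (simp add: power_one_over)
      have "q i (L (s k) - L (s l)) < e0" if "k \<ge> M" "l \<ge> M" for k l
      proof -
        have "L (s k) - L (s l) = (L (v M) - L (v k)) - (L (v M) - L (v l))"
          unfolding Ls by simp
        then have "q i (L (s k) - L (s l)) \<le> q i (L (v M) - L (v k)) + q i (L (v M) - L (v l))"
          using Y.seminorm_diff[OF Y.diff_mem[OF maps[OF vA] maps[OF vA]] Y.diff_mem[OF maps[OF vA] maps[OF vA]],
              of i M k M l] by simp
        also have "\<dots> \<le> e / 2 ^ M + e / 2 ^ M"
          using that by (intro add_mono tele') (auto simp: M_def)
        finally show ?thesis
          using M by simp
      qed
      then show ?thesis by blast
    qed
    have sA: "s k \<in> A" for k
      unfolding s_def by (rule X.diff_mem[OF u(1) vA])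
    then have "range (\<lambda>k. L (s k)) \<subseteq> B"
      using maps by auto
    from Y.complete[OF this cauchy] obtain y where y: "y \<in> B" "\<And>i. (\<lambda>k. q i (L (s k) - y)) \<longlonglongrightarrow> 0"
      by auto
    have "(\<lambda>k. p i (s k - u)) \<longlonglongrightarrow> 0" for i
    proof -
      have "p i (s k - u) = p i (v k)" for k
        using X.seminorm_diff_commute[OF sA u(1), of i k] unfolding s_def by simp
      then show ?thesis
        using vlim by simp
    qed
    then have "L u = y"
      using sA by (intro graph[of s u y] u y) auto
    have "(\<lambda>k. e + q j (L (s k) - y)) \<longlonglongrightarrow> e + 0"
      by (intro tendsto_intros y(2))
    moreover have "q j (L u) \<le> e + q j (L (s k) - y)" for k
    proof -
      have "q j (L (s k)) \<le> e"
        using tele'[of j 0 k] Ls[of k] v0 by simp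
      then show ?thesis
        using Y.seminorm_reverse_triangle[OF maps[OF sA] y(1), of j k] unfolding \<open>L u = y\<close> by linarith
    qed
    ultimately show ?thesis
      using tendsto_lowerbound[of _ "e + 0" sequentially "q j (L u)"] by (auto intro: always_eventually)
  qed
  then show ?thesis
    using d[of 0] by blast
qed

section \<open>Calculus on the half-line\<close>

text \<open>Holds even where there is no derivative, since both sides choose from the same set of
  candidates.\<close>

lemma vector_derivative_within_cong:
  assumes "\<And>t. t \<in> X \<Longrightarrow> f t = g t" and "a \<in> X"
  shows "vector_derivative f (at a within X) = vector_derivative g (at a within X)"
proof -
  have "(f has_vector_derivative d) (at a within X) \<longleftrightarrow> (g has_vector_derivative d) (at a within X)" for d
    using assms has_vector_derivative_transform by metis
  then show ?thesis
    unfolding vector_derivative_def by simp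
qed

lemma at_within_Ici_neq_bot:
  fixes x :: real
  assumes "0 \<le> x" shows "at x within {0..} \<noteq> bot"
proof -
  have "at_right x \<le> at x within {0..}"
    using assms by (intro at_le) auto
  then show ?thesis
    using trivial_limit_at_right_real[of x] by (metis bot.extremum_uniqueI trivial_limit_def)
qed

lemma ddx_eqI:
  assumes "0 \<le> x" "(f has_vector_derivative d) (at x within {0..})"
  shows "ddx f x = d"
  unfolding ddx_def using assms vector_derivative_within[OF at_within_Ici_neq_bot] by simp

lemma ddx_neg [simp]: "x < 0 \<Longrightarrow> ddx f x = 0"
  unfolding ddx_def by simp

lemma ddx_funpow_ddx: "(ddx ^^ j) (ddx f) = (ddx ^^ Suc j) f"
  by (simp add: funpow_swap1)

lemma smooth_half_line_neg: "f \<in> smooth_half_line \<Longrightarrow> x < 0 \<Longrightarrow> f x = 0"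
  unfolding smooth_half_line_def by blast

lemma smooth_half_line_ddx: "f \<in> smooth_half_line \<Longrightarrow> ddx f \<in> smooth_half_line"
  unfolding smooth_half_line_def by (simp add: ddx_funpow_ddx del: funpow.simps)

lemma smooth_half_line_funpow_ddx: "f \<in> smooth_half_line \<Longrightarrow> (ddx ^^ j) f \<in> smooth_half_line"
  by (induction j) (auto intro: smooth_half_line_ddx)

lemma has_ddx:
  assumes "f \<in> smooth_half_line" "0 \<le> x"
  shows "(f has_vector_derivative ddx f x) (at x within {0..})"
proof -
  have "(ddx ^^ 0) f differentiable (at x within {0..})"
    using assms unfolding smooth_half_line_def by blast
  then show ?thesis
    unfolding ddx_def using assms(2) by (simp add: vector_derivative_works)
qed

text \<open>All iterated derivatives stay in \<open>P\<close>. Exhibiting a stable set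
  \<open>P\<close> replaces formulas for the higher derivatives of products, primitives and cutoff
  functions.\<close>

lemma smooth_half_line_coinduct:
  assumes "f \<in> P"
    and "\<And>g x. g \<in> P \<Longrightarrow> x < 0 \<Longrightarrow> g x = 0"
    and "\<And>g x. g \<in> P \<Longrightarrow> 0 \<le> x \<Longrightarrow> g differentiable (at x within {0..})"
    and "\<And>g. g \<in> P \<Longrightarrow> ddx g \<in> P"
  shows "f \<in> smooth_half_line"
proof -
  have "(ddx ^^ j) f \<in> P" for j
    by (induction j) (auto intro: assms)
  then show ?thesis
    unfolding smooth_half_line_def using assms(1-3) by blast
qed

lemma has_ddx_lincomb:
  assumes "f \<in> smooth_half_line" "g \<in> smooth_half_line" "0 \<le> x"
  shows "((\<lambda>x. a * f x + b * g x) has_vector_derivative a * ddx f x + b * ddx g x) (at x within {0..})"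
  using assms by (intro has_vector_derivative_add has_vector_derivative_mult_right has_ddx)

lemma ddx_lincomb:
  assumes "f \<in> smooth_half_line" "g \<in> smooth_half_line"
  shows "ddx (\<lambda>x. a * f x + b * g x) = (\<lambda>x. a * ddx f x + b * ddx g x)"
proof
  fix x show "ddx (\<lambda>x. a * f x + b * g x) x = a * ddx f x + b * ddx g x"
    by (cases "x < 0") (use ddx_eqI[OF _ has_ddx_lincomb[OF assms]] in auto)
qed

lemma smooth_half_line_lincomb:
  assumes "f \<in> smooth_half_line" "g \<in> smooth_half_line"
  shows "(\<lambda>x. a * f x + b * g x) \<in> smooth_half_line"
proof (rule smooth_half_line_coinduct)
  let ?P = "{h. \<exists>f\<in>smooth_half_line. \<exists>g\<in>smooth_half_line. h = (\<lambda>x. a * f x + b * g x)}"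
  show "(\<lambda>x. a * f x + b * g x) \<in> ?P"
    using assms by blast
  show "g x = 0" if "g \<in> ?P" "x < 0" for g x
    using that by (auto simp: smooth_half_line_neg)
  show "g differentiable (at x within {0..})" if "g \<in> ?P" "0 \<le> x" for g x
    using that by (auto intro: differentiableI_vector[OF has_ddx_lincomb])
  show "ddx g \<in> ?P" if "g \<in> ?P" for g
    using that ddx_lincomb smooth_half_line_ddx by blast
qed

lemma ddx_funpow_lincomb:
  assumes "f \<in> smooth_half_line" "g \<in> smooth_half_line"
  shows "(ddx ^^ j) (\<lambda>x. a * f x + b * g x) = (\<lambda>x. a * (ddx ^^ j) f x + b * (ddx ^^ j) g x)"
  by (induction j) (use assms in \<open>simp_all add: ddx_lincomb smooth_half_line_funpow_ddx\<close>)

lemma zero_smooth_half_line [simp]: "0 \<in> smooth_half_line"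
proof (rule smooth_half_line_coinduct[of _ "{0}"])
  have "ddx 0 = 0"
  proof
    fix x show "ddx 0 x = 0 x"
      by (cases "x < 0") (auto intro!: ddx_eqI simp: zero_fun_def)
  qed
  then show "ddx g \<in> {0}" if "g \<in> {0}" for g
    using that by simp
qed (auto simp: zero_fun_def)

lemma smooth_half_line_subspace: "complex_subspace smooth_half_line"
  unfolding complex_subspace_def
proof (intro conjI ballI allI)
  fix f g a assume "f \<in> smooth_half_line"
  then show "(\<lambda>x. a * f x) \<in> smooth_half_line"
    using smooth_half_line_lincomb[of f f a 0] by simp
  assume "g \<in> smooth_half_line"
  then show "f + g \<in> smooth_half_line"
    using smooth_half_line_lincomb[of f g 1 1] \<open>f \<in> smooth_half_line\<close> by (simp add: plus_fun_def)
qed auto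

text \<open>The stable set for products: by the Leibniz rule the derivative of a product is a sum of
  two products, so sums have to be included.\<close>

inductive_set product_sums :: "(real \<Rightarrow> complex) set" where
  product: "f \<in> smooth_half_line \<Longrightarrow> g \<in> smooth_half_line \<Longrightarrow> (\<lambda>x. f x * g x) \<in> product_sums"
| sum: "f \<in> product_sums \<Longrightarrow> g \<in> product_sums \<Longrightarrow> (\<lambda>x. f x + g x) \<in> product_sums"

lemma product_sums_ddx:
  assumes "h \<in> product_sums"
  shows "\<exists>h'\<in>product_sums. (\<forall>x<0. h x = 0 \<and> h' x = 0) \<and>
    (\<forall>x\<ge>0. (h has_vector_derivative h' x) (at x within {0..}))"
  using assms
proof induction
  case (product f g)
  let ?h = "\<lambda>x. f x * ddx g x + ddx f x * g x"
  have "?h \<in> product_sums"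
    using product by (intro product_sums.intros smooth_half_line_ddx)
  moreover have "((\<lambda>x. f x * g x) has_vector_derivative ?h x) (at x within {0..})" if "0 \<le> x" for x
    using product that by (intro has_vector_derivative_mult has_ddx)
  moreover have "\<forall>x<0. f x * g x = 0 \<and> ?h x = 0"
    using product by (simp add: smooth_half_line_neg)
  ultimately show ?case
    by (intro bexI[of _ ?h]) auto
next
  case (sum f g)
  then obtain f' g' where "f' \<in> product_sums" "g' \<in> product_sums"
    "\<forall>x<0. f x = 0 \<and> f' x = 0" "\<forall>x<0. g x = 0 \<and> g' x = 0"
    "\<forall>x\<ge>0. (f has_vector_derivative f' x) (at x within {0..})"
    "\<forall>x\<ge>0. (g has_vector_derivative g' x) (at x within {0..})"
    by blast
  then show ?case
    by (intro bexI[of _ "\<lambda>x. f' x + g' x"]) (auto intro: has_vector_derivative_add product_sums.sum)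
qed

lemma smooth_half_line_mult:
  assumes "f \<in> smooth_half_line" "g \<in> smooth_half_line"
  shows "(\<lambda>x. f x * g x) \<in> smooth_half_line"
proof (rule smooth_half_line_coinduct[of _ product_sums])
  show "ddx h \<in> product_sums" if h: "h \<in> product_sums" for h
  proof -
    obtain h' where h': "h' \<in> product_sums" "\<forall>x<0. h' x = 0"
      "\<And>x. x \<ge> 0 \<Longrightarrow> (h has_vector_derivative h' x) (at x within {0..})"
      using product_sums_ddx[OF h] by blast
    have "ddx h x = h' x" for x
      by (cases "x < 0") (use h' ddx_eqI in auto)
    then have "ddx h = h'"
      by blast
    with h' show ?thesis
      by simp
  qed
  show "h differentiable (at x within {0..})" if "h \<in> product_sums" "0 \<le> x" for h x
    using product_sums_ddx[OF that(1)] that(2) differentiableI_vector by blast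
qed (use assms product_sums_ddx in \<open>auto intro: product_sums.intros\<close>)

lemma continuous_on_smooth_half_line:
  assumes "f \<in> smooth_half_line" shows "continuous_on {0..} f"
  using has_ddx[OF assms] has_vector_derivative_continuous
  by (fastforce simp: continuous_on_eq_continuous_within)

section \<open>The seminorms of the topology of smooth functions\<close>

definition smooth_seminorm :: "nat \<Rightarrow> (real \<Rightarrow> complex) \<Rightarrow> real" where
  "smooth_seminorm N f = (SUP (j, x) \<in> {..N} \<times> {0..real N}. cmod ((ddx ^^ j) f x))"

text \<open>Continuity on a compact interval bounds the set under the supremum, without which
  \<open>SUP\<close> would say nothing.\<close>

lemma smooth_seminorm_upper:
  assumes f: "f \<in> smooth_half_line" and "j \<le> N" "0 \<le> x" "x \<le> real N"
  shows "cmod ((ddx ^^ j) f x) \<le> smooth_seminorm N f"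
proof -
  have "bdd_above ((\<lambda>x. cmod ((ddx ^^ j) f x)) ` {0..real N})" for j
  proof (intro bounded_imp_bdd_above compact_imp_bounded compact_continuous_image)
    have "continuous_on {0..} ((ddx ^^ j) f)"
      using f by (intro continuous_on_smooth_half_line smooth_half_line_funpow_ddx)
    then show "continuous_on {0..real N} (\<lambda>x. cmod ((ddx ^^ j) f x))"
      by (intro continuous_intros) (auto elim: continuous_on_subset)
  qed auto
  then have "bdd_above (\<Union>j\<in>{..N}. (\<lambda>x. cmod ((ddx ^^ j) f x)) ` {0..real N})"
    by simp
  moreover have "(\<lambda>(j, x). cmod ((ddx ^^ j) f x)) ` ({..N} \<times> {0..real N})
     = (\<Union>j\<in>{..N}. (\<lambda>x. cmod ((ddx ^^ j) f x)) ` {0..real N})"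
    by auto
  ultimately have "bdd_above ((\<lambda>(j, x). cmod ((ddx ^^ j) f x)) ` ({..N} \<times> {0..real N}))"
    by simp
  then show ?thesis
    unfolding smooth_seminorm_def using assms(2-4)
      cSUP_upper[of "(j, x)" "{..N} \<times> {0..real N}" "\<lambda>(j, x). cmod ((ddx ^^ j) f x)"] by simp
qed

lemma smooth_seminorm_least:
  assumes "\<And>j x. j \<le> N \<Longrightarrow> 0 \<le> x \<Longrightarrow> x \<le> real N \<Longrightarrow> cmod ((ddx ^^ j) f x) \<le> M"
  shows "smooth_seminorm N f \<le> M"
  unfolding smooth_seminorm_def using assms by (intro cSUP_least) auto

lemma smooth_topology_alt: "smooth_topology = seminorm_topology smooth_half_line smooth_seminorm"
  unfolding smooth_topology_def smooth_seminorm_def ..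

interpretation smooth_half_line: seminormed_space smooth_half_line smooth_seminorm
proof
  show "complex_subspace smooth_half_line"
    by (rule smooth_half_line_subspace)
  fix N
  have scale_le: "smooth_seminorm N (\<lambda>x. a * f x) \<le> cmod a * smooth_seminorm N f"
    if "f \<in> smooth_half_line" for a f
  proof (rule smooth_seminorm_least)
    fix j x assume "j \<le> N" "0 \<le> x" "x \<le> real N"
    then show "cmod ((ddx ^^ j) (\<lambda>x. a * f x) x) \<le> cmod a * smooth_seminorm N f"
      using ddx_funpow_lincomb[OF that that, of j a 0]  smooth_seminorm_upper[OF that, of j N x]
      by (simp add: norm_mult mult_left_mono)
  qed
  show "seminorm_on smooth_half_line (smooth_seminorm N)"
    unfolding seminorm_on_def
  proof (intro conjI ballI allI)
    fix f g assume f: "f \<in> smooth_half_line" and g: "g \<in> smooth_half_line"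
    show "smooth_seminorm N (f + g) \<le> smooth_seminorm N f + smooth_seminorm N g"
    proof (rule smooth_seminorm_least)
      fix j x assume *: "j \<le> N" "0 \<le> x" "x \<le> real N"
      have "(ddx ^^ j) (f + g) x = (ddx ^^ j) f x + (ddx ^^ j) g x"
        using ddx_funpow_lincomb[OF f g, of j 1 1] by (simp add: plus_fun_def)
      then show "cmod ((ddx ^^ j) (f + g) x) \<le> smooth_seminorm N f + smooth_seminorm N g"
        using smooth_seminorm_upper[OF f *] smooth_seminorm_upper[OF g *]
        by (simp add: norm_triangle_le)
    qed
  next
    fix f a assume f: "f \<in> smooth_half_line"
    show "smooth_seminorm N (\<lambda>x. a * f x) = cmod a * smooth_seminorm N f"
    proof (rule antisym[OF scale_le[OF f]])
      show "cmod a * smooth_seminorm N f \<le> smooth_seminorm N (\<lambda>x. a * f x)"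
      proof (cases "a = 0")
        case True
        have "cmod ((ddx ^^ 0) (\<lambda>x. a * f x) 0) \<le> smooth_seminorm N (\<lambda>x. a * f x)"
          using smooth_half_line_subspace f unfolding complex_subspace_def
          by (intro smooth_seminorm_upper) auto
        with True show ?thesis
          by simp
      next
        case False
        have "(\<lambda>x. a * f x) \<in> smooth_half_line"
          using smooth_half_line_subspace f unfolding complex_subspace_def by blast
        from scale_le[OF this, of "1 / a"] False show ?thesis
          by (simp add: norm_divide field_simps)
      qed
    qed
  qed
qed

lemma limitin_smooth_topologyD:
  assumes lim: "limitin smooth_topology f l F" and "0 \<le> x"
  shows "((\<lambda>t. (ddx ^^ j) (f t) x) \<longlongrightarrow> (ddx ^^ j) l x) F"
proof (rule Lim_transform_bound[of "\<lambda>t. (ddx ^^ j) (f t) x - (ddx ^^ j) l x", THEN LIM_zero_cancel])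
  \<comment> \<open>One index serves twice: it bounds the order of the derivative and the length of
    the interval.\<close>
  define N where "N = max j (nat \<lceil>x\<rceil>)"
  have N: "j \<le> N" "x \<le> real N"
    unfolding N_def by (auto intro: order_trans[OF real_nat_ceiling_ge])
  have l: "l \<in> smooth_half_line" and ev: "\<forall>\<^sub>F t in F. f t \<in> smooth_half_line"
    and lim0: "((\<lambda>t. smooth_seminorm N (f t - l)) \<longlongrightarrow> 0) F"
    using lim unfolding smooth_topology_alt smooth_half_line.limitin_seminorm_topology by auto
  show "((\<lambda>t. smooth_seminorm N (f t - l)) \<longlongrightarrow> 0) F"
    by fact
  show "\<forall>\<^sub>F t in F. cmod ((ddx ^^ j) (f t) x - (ddx ^^ j) l x) \<le> norm (smooth_seminorm N (f t - l))"
    using ev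
  proof eventually_elim
    case (elim t)
    have "(ddx ^^ j) (f t - l) x = (ddx ^^ j) (f t) x - (ddx ^^ j) l x"
      using ddx_funpow_lincomb[OF elim l, of j 1 "-1"] by (simp add: fun_diff_def)
    then show ?case
      using smooth_seminorm_upper[OF smooth_half_line.diff_mem[OF elim l] N(1) \<open>0 \<le> x\<close> N(2)] by simp
  qed
qed

section \<open>Primitives and the fundamental theorem of calculus\<close>

definition primitive :: "(real \<Rightarrow> complex) \<Rightarrow> real \<Rightarrow> complex" where
  "primitive f = (\<lambda>x. if 0 \<le> x then integral {0..x} f else 0)"

lemma integrable_smooth_half_line:
  "f \<in> smooth_half_line \<Longrightarrow> f integrable_on {0..x}"
  by (intro integrable_continuous_real continuous_on_subset[OF continuous_on_smooth_half_line]) auto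

lemma has_vector_derivative_primitive:
  assumes "f \<in> smooth_half_line" "0 \<le> x"
  shows "(primitive f has_vector_derivative f x) (at x within {0..})"
proof -
  have "continuous_on {0..x + 1} f"
    using continuous_on_smooth_half_line[OF assms(1)] by (rule continuous_on_subset) auto
  then have "((\<lambda>u. integral {0..u} f) has_vector_derivative f x) (at x within {0..x + 1})"
    using assms(2) by (intro integral_has_vector_derivative) auto
  moreover have "at x within {0..x + 1} = at x within {0..}"
    by (rule at_within_nhd[of _ "{..<x + 1}"]) auto
  ultimately have "((\<lambda>u. integral {0..u} f) has_vector_derivative f x) (at x within {0..})"
    by simp
  then show ?thesis
    by (rule has_vector_derivative_transform[rotated 2]) (use assms(2) in \<open>auto simp: primitive_def\<close>)
qed

lemma ddx_primitive:
  assumes "f \<in> smooth_half_line" shows "ddx (primitive f) = f"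
proof
  fix x show "ddx (primitive f) x = f x"
    by (cases "x < 0")
      (use assms has_vector_derivative_primitive ddx_eqI smooth_half_line_neg in auto)
qed

lemma smooth_half_line_primitive:
  assumes "f \<in> smooth_half_line" shows "primitive f \<in> smooth_half_line"
proof (rule smooth_half_line_coinduct[of _ "insert (primitive f) smooth_half_line"])
  fix g x assume g: "g \<in> insert (primitive f) smooth_half_line"
  show "ddx g \<in> insert (primitive f) smooth_half_line"
    using g assms by (auto simp: ddx_primitive smooth_half_line_ddx)
  show "g x = 0" if "x < 0"
    using g that by (auto simp: primitive_def smooth_half_line_neg)
  show "g differentiable (at x within {0..})" if "0 \<le> x"
    using g that has_ddx has_vector_derivative_primitive[OF assms] differentiableI_vector by blast
qed simp

lemma smooth_half_line_eqI:
  assumes f: "f \<in> smooth_half_line" and g: "g \<in> smooth_half_line"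
    and "ddx f = ddx g" "f 0 = g 0"
  shows "f = g"
proof -
  have "((\<lambda>x. 1 * f x + (-1) * g x) has_vector_derivative 0) (at x within {0..})" if "0 \<le> x" for x
    using has_ddx_lincomb[OF f g that, of 1 "-1"] assms(3) by simp
  then obtain c where c: "\<And>x. 0 \<le> x \<Longrightarrow> f x - g x = c"
    using has_vector_derivative_zero_constant[of "{0..}" "\<lambda>x. 1 * f x + (-1) * g x"] by auto
  then have "c = 0"
    using c[of 0] assms(4) by simp
  show ?thesis
  proof
    fix x show "f x = g x"
      using c[of x] \<open>c = 0\<close> smooth_half_line_neg[OF f, of x] smooth_half_line_neg[OF g, of x]
      by (cases "x < 0") auto
  qed
qed

lemma primitive_ddx:
  assumes "f \<in> smooth_half_line" "f 0 = 0" shows "primitive (ddx f) = f"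
  by (rule smooth_half_line_eqI)
    (use assms in \<open>simp_all add: ddx_primitive smooth_half_line_ddx smooth_half_line_primitive\<close>,
     simp add: primitive_def)

lemma primitive_lincomb:
  assumes "f \<in> smooth_half_line" "g \<in> smooth_half_line"
  shows "primitive (\<lambda>x. a * f x + b * g x) = (\<lambda>x. a * primitive f x + b * primitive g x)"
  using assms integrable_smooth_half_line
  by (auto simp: primitive_def fun_eq_iff integral_add integrable_on_mult_right)

lemma primitive_zero_upto:
  assumes "\<And>x. x < \<epsilon> \<Longrightarrow> f x = 0" "x < \<epsilon>"
  shows "primitive f x = 0"
proof -
  have "integral {0..x} f = integral {0..x} (\<lambda>_. 0)"
    using assms by (intro integral_cong) auto
  then show ?thesis
    by (simp add: primitive_def)
qed

section \<open>Cutoff functions\<close>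

text \<open>The polynomial factor keeps the family stable under differentiation: the derivative of
  p(1/x) exp(-1/x) is q(1/x) exp(-1/x) with q(y) = y^2 (p(y) - p'(y)), and exponential decay beats
  the polynomial at 0.\<close>

definition flat :: "real poly \<Rightarrow> real \<Rightarrow> real" where
  "flat p x = (if x > 0 then poly p (1 / x) * exp (- 1 / x) else 0)"

lemma poly_times_exp_tendsto_0: "((\<lambda>y::real. poly p y * exp (- y)) \<longlongrightarrow> 0) at_top"
proof -
  have "((\<lambda>y. \<Sum>i\<le>degree p. coeff p i * (y ^ i / exp y)) \<longlongrightarrow> (\<Sum>i\<le>degree p. coeff p i * 0)) at_top"
    by (intro tendsto_intros tendsto_power_div_exp_0)
  then show ?thesis
    by (simp add: poly_altdef sum_distrib_right exp_minus divide_inverse mult.assoc)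
qed

lemma flat_deriv:
  "(flat p has_real_derivative flat ([:0, 0, 1:] * (p - pderiv p)) x) (at x)"
proof -
  consider "x > 0" | "x < 0" | "x = 0" by linarith
  then show ?thesis
  proof cases
    case 1
    have "((\<lambda>x. - (1 / x)) has_real_derivative (1 / x) * (1 / x)) (at x)"
      using 1 by (auto intro!: derivative_eq_intros)
    moreover have "((\<lambda>x. 1 / x) has_real_derivative - ((1 / x) * (1 / x))) (at x)"
      using 1 by (auto intro!: derivative_eq_intros)
    ultimately have "((\<lambda>x. poly p (1 / x) * exp (- (1 / x))) has_real_derivative
       poly p (1 / x) * (exp (- (1 / x)) * ((1 / x) * (1 / x)))
        + poly (pderiv p) (1 / x) * - ((1 / x) * (1 / x)) * exp (- (1 / x))) (at x)"
      by (intro DERIV_mult' DERIV_chain2[OF poly_DERIV] DERIV_chain2[OF DERIV_exp])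
    also have "poly p (1 / x) * (exp (- (1 / x)) * ((1 / x) * (1 / x)))
        + poly (pderiv p) (1 / x) * - ((1 / x) * (1 / x)) * exp (- (1 / x))
      = flat ([:0, 0, 1:] * (p - pderiv p)) x"
      using 1 unfolding flat_def by (simp add: algebra_simps)
    finally have "((\<lambda>x. poly p (1 / x) * exp (- 1 / x)) has_real_derivative flat ([:0, 0, 1:] * (p - pderiv p)) x) (at x)"
      by simp
    then show ?thesis
    proof (rule DERIV_cong_ev[THEN iffD1, OF refl _ refl, rotated])
      show "\<forall>\<^sub>F x in nhds x. poly p (1 / x) * exp (- 1 / x) = flat p x"
        using eventually_nhds_in_open[of "{0<..}" x] 1
        by (auto simp: flat_def elim: eventually_mono)
    qed
  next
    case 2
    have "((\<lambda>x. 0) has_real_derivative flat ([:0, 0, 1:] * (p - pderiv p)) x) (at x)"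
      using 2 by (auto simp: flat_def)
    then show ?thesis
    proof (rule DERIV_cong_ev[THEN iffD1, OF refl _ refl, rotated])
      show "\<forall>\<^sub>F x in nhds x. 0 = flat p x"
        using eventually_nhds_in_open[of "{..<0}" x] 2
        by (auto simp: flat_def elim: eventually_mono)
    qed
  next
    case 3
    have "((\<lambda>h. (flat p (0 + h) - flat p 0) / h) \<longlongrightarrow> 0) (at 0)"
    proof (rule filterlim_split_at)
      show "((\<lambda>h. (flat p (0 + h) - flat p 0) / h) \<longlongrightarrow> 0) (at_left 0)"
        by (rule tendsto_eventually) (auto simp: eventually_at_filter flat_def)
      \<comment> \<open>With y = 1/h the difference quotient at 0 is y p(y) exp(-y), and
        \<open>pCons 0 p\<close> is the polynomial y p(y).\<close>
      have "((\<lambda>h. poly (pCons 0 p) (inverse h) * exp (- inverse h)) \<longlongrightarrow> 0) (at_right (0::real))"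
        using filterlim_compose[OF poly_times_exp_tendsto_0 filterlim_inverse_at_top_right] .
      then show "((\<lambda>h. (flat p (0 + h) - flat p 0) / h) \<longlongrightarrow> 0) (at_right 0)"
      proof (rule Lim_transform_eventually)
        show "\<forall>\<^sub>F h in at_right 0. poly (pCons 0 p) (inverse h) * exp (- inverse h)
            = (flat p (0 + h) - flat p 0) / h"
          by (auto simp: eventually_at_filter flat_def field_simps)
      qed
    qed
    then show ?thesis
      using 3 by (simp add: DERIV_def flat_def)
  qed
qed

lemma flat_nonneg_pos: "x \<le> 0 \<Longrightarrow> flat p x = 0" "x > 0 \<Longrightarrow> flat 1 x > 0"
  by (auto simp: flat_def)

lemma flat_up_smooth: "(\<lambda>x. complex_of_real (flat p (x - 1))) \<in> smooth_half_line"
proof (rule smooth_half_line_coinduct)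
  let ?P = "range (\<lambda>p x. complex_of_real (flat p (x - 1)))"
  have der: "((\<lambda>x. complex_of_real (flat p (x - 1))) has_vector_derivative
      complex_of_real (flat ([:0, 0, 1:] * (p - pderiv p)) (x - 1))) (at x within X)" for p x X
  proof -
    have "((\<lambda>x. flat p (x - 1)) has_real_derivative flat ([:0, 0, 1:] * (p - pderiv p)) (x - 1) * 1) (at x)"
      by (rule DERIV_chain2[OF flat_deriv]) (auto intro!: derivative_eq_intros)
    then have "((\<lambda>x. flat p (x - 1)) has_vector_derivative flat ([:0, 0, 1:] * (p - pderiv p)) (x - 1)) (at x within X)"
      unfolding mult_1_right has_real_derivative_iff_has_vector_derivative
      by (rule has_vector_derivative_at_within)
    then show ?thesis
      by (rule bounded_linear.has_vector_derivative[OF bounded_linear_of_real])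
  qed
  show "(\<lambda>x. complex_of_real (flat p (x - 1))) \<in> ?P"
    by blast
  show "ddx g \<in> ?P" if gP: "g \<in> ?P" for g
  proof -
    obtain p where g: "g = (\<lambda>x. complex_of_real (flat p (x - 1)))"
      using gP by blast
    have "ddx g x = complex_of_real (flat ([:0, 0, 1:] * (p - pderiv p)) (x - 1))" for x
    proof (cases "x < 0")
      case True
      then show ?thesis
        by (simp add: flat_def)
    next
      case False
      then show ?thesis
        unfolding g by (intro ddx_eqI der) auto
    qed
    then show ?thesis
      by blast
  qed
  show "g differentiable (at x within {0..})" if "g \<in> ?P" for g x
    using that der differentiableI_vector by blast
qed (auto simp: flat_def)

text \<open>Reflection contributes the sign that turns \<open>p - pderiv p\<close> into
  \<open>pderiv p - p\<close>. The case distinction enforces the convention that representatives are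
  0 for negative \<open>x\<close>, where \<open>flat p (2 - x)\<close> need not vanish.\<close>

lemma flat_down_smooth:
  "(\<lambda>x. if x < 0 then 0 else complex_of_real (flat p (2 - x))) \<in> smooth_half_line"
proof (rule smooth_half_line_coinduct)
  let ?P = "range (\<lambda>p x. if x < 0 then 0 else complex_of_real (flat p (2 - x)))"
  have der: "((\<lambda>x. if x < 0 then 0 else complex_of_real (flat p (2 - x))) has_vector_derivative
      complex_of_real (flat ([:0, 0, 1:] * (pderiv p - p)) (2 - x))) (at x within {0..})"
    if "0 \<le> x" for p x
  proof -
    have "((\<lambda>x. flat p (2 - x)) has_real_derivative flat ([:0, 0, 1:] * (p - pderiv p)) (2 - x) * (- 1)) (at x)"
      by (rule DERIV_chain2[OF flat_deriv]) (auto intro!: derivative_eq_intros)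
    moreover have "flat ([:0, 0, 1:] * (p - pderiv p)) (2 - x) * (- 1) = flat ([:0, 0, 1:] * (pderiv p - p)) (2 - x)"
      by (simp add: flat_def algebra_simps)
    ultimately have "((\<lambda>x. flat p (2 - x)) has_real_derivative flat ([:0, 0, 1:] * (pderiv p - p)) (2 - x)) (at x)"
      by metis
    then have "((\<lambda>x. flat p (2 - x)) has_vector_derivative flat ([:0, 0, 1:] * (pderiv p - p)) (2 - x)) (at x within {0..})"
      unfolding has_real_derivative_iff_has_vector_derivative
      by (rule has_vector_derivative_at_within)
    then have "((\<lambda>x. complex_of_real (flat p (2 - x))) has_vector_derivative
      complex_of_real (flat ([:0, 0, 1:] * (pderiv p - p)) (2 - x))) (at x within {0..})"
      by (rule bounded_linear.has_vector_derivative[OF bounded_linear_of_real])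
    then show ?thesis
      by (rule has_vector_derivative_transform[rotated 2]) (use that in auto)
  qed
  show "(\<lambda>x. if x < 0 then 0 else complex_of_real (flat p (2 - x))) \<in> ?P"
    by blast
  show "ddx g \<in> ?P" if gP: "g \<in> ?P" for g
  proof -
    obtain p where g: "g = (\<lambda>x. if x < 0 then 0 else complex_of_real (flat p (2 - x)))"
      using gP by blast
    have "ddx g x = (if x < 0 then 0 else complex_of_real (flat ([:0, 0, 1:] * (pderiv p - p)) (2 - x)))" for x
      unfolding g by (simp add: ddx_eqI[OF _ der])
    then show ?thesis
      by blast
  qed
  show "g differentiable (at x within {0..})" if "g \<in> ?P" "0 \<le> x" for g x
    using that der differentiableI_vector by blast
qed auto

text \<open>Positive exactly between 1 and 2. It serves both as a test function with non-zero
  integral and as the source of the cutoff.\<close>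

definition bump :: "real \<Rightarrow> complex" where
  "bump x = complex_of_real (flat 1 (x - 1) * flat 1 (2 - x))"

lemma bump_smooth: "bump \<in> smooth_half_line"
proof -
  have "bump = (\<lambda>x. complex_of_real (flat 1 (x - 1)) * (if x < 0 then 0 else complex_of_real (flat 1 (2 - x))))"
    by (auto simp: bump_def flat_def)
  then show ?thesis
    using smooth_half_line_mult[OF flat_up_smooth flat_down_smooth, of 1 1] by simp
qed

lemma bump_zero: "x \<le> 1 \<or> x \<ge> 2 \<Longrightarrow> bump x = 0"
  by (auto simp: bump_def flat_def)

lemma integral_bump_neq_0: "integral {0..2} bump \<noteq> 0"
proof
  assume "integral {0..2} bump = 0"
  moreover have "integral {0..2} (Re \<circ> bump) = Re (integral {0..2} bump)"
    by (rule integral_linear[OF integrable_smooth_half_line[OF bump_smooth] bounded_linear_Re])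
  moreover have "continuous_on {0..2} (Re \<circ> bump)"
    using continuous_on_smooth_half_line[OF bump_smooth] unfolding o_def
    by (intro continuous_intros) (auto elim: continuous_on_subset)
  moreover have nonneg: "flat 1 x \<ge> 0" for x
    using flat_nonneg_pos[of x] by (cases "x \<le> 0") (auto simp: not_le less_imp_le)
  ultimately have "\<forall>x\<in>{0..2}. (Re \<circ> bump) x = 0"
    using integral_eq_0_iff[of 0 2 "Re \<circ> bump"] by (simp add: bump_def)
  then have "(Re \<circ> bump) (3 / 2) = 0"
    by (rule bspec) simp
  moreover have "(Re \<circ> bump) (3 / 2) > 0"
    by (simp add: bump_def flat_def)
  ultimately show False
    by simp
qed

text \<open>One minus the normalised primitive of \<open>bump\<close>, so the transition from 1 to 0
  takes place between 1 and 2. The constant 1 appears as \<open>of_bool (0 \<le> x)\<close> because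
  functions on the half-line are extended by 0.\<close>

definition cutoff :: "real \<Rightarrow> complex" where
  "cutoff x = of_bool (0 \<le> x) - primitive bump x / integral {0..2} bump"

lemma cutoff_smooth: "cutoff \<in> smooth_half_line"
proof -
  have "(\<lambda>x::real. of_bool (0 \<le> x)) \<in> smooth_half_line" (is "?i \<in> _")
  proof (rule smooth_half_line_coinduct)
    have der: "(?i has_vector_derivative 0) (at x within {0..})" if "0 \<le> x" for x
      by (rule has_vector_derivative_transform[OF _ _ has_vector_derivative_const[of 1]]) (use that in auto)
    have "ddx ?i = 0"
      using ddx_eqI[OF _ der] by (auto simp: fun_eq_iff) (metis ddx_neg linorder_not_le)
    then show "ddx g \<in> insert ?i smooth_half_line" if "g \<in> insert ?i smooth_half_line" for g
      using that smooth_half_line_ddx by auto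
    show "g differentiable (at x within {0..})" if "g \<in> insert ?i smooth_half_line" "0 \<le> x" for g x
      using that der has_ddx differentiableI_vector by blast
  qed (auto simp: smooth_half_line_neg)
  from smooth_half_line_lincomb[OF this smooth_half_line_primitive[OF bump_smooth], of 1 "- 1 / integral {0..2} bump"]
  show ?thesis
    by (simp add: cutoff_def[abs_def])
qed

lemma cutoff_one:
  assumes "0 \<le> x" "x < 1" shows "cutoff x = 1"
  using primitive_zero_upto[of 1 bump x] assms by (simp add: cutoff_def bump_zero)

lemma cutoff_zero:
  assumes "x \<ge> 2" shows "cutoff x = 0"
proof -
  have "integral {0..2} bump + integral {2..x} bump = integral {0..x} bump"
    using assms integrable_smooth_half_line[OF bump_smooth]
    by (intro Henstock_Kurzweil_Integration.integral_combine) auto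
  moreover have "integral {2..x} bump = integral {2..x} (\<lambda>_. 0)"
    by (intro integral_cong bump_zero) auto
  ultimately show ?thesis
    using assms integral_bump_neq_0 by (simp add: cutoff_def primitive_def)
qed

lemma compactly_supportedI:
  assumes f: "f \<in> smooth_half_line" and "\<And>x. R < x \<Longrightarrow> f x = 0"
  shows "f \<in> compactly_supported"
proof -
  have "{x. f x \<noteq> 0} \<subseteq> {0..R}"
    using smooth_half_line_neg[OF f] assms(2) by (auto simp: not_less[symmetric])
  then have "supp f \<subseteq> {0..R}"
    unfolding supp_def by (intro closure_minimal) auto
  then have "compact (supp f)"
    using bounded_subset[of "{0..R}"] by (auto simp: compact_eq_bounded_closed supp_def)
  with f show ?thesis
    unfolding compactly_supported_def by simp
qed

lemma supp_subset_positive: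
  assumes "0 < \<epsilon>" "\<And>x. x < \<epsilon> \<Longrightarrow> f x = 0"
  shows "supp f \<subseteq> {0<..}"
proof -
  have "{x. f x \<noteq> 0} \<subseteq> {\<epsilon>..}"
    using assms(2) by force
  then have "supp f \<subseteq> {\<epsilon>..}"
    unfolding supp_def by (intro closure_minimal) auto
  with assms(1) show ?thesis
    by auto
qed

section \<open>Continuity in admissible spaces\<close>

locale admissible_space =
  fixes T :: "(real \<Rightarrow> complex) topology" and fint :: "(real \<Rightarrow> complex) \<Rightarrow> complex"
  assumes admissible: "admissible T fint"
begin

text \<open>\<open>frechet_space\<close> asserts only that a defining family exists; one is fixed
  here so that limits in \<open>T\<close> become limits of real numbers.\<close>

definition seminorms :: "nat \<Rightarrow> (real \<Rightarrow> complex) \<Rightarrow> real" where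
  "seminorms = (SOME q. complete_seminormed_space (topspace T) q \<and> T = seminorm_topology (topspace T) q)"

lemma seminorms: "complete_seminormed_space (topspace T) seminorms"
  and topology_eq: "seminorm_topology (topspace T) seminorms = T"
proof -
  have "frechet_space T"
    using admissible unfolding admissible_def by blast
  then obtain q where sub: "complex_subspace (topspace T)" and q: "\<forall>j. seminorm_on (topspace T) (q j)"
    and T: "T = seminorm_topology (topspace T) q"
    and complete: "\<forall>s. range s \<subseteq> topspace T \<and>
      (\<forall>j. \<forall>e>0. \<exists>N. \<forall>k\<ge>N. \<forall>l\<ge>N. q j (s k - s l) < e) \<longrightarrow> (\<exists>f. limitin T s f sequentially)"
    unfolding frechet_space_def by (elim conjE exE) (rule that)
  interpret seminormed_space "topspace T" q
    by unfold_locales (use sub q in auto)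
  have "complete_seminormed_space (topspace T) q"
  proof
    fix s :: "nat \<Rightarrow> real \<Rightarrow> complex"
    assume s: "range s \<subseteq> topspace T"
      and cauchy: "\<And>j e. e > 0 \<Longrightarrow> \<exists>N. \<forall>k\<ge>N. \<forall>l\<ge>N. q j (s k - s l) < e"
    have "range s \<subseteq> topspace T \<and> (\<forall>j. \<forall>e>0. \<exists>N. \<forall>k\<ge>N. \<forall>l\<ge>N. q j (s k - s l) < e)"
      by (intro conjI s allI impI cauchy)
    from complete[THEN spec, THEN mp, OF this] obtain f where "limitin T s f sequentially" ..
    then have "limitin (seminorm_topology (topspace T) q) s f sequentially"
      unfolding T[symmetric] .
    then show "\<exists>f\<in>topspace T. \<forall>j. (\<lambda>k. q j (s k - f)) \<longlonglongrightarrow> 0"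
      unfolding limitin_seminorm_topology by blast
  qed
  with T have "\<exists>q. complete_seminormed_space (topspace T) q \<and> T = seminorm_topology (topspace T) q"
    by (intro exI conjI)
  from someI_ex[OF this] have *: "complete_seminormed_space (topspace T) seminorms \<and>
      T = seminorm_topology (topspace T) seminorms"
    unfolding seminorms_def .
  show "complete_seminormed_space (topspace T) seminorms"
    using * by (rule conjunct1)
  show "seminorm_topology (topspace T) seminorms = T"
    using * by (rule conjunct2[THEN sym])
qed

sublocale complete_seminormed_space "topspace T" seminorms
  by (rule seminorms)

lemma limitin_iff:
  "limitin T f l F \<longleftrightarrow>
    l \<in> topspace T \<and> eventually (\<lambda>x. f x \<in> topspace T) F \<and> (\<forall>j. ((\<lambda>x. seminorms j (f x - l)) \<longlongrightarrow> 0) F)"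
  using limitin_seminorm_topology[of f l F] unfolding topology_eq .

lemma mem_smooth: "f \<in> topspace T \<Longrightarrow> f \<in> smooth_half_line"
  using admissible unfolding admissible_def by blast

lemma mem_neg: "f \<in> topspace T \<Longrightarrow> x < 0 \<Longrightarrow> f x = 0"
  using mem_smooth smooth_half_line_neg by blast

lemma ddx_mem: "f \<in> topspace T \<Longrightarrow> ddx f \<in> topspace T"
  using admissible unfolding admissible_def by blast

lemma lincomb_mem: "f \<in> topspace T \<Longrightarrow> g \<in> topspace T \<Longrightarrow> (\<lambda>x. a * f x + b * g x) \<in> topspace T"
  using add_mem[OF scale_mem scale_mem] by (simp add: plus_fun_def)

lemma fint_lincomb:
  assumes "f \<in> topspace T" "g \<in> topspace T"
  shows "fint (\<lambda>x. a * f x + b * g x) = a * fint f + b * fint g"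
proof -
  have "fint ((\<lambda>x. a * f x) + (\<lambda>x. b * g x)) = fint (\<lambda>x. a * f x) + fint (\<lambda>x. b * g x)"
    using admissible assms scale_mem unfolding admissible_def by blast
  moreover have "fint (\<lambda>x. a * f x) = a * fint f" "fint (\<lambda>x. b * g x) = b * fint g"
    using admissible assms unfolding admissible_def by blast+
  ultimately show ?thesis
    by (simp add: plus_fun_def)
qed

lemma limitin_smooth:
  assumes "limitin T f l F" shows "limitin smooth_topology f l F"
proof -
  have "continuous_map T smooth_topology (\<lambda>f. f)"
    using admissible unfolding admissible_def by blast
  from continuous_map_limit[OF this assms] show ?thesis
    by (simp add: o_def)
qed

lemma limitin_ddx_pointwise:
  assumes "limitin T f l F" "0 \<le> x"
  shows "((\<lambda>t. (ddx ^^ j) (f t) x) \<longlongrightarrow> (ddx ^^ j) l x) F"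
  using limitin_smooth_topologyD[OF limitin_smooth[OF assms(1)] assms(2)] .

lemma limitin_pointwise:
  assumes "limitin T f l F"
  shows "((\<lambda>t. f t x) \<longlongrightarrow> l x) F"
proof (cases "0 \<le> x")
  case True
  then show ?thesis
    using limitin_ddx_pointwise[OF assms True, of 0] by simp
next
  case False
  have "\<forall>\<^sub>F t in F. f t \<in> topspace T" "l \<in> topspace T"
    using assms unfolding limitin_iff by auto
  then show ?thesis
    using False by (intro tendsto_eventually) (auto elim!: eventually_mono simp: mem_neg)
qed

section \<open>Functions vanishing below a fixed level\<close>

definition vanishing :: "real \<Rightarrow> (real \<Rightarrow> complex) set" where
  "vanishing \<epsilon> = {f \<in> topspace T. \<forall>x<\<epsilon>. f x = 0}"

lemma vanishing_mem: "f \<in> vanishing \<epsilon> \<Longrightarrow> f \<in> topspace T"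
  unfolding vanishing_def by blast

lemma vanishing_lincomb:
  "f \<in> vanishing \<epsilon> \<Longrightarrow> g \<in> vanishing \<epsilon> \<Longrightarrow> (\<lambda>x. a * f x + b * g x) \<in> vanishing \<epsilon>"
  unfolding vanishing_def using lincomb_mem by simp

lemma vanishing_subspace: "complex_subspace (vanishing \<epsilon>)"
  unfolding complex_subspace_def vanishing_def by auto

lemma vanishing_mono: "\<delta> \<le> \<epsilon> \<Longrightarrow> vanishing \<epsilon> \<subseteq> vanishing \<delta>"
  unfolding vanishing_def by auto

lemma vanishing_near_0:
  assumes "f \<in> vanishing \<epsilon>" "0 < \<epsilon>" shows "f \<in> vanishing_near_0 (topspace T)"
  using assms supp_subset_positive[of \<epsilon> f] unfolding vanishing_def vanishing_near_0_def by blast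

lemma fint_ddx: "f \<in> vanishing \<epsilon> \<Longrightarrow> 0 < \<epsilon> \<Longrightarrow> fint (ddx f) = 0"
  using vanishing_near_0 admissible unfolding admissible_def by blast

text \<open>The continuous embedding into the smooth functions turns convergence in \<open>T\<close>
  into pointwise convergence, under which zeros persist.\<close>

lemma vanishing_limit:
  assumes lim: "limitin T f l F" and ev: "\<forall>\<^sub>F t in F. f t \<in> vanishing \<epsilon>" and "F \<noteq> bot"
  shows "l \<in> vanishing \<epsilon>"
proof -
  have "l x = 0" if "x < \<epsilon>" for x
  proof (rule tendsto_unique[OF \<open>F \<noteq> bot\<close> limitin_pointwise[OF lim]])
    show "((\<lambda>t. f t x) \<longlongrightarrow> 0) F"
      using ev that by (intro tendsto_eventually) (auto elim!: eventually_mono simp: vanishing_def)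
  qed
  then show ?thesis
    using lim unfolding vanishing_def limitin_iff by blast
qed

text \<open>On compactly supported functions \<open>fint\<close> is \<open>c\<close> times the
  integral. If \<open>c\<close> is non-zero, \<open>bump\<close> does the job. If
  \<open>c = 0\<close>, take any \<open>f\<close> with \<open>fint f \<noteq> 0\<close> and subtract
  \<open>cutoff * f\<close>: this has compact support, so the functional does not notice, and the
  difference vanishes below 1.\<close>

lemma exists_unit: "\<exists>e\<in>vanishing 1. fint e = 1"
proof -
  obtain c where c: "\<And>f. f \<in> compactly_supported \<Longrightarrow> fint f = c * integral {0..} f"
    using admissible unfolding admissible_def by blast
  have cs: "f \<in> topspace T" if "f \<in> compactly_supported" for f
    using that admissible unfolding admissible_def by blast
  have "\<exists>f\<in>vanishing 1. fint f \<noteq> 0"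
  proof (cases "c = 0")
    case True
    obtain f where f: "f \<in> topspace T" "fint f \<noteq> 0"
      using admissible unfolding admissible_def by blast
    let ?g = "\<lambda>x. cutoff x * f x"
    have g: "?g \<in> compactly_supported"
      by (rule compactly_supportedI[of _ 2])
        (auto intro: smooth_half_line_mult cutoff_smooth mem_smooth f simp: cutoff_zero)
    have "fint ?g = 0"
      using c[OF g] True by simp
    then have "fint (\<lambda>x. 1 * f x + (-1) * ?g x) \<noteq> 0"
      using fint_lincomb[OF f(1) cs[OF g], of 1 "-1"] f(2) by simp
    moreover have "1 * f x + (-1) * ?g x = 0" if "x < 1" for x
      using that mem_neg[OF f(1)] cutoff_one[of x] by (cases "x < 0") auto
    then have "(\<lambda>x. 1 * f x + (-1) * ?g x) \<in> vanishing 1"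
      using lincomb_mem[OF f(1) cs[OF g]] unfolding vanishing_def by blast
    ultimately show ?thesis
      by blast
  next
    case False
    have b: "bump \<in> compactly_supported"
      by (rule compactly_supportedI[of _ 2]) (auto intro: bump_smooth bump_zero)
    have "(bump has_integral integral {0..2} bump) {0..2}"
      using integrable_smooth_half_line[OF bump_smooth] by (rule integrable_integral)
    then have "(bump has_integral integral {0..2} bump) {0..}"
      by (rule has_integral_on_superset) (auto intro: bump_zero)
    then have "fint bump = c * integral {0..2} bump"
      using c[OF b] by (simp add: integral_unique)
    then have "fint bump \<noteq> 0"
      using False integral_bump_neq_0 by simp
    moreover have "bump \<in> vanishing 1"
      unfolding vanishing_def using cs[OF b] by (auto intro: bump_zero)
    ultimately show ?thesis
      by blast
  qed
  then obtain f where f: "f \<in> vanishing 1" "fint f \<noteq> 0"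
    by blast
  have "(\<lambda>x. (1 / fint f) * f x + 0 * f x) \<in> vanishing 1"
    using f(1) by (intro vanishing_lincomb)
  moreover have "fint (\<lambda>x. (1 / fint f) * f x + 0 * f x) = 1"
    using f by (subst fint_lincomb) (auto simp: vanishing_def)
  ultimately show ?thesis
    by blast
qed

definition unit :: "real \<Rightarrow> complex" where
  "unit = (SOME e. e \<in> vanishing 1 \<and> fint e = 1)"

lemma unit_vanishing_1: "unit \<in> vanishing 1" and fint_unit [simp]: "fint unit = 1"
proof -
  have "\<exists>e. e \<in> vanishing 1 \<and> fint e = 1"
    using exists_unit by blast
  from someI_ex[OF this] show "unit \<in> vanishing 1" "fint unit = 1"
    unfolding unit_def by auto
qed

lemma unit_vanishing: "\<epsilon> \<le> 1 \<Longrightarrow> unit \<in> vanishing \<epsilon>"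
  using unit_vanishing_1 vanishing_mono by blast

lemma unit_mem: "unit \<in> topspace T"
  using unit_vanishing_1 vanishing_mem by blast

text \<open>The projection onto the kernel of \<open>fint\<close> along \<open>unit\<close>. It is
  spelled as a linear combination so that the rules for these match it syntactically.\<close>

definition reduce :: "(real \<Rightarrow> complex) \<Rightarrow> real \<Rightarrow> complex" where
  "reduce f = (\<lambda>x. 1 * f x + (- fint f) * unit x)"

text \<open>This is the operator \<open>P\<close> of the overview.\<close>

definition fprim :: "(real \<Rightarrow> complex) \<Rightarrow> real \<Rightarrow> complex" where
  "fprim f = primitive (reduce f)"

lemma reduce_vanishing: "f \<in> vanishing \<epsilon> \<Longrightarrow> \<epsilon> \<le> 1 \<Longrightarrow> reduce f \<in> vanishing \<epsilon>"
  unfolding reduce_def by (intro vanishing_lincomb unit_vanishing)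

lemma fint_reduce: "f \<in> topspace T \<Longrightarrow> fint (reduce f) = 0"
  unfolding reduce_def by (subst fint_lincomb) (auto simp: unit_mem)

lemma reduce_mem: "f \<in> topspace T \<Longrightarrow> reduce f \<in> topspace T"
  unfolding reduce_def by (intro lincomb_mem unit_mem)

text \<open>Axiom (c) applies because \<open>fint\<close> vanishes on \<open>reduce f\<close>. The
  bound \<open>\<epsilon> \<le> 1\<close> comes from \<open>unit\<close>, which is known to vanish
  below 1.\<close>

lemma fprim_vanishing:
  assumes f: "f \<in> vanishing \<epsilon>" and "0 < \<epsilon>" "\<epsilon> \<le> 1" shows "fprim f \<in> vanishing \<epsilon>"
proof -
  have r: "reduce f \<in> vanishing \<epsilon>" "fint (reduce f) = 0"
    using reduce_vanishing[OF f \<open>\<epsilon> \<le> 1\<close>] fint_reduce[OF vanishing_mem[OF f]] by auto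
  then have "primitive (reduce f) \<in> topspace T"
    using vanishing_near_0[OF _ \<open>0 < \<epsilon>\<close>] admissible unfolding admissible_def primitive_def by blast
  moreover have "primitive (reduce f) x = 0" if "x < \<epsilon>" for x
    using r(1) that by (intro primitive_zero_upto) (auto simp: vanishing_def)
  ultimately show ?thesis
    unfolding fprim_def vanishing_def by blast
qed

lemma reduce_lincomb:
  assumes "f \<in> topspace T" "g \<in> topspace T"
  shows "reduce (\<lambda>x. a * f x + b * g x) = (\<lambda>x. a * reduce f x + b * reduce g x)"
  unfolding reduce_def by (subst fint_lincomb[OF assms]) (simp add: algebra_simps)

lemma fprim_lincomb:
  assumes "f \<in> topspace T" "g \<in> topspace T"
  shows "fprim (\<lambda>x. a * f x + b * g x) = (\<lambda>x. a * fprim f x + b * fprim g x)"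
  unfolding fprim_def reduce_lincomb[OF assms]
  using assms by (intro primitive_lincomb mem_smooth reduce_mem)

lemma ddx_fprim: "f \<in> topspace T \<Longrightarrow> ddx (fprim f) = reduce f"
  unfolding fprim_def by (intro ddx_primitive mem_smooth reduce_mem)

text \<open>By axiom (b) a derivative is not changed by \<open>reduce\<close>, and the constant of
  integration is 0 because \<open>f\<close> vanishes at 0.\<close>

lemma fprim_ddx:
  assumes "f \<in> vanishing \<epsilon>" "0 < \<epsilon>" shows "fprim (ddx f) = f"
proof -
  have "reduce (ddx f) = ddx f"
    using fint_ddx[OF assms] by (simp add: reduce_def)
  moreover have "f 0 = 0"
    using assms by (simp add: vanishing_def)
  ultimately show ?thesis
    unfolding fprim_def using mem_smooth[OF vanishing_mem[OF assms(1)]] by (simp add: primitive_ddx)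
qed

section \<open>Joint continuity of the functional and the primitive\<close>

lemma vanishing_complete: "complete_seminormed_space (vanishing \<epsilon>) seminorms"
proof
  show "complex_subspace (vanishing \<epsilon>)"
    by (rule vanishing_subspace)
  show "seminorm_on (vanishing \<epsilon>) (seminorms j)" for j
    using seminorm[of j] vanishing_mem unfolding seminorm_on_def by blast
  fix s :: "nat \<Rightarrow> real \<Rightarrow> complex"
  assume s: "range s \<subseteq> vanishing \<epsilon>"
    and cauchy: "\<And>j e. e > 0 \<Longrightarrow> \<exists>N. \<forall>k\<ge>N. \<forall>l\<ge>N. seminorms j (s k - s l) < e"
  have "range s \<subseteq> topspace T"
    using s vanishing_mem by blast
  from complete[OF this cauchy] obtain f where f: "f \<in> topspace T" "\<And>j. (\<lambda>k. seminorms j (s k - f)) \<longlonglongrightarrow> 0"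
    by blast
  then have "limitin T s f sequentially"
    using \<open>range s \<subseteq> topspace T\<close> unfolding limitin_iff
    by (auto intro!: always_eventually)
  then have "f \<in> vanishing \<epsilon>"
    by (rule vanishing_limit) (use s in \<open>auto intro!: always_eventually\<close>)
  with f(2) show "\<exists>f\<in>vanishing \<epsilon>. \<forall>j. (\<lambda>k. seminorms j (s k - f)) \<longlonglongrightarrow> 0"
    by blast
qed

text \<open>
  The product of the space with \<open>\<complex>\<close>, as a space of functions: the value at \<^const>\<open>None\<close> is the scalar.
\<close>

definition product_space :: "(real option \<Rightarrow> complex) set" where
  "product_space = {g. (\<lambda>x. g (Some x)) \<in> topspace T}"

definition product_seminorms :: "nat \<Rightarrow> (real option \<Rightarrow> complex) \<Rightarrow> real" where
  "product_seminorms j g = seminorms j (\<lambda>x. g (Some x)) + cmod (g None)"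

definition product_map :: "(real \<Rightarrow> complex) \<Rightarrow> real option \<Rightarrow> complex" where
  "product_map f = (\<lambda>z. case z of None \<Rightarrow> fint f | Some x \<Rightarrow> fprim f x)"

lemma product_complete: "complete_seminormed_space product_space product_seminorms"
proof
  have zero: "(\<lambda>x. (0 :: real option \<Rightarrow> complex) (Some x)) = 0"
    by auto
  have plus: "(\<lambda>x. (f + g) (Some x)) = (\<lambda>x. f (Some x)) + (\<lambda>x. g (Some x))" for f g :: "real option \<Rightarrow> complex"
    by auto
  have minus: "(\<lambda>x. (f - g) (Some x)) = (\<lambda>x. f (Some x)) - (\<lambda>x. g (Some x))" for f g :: "real option \<Rightarrow> complex"
    by auto
  show "complex_subspace product_space"
    unfolding complex_subspace_def product_space_def mem_Collect_eq plus zero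
    using add_mem scale_mem by blast
  show "seminorm_on product_space (product_seminorms j)" for j
    unfolding seminorm_on_def product_space_def product_seminorms_def plus
  proof (intro conjI ballI allI, goal_cases)
    case (1 f g)
    then show ?case
      using seminorm_add[of "\<lambda>x. f (Some x)" "\<lambda>x. g (Some x)" j] norm_triangle_ineq[of "f None" "g None"]
      by simp
  next
    case (2 a f)
    then show ?case
      using seminorm_scale[of "\<lambda>x. f (Some x)" j a] by (simp add: norm_mult algebra_simps)
  qed
  fix s :: "nat \<Rightarrow> real option \<Rightarrow> complex"
  assume s: "range s \<subseteq> product_space"
    and cauchy: "\<And>j e. e > 0 \<Longrightarrow> \<exists>N. \<forall>k\<ge>N. \<forall>l\<ge>N. product_seminorms j (s k - s l) < e"
  let ?s = "\<lambda>k x. s k (Some x)"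
  have sA: "?s k \<in> topspace T" for k
    using s unfolding product_space_def by blast
  then have nonneg: "seminorms j (?s k - ?s l) \<ge> 0" for j k l
    by (intro seminorm_nonneg diff_mem)
  have "\<exists>N. \<forall>k\<ge>N. \<forall>l\<ge>N. seminorms j (?s k - ?s l) < e" if e: "e > 0" for j e
  proof -
    obtain N where "\<forall>k\<ge>N. \<forall>l\<ge>N. product_seminorms j (s k - s l) < e"
      using cauchy[OF e] by blast
    then have "seminorms j (?s k - ?s l) < e" if "k \<ge> N" "l \<ge> N" for k l
      using that unfolding product_seminorms_def minus
      by (metis add.right_neutral add_left_mono norm_ge_zero order_le_less_trans)
    then show ?thesis
      by blast
  qed
  moreover have "range ?s \<subseteq> topspace T"
    using sA by blast
  ultimately obtain f where f: "f \<in> topspace T" "\<And>j. (\<lambda>k. seminorms j (?s k - f)) \<longlonglongrightarrow> 0"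
    using complete[of ?s] by blast
  have "Cauchy (\<lambda>k. s k None)"
  proof (rule metric_CauchyI)
    fix e :: real assume e: "0 < e"
    obtain N where N: "\<forall>k\<ge>N. \<forall>l\<ge>N. product_seminorms 0 (s k - s l) < e"
      using cauchy[OF e] by blast
    have "dist (s k None) (s l None) < e" if "k \<ge> N" "l \<ge> N" for k l
    proof -
      have "product_seminorms 0 (s k - s l) < e"
        using N that by blast
      then show ?thesis
        using nonneg[of 0 k l] unfolding product_seminorms_def minus by (simp add: dist_norm)
    qed
    then show "\<exists>N. \<forall>k\<ge>N. \<forall>l\<ge>N. dist (s k None) (s l None) < e"
      by blast
  qed
  then obtain c where c: "(\<lambda>k. s k None) \<longlonglongrightarrow> c"
    using Cauchy_convergent convergent_def by blast
  let ?y = "\<lambda>z. case z of None \<Rightarrow> c | Some x \<Rightarrow> f x"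
  have "(\<lambda>k. product_seminorms j (s k - ?y)) \<longlonglongrightarrow> 0" for j
  proof -
    have "(\<lambda>k. seminorms j (?s k - f) + cmod (s k None - c)) \<longlonglongrightarrow> 0 + 0"
      using LIM_zero[OF c] by (intro tendsto_add f(2) tendsto_norm_zero)
    then show ?thesis
      unfolding product_seminorms_def minus by simp
  qed
  moreover have "?y \<in> product_space"
    unfolding product_space_def using f(1) by simp
  ultimately show "\<exists>y\<in>product_space. \<forall>j. (\<lambda>k. product_seminorms j (s k - y)) \<longlonglongrightarrow> 0"
    by blast
qed

text \<open>
  If \<open>s\<^sub>k \<rightarrow> x\<close>, \<open>fprim s\<^sub>k \<rightarrow> G\<close> and \<open>fint s\<^sub>k \<rightarrow> c\<close>, then \<open>G' = x - c e\<close> with \<open>e\<close> the unit, and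
  \<open>fint G' = 0\<close> gives \<open>c = fint x\<close>.  It is for this last step that the functional and the primitive
  have to be treated together.
\<close>

lemma product_map_closed_graph:
  assumes \<epsilon>: "0 < \<epsilon>" "\<epsilon> \<le> 1"
    and s: "range s \<subseteq> vanishing \<epsilon>" and x: "x \<in> vanishing \<epsilon>" and y: "y \<in> product_space"
    and slim: "\<And>j. (\<lambda>k. seminorms j (s k - x)) \<longlonglongrightarrow> 0"
    and Llim: "\<And>j. (\<lambda>k. product_seminorms j (product_map (s k) - y)) \<longlonglongrightarrow> 0"
  shows "product_map x = y"
proof -
  define G where "G = (\<lambda>x. y (Some x))"
  define c where "c = y None"
  have sv: "s k \<in> vanishing \<epsilon>" for k
    using s by blast
  have sA: "s k \<in> topspace T" and fsA: "fprim (s k) \<in> topspace T" for k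
    using vanishing_mem[OF sv] vanishing_mem[OF fprim_vanishing[OF sv \<epsilon>]] by auto
  have GA: "G \<in> topspace T"
    using y unfolding product_space_def G_def by simp
  have split: "product_seminorms j (product_map (s k) - y) = seminorms j (fprim (s k) - G) + cmod (fint (s k) - c)" for j k
    unfolding product_seminorms_def product_map_def G_def c_def by (simp add: fun_diff_def)
  have "(\<lambda>k. seminorms j (fprim (s k) - G)) \<longlonglongrightarrow> 0" for j
    by (rule tendsto_sandwich[OF _ _ tendsto_const Llim[of j]])
      (auto intro!: always_eventually seminorm_nonneg diff_mem fsA GA simp: split)
  then have Glim: "limitin T (\<lambda>k. fprim (s k)) G sequentially"
    unfolding limitin_iff using GA fsA by auto
  have xlim: "limitin T s x sequentially"
    unfolding limitin_iff using sA vanishing_mem[OF x] slim by auto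
  have "(\<lambda>k. cmod (fint (s k) - c)) \<longlonglongrightarrow> 0"
    by (rule tendsto_sandwich[OF _ _ tendsto_const Llim[of 0]])
      (auto intro!: always_eventually seminorm_nonneg diff_mem fsA GA simp: split)
  then have clim: "(\<lambda>k. fint (s k)) \<longlonglongrightarrow> c"
    using LIM_zero_iff tendsto_norm_zero_iff by blast
  \<comment> \<open>As a limit of functions vanishing below \<epsilon>, \<open>G\<close> itself
    vanishes there, which makes axiom (b) applicable to it.\<close>
  have Gv: "G \<in> vanishing \<epsilon>"
    by (rule vanishing_limit[OF Glim]) (use fprim_vanishing[OF sv \<epsilon>] in auto)
  have ddxG: "ddx G = (\<lambda>r. 1 * x r + (- c) * unit r)"
  proof
    fix r show "ddx G r = 1 * x r + (- c) * unit r"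
    proof (cases "r < 0")
      case True
      then show ?thesis
        using mem_neg[OF vanishing_mem[OF x]] mem_neg[OF unit_mem] by simp
    next
      case False
      then have "(\<lambda>k. (ddx ^^ 1) (fprim (s k)) r) \<longlonglongrightarrow> (ddx ^^ 1) G r"
        by (intro limitin_ddx_pointwise[OF Glim]) simp
      then have "(\<lambda>k. reduce (s k) r) \<longlonglongrightarrow> ddx G r"
        using sA by (simp add: ddx_fprim)
      moreover have "(\<lambda>k. reduce (s k) r) \<longlonglongrightarrow> 1 * x r + (- c) * unit r"
        unfolding reduce_def by (intro tendsto_intros limitin_pointwise[OF xlim] clim)
      ultimately show ?thesis
        using LIMSEQ_unique by blast
    qed
  qed
  have "fint (ddx G) = fint x - c"
    unfolding ddxG by (subst fint_lincomb) (auto simp: unit_mem vanishing_mem[OF x])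
  then have c: "c = fint x"
    using fint_ddx[OF Gv \<epsilon>(1)] by simp
  have "reduce x = ddx G"
    unfolding ddxG c reduce_def ..
  moreover have "G 0 = 0"
    using Gv \<epsilon> by (simp add: vanishing_def)
  ultimately have "fprim x = G"
    unfolding fprim_def using primitive_ddx[OF mem_smooth[OF GA]] by simp
  with c show ?thesis
    unfolding product_map_def G_def c_def by (auto simp: fun_eq_iff split: option.split)
qed

lemma product_map_continuous:
  assumes \<epsilon>: "0 < \<epsilon>" "\<epsilon> \<le> 1" and "e > 0"
  shows "\<exists>N. \<exists>d>0. \<forall>f\<in>vanishing \<epsilon>. (\<forall>i\<le>N. seminorms i f < d) \<longrightarrow> product_seminorms j (product_map f) \<le> e"
proof (rule closed_graph[OF vanishing_complete product_complete])
  fix f g a assume f: "f \<in> vanishing \<epsilon>"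
  have fA: "f \<in> topspace T"
    using f vanishing_mem by blast
  show "product_map f \<in> product_space"
    using vanishing_mem[OF fprim_vanishing[OF f \<epsilon>]] unfolding product_space_def product_map_def by simp
  show "product_map (\<lambda>x. a * f x) = (\<lambda>x. a * product_map f x)"
    using fprim_lincomb[OF fA fA, of a 0] fint_lincomb[OF fA fA, of a 0]
    by (auto simp: product_map_def fun_eq_iff split: option.split)
  assume "g \<in> vanishing \<epsilon>"
  then have gA: "g \<in> topspace T"
    using vanishing_mem by blast
  show "product_map (f + g) = product_map f + product_map g"
    using fprim_lincomb[OF fA gA, of 1 1] fint_lincomb[OF fA gA, of 1 1]
    by (auto simp: product_map_def fun_eq_iff plus_fun_def split: option.split)
qed (use assms product_map_closed_graph[OF \<epsilon>] in auto)

text \<open>By linearity, continuity at 0 is continuity at \<open>l\<close>, and the two limits are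
  the components of a single limit in the product. The filter is arbitrary because the rule is
  applied to points of a chart as well as to difference quotients.\<close>

lemma
  assumes \<epsilon>: "0 < \<epsilon>" "\<epsilon> \<le> 1"
    and lim: "limitin T f l F" and ev: "\<forall>\<^sub>F t in F. f t \<in> vanishing \<epsilon>" and l: "l \<in> vanishing \<epsilon>"
  shows limitin_fprim: "limitin T (\<lambda>t. fprim (f t)) (fprim l) F"
    and tendsto_fint: "((\<lambda>t. fint (f t)) \<longlongrightarrow> fint l) F"
proof -
  have lA: "l \<in> topspace T" and fprimA: "fprim g \<in> topspace T" if "g \<in> vanishing \<epsilon>" for g
    using vanishing_mem[OF fprim_vanishing[OF _ \<epsilon>]] l that vanishing_mem by auto
  have "((\<lambda>t. product_seminorms j (product_map (f t) - product_map l)) \<longlongrightarrow> 0) F" for j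
  proof (rule tendstoI)
    fix e :: real assume "e > 0"
    then obtain N d where d: "d > 0" and
      small: "\<And>f. f \<in> vanishing \<epsilon> \<Longrightarrow> \<forall>i\<le>N. seminorms i f < d \<Longrightarrow> product_seminorms j (product_map f) \<le> e / 2"
      using product_map_continuous[OF \<epsilon>, of "e / 2" j] by auto
    have "\<forall>\<^sub>F t in F. seminorms i (f t - l) < d" for i
      using lim order_tendstoD(2)[of _ 0 F d] d unfolding limitin_iff by blast
    then have "\<forall>\<^sub>F t in F. \<forall>i\<in>{..N}. seminorms i (f t - l) < d"
      by (intro eventually_ball_finite) auto
    with ev show "\<forall>\<^sub>F t in F. dist (product_seminorms j (product_map (f t) - product_map l)) 0 < e"
    proof eventually_elim
      case (elim t)
      have eq: "(\<lambda>x. 1 * f t x + (-1) * l x) = f t - l"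
        by auto
      have "f t - l \<in> vanishing \<epsilon>"
        using vanishing_lincomb[OF elim(1) l, of 1 "-1"] unfolding eq .
      moreover have "product_map (f t - l) = product_map (f t) - product_map l"
        using fprim_lincomb[OF vanishing_mem[OF elim(1)] vanishing_mem[OF l], of 1 "-1"]
          fint_lincomb[OF vanishing_mem[OF elim(1)] vanishing_mem[OF l], of 1 "-1"]
        unfolding eq by (auto simp: product_map_def fun_eq_iff split: option.split)
      moreover have "product_seminorms j (product_map (f t - l)) \<ge> 0"
        using fprimA[OF \<open>f t - l \<in> vanishing \<epsilon>\<close>] seminorm_nonneg
        by (simp add: product_seminorms_def product_map_def)
      ultimately show ?case
        using small[of "f t - l"] elim(2) \<open>e > 0\<close> by (force simp: dist_real_def)
    qed
  qed
  note main = this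
  have split: "product_seminorms j (product_map g - product_map l) = seminorms j (fprim g - fprim l) + cmod (fint g - fint l)"
    for j g
    unfolding product_seminorms_def product_map_def by (simp add: fun_diff_def)
  have "((\<lambda>t. seminorms j (fprim (f t) - fprim l)) \<longlongrightarrow> 0) F" for j
  proof (rule tendsto_sandwich[OF _ _ tendsto_const main[of j]])
    show "\<forall>\<^sub>F t in F. 0 \<le> seminorms j (fprim (f t) - fprim l)"
      using ev by eventually_elim (intro seminorm_nonneg diff_mem fprimA l)
  qed (auto simp: split)
  moreover have "\<forall>\<^sub>F t in F. fprim (f t) \<in> topspace T"
    using ev by eventually_elim (rule fprimA)
  ultimately show "limitin T (\<lambda>t. fprim (f t)) (fprim l) F"
    unfolding limitin_iff using fprimA[OF l] by blast
  have "((\<lambda>t. cmod (fint (f t) - fint l)) \<longlongrightarrow> 0) F"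
  proof (rule tendsto_sandwich[OF _ _ tendsto_const main[of 0]])
    show "\<forall>\<^sub>F t in F. cmod (fint (f t) - fint l) \<le> product_seminorms 0 (product_map (f t) - product_map l)"
      unfolding split using ev
      by eventually_elim (simp add: seminorm_nonneg diff_mem fprimA l)
  qed auto
  then show "((\<lambda>t. fint (f t)) \<longlongrightarrow> fint l) F"
    using LIM_zero_iff tendsto_norm_zero_iff by blast
qed

end

section \<open>Partial derivatives in coordinates\<close>

text \<open>Guarantees that partial derivatives, possibly one-sided, are unique: along each
  coordinate line the point is a limit point of the slice of \<open>S\<close>.\<close>

definition nondegenerate :: "nat \<Rightarrow> (nat \<Rightarrow> real) set \<Rightarrow> bool" where
  "nondegenerate N S \<longleftrightarrow> (\<forall>x\<in>S. \<forall>i<N. at (x i) within {t. x(i := t) \<in> S} \<noteq> bot)"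

lemma continuous_on_fun_upd_const: "continuous_on UNIV (\<lambda>t::real. (x::nat \<Rightarrow> real)(i := t))"
proof (rule continuous_on_coordinatewise_then_product)
  show "continuous_on UNIV (\<lambda>t. (x(i := t)) j)" for j
    by (cases "j = i") (auto intro: continuous_intros)
qed

lemma Euclidean_space_top_of_set: "Euclidean_space n = top_of_set {x. \<forall>i\<ge>n. x i = 0}"
  by (simp add: Euclidean_space_def euclidean_product_topology)

lemma openin_Euclidean_subset: "openin (Euclidean_space n) V \<Longrightarrow> x \<in> V \<Longrightarrow> i \<ge> n \<Longrightarrow> x i = 0"
  using openin_subset[of "Euclidean_space n" V] unfolding topspace_Euclidean_space by blast

lemma open_slice:
  assumes V: "openin (Euclidean_space n) V" and "x \<in> V" "i < n"
  shows "open {t. x(i := t) \<in> V}"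
proof -
  obtain U where U: "open U" "V = {x. \<forall>i\<ge>n. x i = 0} \<inter> U"
    using V unfolding Euclidean_space_top_of_set openin_open by blast
  have "{t. x(i := t) \<in> V} = (\<lambda>t. x(i := t)) -` U"
    using U(2) \<open>x \<in> V\<close> \<open>i < n\<close> by auto
  then show ?thesis
    using open_vimage[OF U(1) continuous_on_fun_upd_const] by simp
qed

lemma at_within_slice:
  assumes "openin (Euclidean_space n) V" and "x \<in> V" "i < n"
  shows "at (x i) within {t. x(i := t) \<in> V} = at (x i)"
  using open_slice[OF assms] assms(2) by (intro at_within_open) auto

lemma nondegenerate_openin: "openin (Euclidean_space n) V \<Longrightarrow> nondegenerate n V"
  unfolding nondegenerate_def by (simp add: at_within_slice)

lemma pd_eqI:
  assumes "nondegenerate N S" "x \<in> S" "i < N"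
    and "((\<lambda>t. f (x(i := t))) has_vector_derivative d) (at (x i) within {t. x(i := t) \<in> S})"
  shows "pd S i f x = d"
  using vector_derivative_within[OF _ assms(4)] assms(1-3) unfolding pd_def nondegenerate_def by simp

lemma pd_outside [simp]: "x \<notin> S \<Longrightarrow> pd S i f x = 0"
  unfolding pd_def by simp

lemma pd_cong:
  assumes "\<And>x. x \<in> S \<Longrightarrow> f x = g x" shows "pd S i f = pd S i g"
proof
  fix x show "pd S i f x = pd S i g x"
    unfolding pd_def using assms
    by (auto intro!: vector_derivative_within_cong)
qed

lemma pd_zero: "nondegenerate N S \<Longrightarrow> i < N \<Longrightarrow> pd S i (\<lambda>_. 0) = (\<lambda>_. 0)"
proof
  fix x assume "nondegenerate N S" "i < N"
  then show "pd S i (\<lambda>_. 0) x = 0"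
    by (cases "x \<in> S") (auto intro!: pd_eqI)
qed

lemma smooth_coords_has_pd:
  assumes "smooth_coords N S f" "set is \<subseteq> {..<N}" "i < N" "x \<in> S"
  shows "((\<lambda>t. foldr (pd S) is f (x(i := t))) has_vector_derivative foldr (pd S) (i # is) f x)
     (at (x i) within {t. x(i := t) \<in> S})"
proof -
  have "(\<lambda>t. foldr (pd S) is f (x(i := t))) differentiable (at (x i) within {t. x(i := t) \<in> S})"
    using assms unfolding smooth_coords_def by blast
  then show ?thesis
    using assms(4) by (simp add: pd_def vector_derivative_works)
qed

text \<open>\<open>smooth_coords\<close> speaks of iterated \<open>pd\<close>, defined by choice.
  Given a candidate \<open>D\<close> for all iterated derivatives at once, it is enough to check one
  differentiation at a time; induction on the list then identifies the iterated \<open>pd\<close>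
  with \<open>D\<close>.\<close>

lemma
  assumes N: "nondegenerate N S" and start: "\<And>x. x \<in> S \<Longrightarrow> f x = D [] x"
    and cont: "\<And>is. set is \<subseteq> {..<N} \<Longrightarrow> continuous_on S (D is)"
    and deriv: "\<And>is i x. set is \<subseteq> {..<N} \<Longrightarrow> i < N \<Longrightarrow> x \<in> S \<Longrightarrow>
      ((\<lambda>t. D is (x(i := t))) has_vector_derivative D (i # is) x) (at (x i) within {t. x(i := t) \<in> S})"
  shows smooth_coordsI: "smooth_coords N S f"
    and iterated_pd_eqI: "\<And>is x. set is \<subseteq> {..<N} \<Longrightarrow> x \<in> S \<Longrightarrow> foldr (pd S) is f x = D is x"
proof -
  show eq: "foldr (pd S) is f x = D is x" if "set is \<subseteq> {..<N}" "x \<in> S" for "is" x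
    using that
  proof (induction "is" arbitrary: x)
    case Nil
    then show ?case
      using start by simp
  next
    case (Cons i "is")
    then have "pd S i (foldr (pd S) is f) = pd S i (D is)"
      by (intro pd_cong) auto
    moreover have "pd S i (D is) x = D (i # is) x"
      using Cons.prems by (intro pd_eqI[OF N] deriv) auto
    ultimately show ?case
      by simp
  qed
  show "smooth_coords N S f"
    unfolding smooth_coords_def
  proof (intro allI impI conjI ballI)
    fix "is" assume "is": "set is \<subseteq> {..<N}"
    show "continuous_on S (foldr (pd S) is f)"
      using cont[OF "is"] eq[OF "is"] by (simp cong: continuous_on_cong)
    fix i x assume "i < N" "x \<in> S"
    have "((\<lambda>t. foldr (pd S) is f (x(i := t))) has_vector_derivative D (i # is) x)
        (at (x i) within {t. x(i := t) \<in> S})"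
      by (rule has_vector_derivative_transform[OF _ _ deriv[OF "is" \<open>i < N\<close> \<open>x \<in> S\<close>]])
        (use eq[OF "is"] \<open>x \<in> S\<close> in auto)
    then show "(\<lambda>t. foldr (pd S) is f (x(i := t))) differentiable (at (x i) within {t. x(i := t) \<in> S})"
      by (rule differentiableI_vector)
  qed
qed

lemma
  fixes f g :: "(nat \<Rightarrow> real) \<Rightarrow> complex"
  assumes N: "nondegenerate N S" and f: "smooth_coords N S f" and g: "smooth_coords N S g"
  shows smooth_coords_lincomb: "smooth_coords N S (\<lambda>x. a * f x + b * g x)"
    and pd_lincomb: "i < N \<Longrightarrow> pd S i (\<lambda>x. a * f x + b * g x) = (\<lambda>x. a * pd S i f x + b * pd S i g x)"
proof -
  let ?D = "\<lambda>is x. a * foldr (pd S) is f x + b * foldr (pd S) is g x"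
  have cont: "continuous_on S (?D is)" if "set is \<subseteq> {..<N}" for "is"
    using f g that unfolding smooth_coords_def by (intro continuous_intros) auto
  have deriv: "((\<lambda>t. ?D is (x(i := t))) has_vector_derivative ?D (i # is) x) (at (x i) within {t. x(i := t) \<in> S})"
    if "set is \<subseteq> {..<N}" "i < N" "x \<in> S" for "is" i x
    using that
    by (intro has_vector_derivative_add has_vector_derivative_mult_right smooth_coords_has_pd[OF f] smooth_coords_has_pd[OF g])
  show "smooth_coords N S (\<lambda>x. a * f x + b * g x)"
    by (rule smooth_coordsI[where D = ?D, OF N _ cont deriv]) auto
  assume "i < N"
  show "pd S i (\<lambda>x. a * f x + b * g x) = (\<lambda>x. a * pd S i f x + b * pd S i g x)"
  proof
    fix x
    have "foldr (pd S) [i] (\<lambda>x. a * f x + b * g x) x = ?D [i] x" if "x \<in> S"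
      by (rule iterated_pd_eqI[where D = ?D, OF N _ cont deriv]) (use \<open>i < N\<close> that in auto)
    then show "pd S i (\<lambda>x. a * f x + b * g x) x = a * pd S i f x + b * pd S i g x"
      by (cases "x \<in> S") simp_all
  qed
qed

lemma smooth_coords_zero:
  assumes "nondegenerate N S" shows "smooth_coords N S (\<lambda>_. 0)"
  by (rule smooth_coordsI[OF assms, of _ "\<lambda>_ _. 0"]) auto

text \<open>Connects derivatives in coordinates with the difference quotients of
  \<open>smooth_into\<close>, whose denominators are complex numbers.\<close>

lemma has_vector_derivative_at_iff:
  fixes f :: "real \<Rightarrow> complex"
  shows "(f has_vector_derivative d) (at x) \<longleftrightarrow>
    ((\<lambda>h. (f (x + h) - f x) / complex_of_real h) \<longlongrightarrow> d) (at 0)"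
proof -
  have "norm (f (x + h) - f x - h *\<^sub>R d) / norm h = norm ((f (x + h) - f x) / complex_of_real h - d)" if "h \<noteq> 0" for h
  proof -
    have "(f (x + h) - f x) / complex_of_real h - d = (f (x + h) - f x - h *\<^sub>R d) / complex_of_real h"
      using that by (simp add: scaleR_conv_of_real diff_divide_distrib)
    then show ?thesis
      by (simp add: norm_divide)
  qed
  then have "(\<lambda>h. norm (f (x + h) - f x - h *\<^sub>R d) / norm h) \<midarrow>0\<rightarrow> 0 \<longleftrightarrow>
     (\<lambda>h. norm ((f (x + h) - f x) / complex_of_real h - d)) \<midarrow>0\<rightarrow> 0"
    by (intro filterlim_cong) (auto simp: eventually_at_filter)
  then show ?thesis
    unfolding has_vector_derivative_def has_derivative_at tendsto_norm_zero_iff LIM_zero_iff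
    by (simp add: bounded_linear_scaleR_left)
qed

section \<open>Smooth families in an admissible space\<close>

text \<open>\<open>cyl n V\<close> is \<open>V \<times> [0,\<infinity>)\<close>, with the last factor as the coordinate of index \<open>n\<close>.\<close>

definition cyl :: "nat \<Rightarrow> (nat \<Rightarrow> real) set \<Rightarrow> (nat \<Rightarrow> real) set" where
  "cyl n V = {y. y(n := 0) \<in> V \<and> 0 \<le> y n}"

lemma slice_cyl:
  assumes "y \<in> cyl n V" "i < n"
  shows "{t. y(i := t) \<in> cyl n V} = {t. (y(n := 0))(i := t) \<in> V}"
  using assms by (auto simp: cyl_def fun_upd_twist)

lemma slice_cyl_last:
  assumes "y \<in> cyl n V"
  shows "{t. y(n := t) \<in> cyl n V} = {0..}"
  using assms by (auto simp: cyl_def)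

lemma nondegenerate_cyl:
  assumes V: "openin (Euclidean_space n) V"
  shows "nondegenerate (Suc n) (cyl n V)"
  unfolding nondegenerate_def
proof (intro ballI allI impI)
  fix y i assume y: "y \<in> cyl n V" and "i < Suc n"
  then consider "i = n" | "i < n"
    by linarith
  then show "at (y i) within {t. y(i := t) \<in> cyl n V} \<noteq> bot"
  proof cases
    case 1
    with y show ?thesis
      unfolding 1 slice_cyl_last[OF y] by (intro at_within_Ici_neq_bot) (simp add: cyl_def)
  next
    case 2
    have "at ((y(n := 0)) i) within {t. (y(n := 0))(i := t) \<in> V} \<noteq> bot"
      using nondegenerate_openin[OF V] y 2 unfolding nondegenerate_def cyl_def by blast
    with 2 show ?thesis
      unfolding slice_cyl[OF y 2] by simp
  qed
qed

context admissible_space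
begin

text \<open>What is asked of the witness in \<open>smooth_into\<close>, with continuity restated as
  a limit at each point. Linear operators known to preserve limits can then be applied to the whole
  family.\<close>

definition smooth_family :: "nat \<Rightarrow> (nat \<Rightarrow> real) set \<Rightarrow> (nat list \<Rightarrow> (nat \<Rightarrow> real) \<Rightarrow> real \<Rightarrow> complex) \<Rightarrow> bool" where
  "smooth_family n V D \<longleftrightarrow> (\<forall>is. set is \<subseteq> {..<n} \<longrightarrow>
     (\<forall>x\<in>V. limitin T (D is) (D is x) (at x within V) \<and>
        (\<forall>i<n. limitin T (\<lambda>h::real. \<lambda>r. (D is (x(i := x i + h)) r - D is x r) / complex_of_real h)
           (D (i # is) x) (at 0))))"

lemma continuous_map_iff_limitin:
  assumes V: "openin (Euclidean_space n) V" and mem: "\<And>x. x \<in> V \<Longrightarrow> g x \<in> topspace T"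
  shows "continuous_map (subtopology (Euclidean_space n) V) T g \<longleftrightarrow> (\<forall>x\<in>V. limitin T g (g x) (at x within V))"
proof -
  have "{x. \<forall>i\<ge>n. x i = 0} \<inter> V = V"
    using openin_Euclidean_subset[OF V] by blast
  then have top: "subtopology (Euclidean_space n) V = top_of_set V"
    unfolding Euclidean_space_top_of_set by (simp add: subtopology_subtopology)
  have at: "atin (top_of_set V) x = at x within V" if "x \<in> V" for x
    unfolding atin_subtopology_within[OF that] filter_eq_iff eventually_atin_within eventually_at_topological
    by auto
  show ?thesis
    unfolding top continuous_map_atin using at by simp
qed

lemma smooth_into_iff:
  assumes V: "openin (Euclidean_space n) V"
  shows "smooth_into n V T F \<longleftrightarrow> (\<exists>D. (\<forall>x\<in>V. D [] x = F x) \<and> smooth_family n V D)"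
proof -
  have "{x. \<forall>i\<ge>n. x i = 0} \<inter> V = V"
    using openin_Euclidean_subset[OF V] by blast
  then have top: "topspace (subtopology (Euclidean_space n) V) = V"
    by (simp add: topspace_Euclidean_space)
  have mem: "\<forall>x\<in>V. g x \<in> topspace T" if "continuous_map (subtopology (Euclidean_space n) V) T g" for g
    using continuous_map_image_subset_topspace[OF that] unfolding top by blast
  have "continuous_map (subtopology (Euclidean_space n) V) T g \<longleftrightarrow> (\<forall>x\<in>V. limitin T g (g x) (at x within V))" for g
  proof (cases "\<forall>x\<in>V. g x \<in> topspace T")
    case True
    then show ?thesis
      using continuous_map_iff_limitin[OF V, of g] by blast
  next
    case False
    then show ?thesis
      using mem[of g] limitin_topspace by metis
  qed
  then show ?thesis
    unfolding smooth_into_def smooth_family_def by (simp add: ball_conj_distrib) blast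
qed

lemma smooth_family_limit:
  "smooth_family n V D \<Longrightarrow> set is \<subseteq> {..<n} \<Longrightarrow> x \<in> V \<Longrightarrow> limitin T (D is) (D is x) (at x within V)"
  unfolding smooth_family_def by blast

lemma smooth_family_mem:
  "smooth_family n V D \<Longrightarrow> set is \<subseteq> {..<n} \<Longrightarrow> x \<in> V \<Longrightarrow> D is x \<in> topspace T"
  using smooth_family_limit limitin_topspace by metis

lemma smooth_family_deriv:
  "smooth_family n V D \<Longrightarrow> set is \<subseteq> {..<n} \<Longrightarrow> x \<in> V \<Longrightarrow> i < n \<Longrightarrow>
    limitin T (\<lambda>h. \<lambda>r. (D is (x(i := x i + h)) r - D is x r) / complex_of_real h) (D (i # is) x) (at 0)"
  unfolding smooth_family_def by blast

lemma eventually_slice: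
  assumes "openin (Euclidean_space n) V" "x \<in> V" "i < n"
  shows "\<forall>\<^sub>F h in at 0. x(i := x i + h) \<in> V"
proof -
  have "open ((\<lambda>h. x i + h) -` {t. x(i := t) \<in> V})"
    by (intro open_vimage open_slice[OF assms] continuous_intros)
  then have "\<forall>\<^sub>F h in nhds 0. h \<in> (\<lambda>h. x i + h) -` {t. x(i := t) \<in> V}"
    by (intro eventually_nhds_in_open) (use assms in auto)
  then show ?thesis
    unfolding eventually_at_filter by (rule eventually_mono) auto
qed

text \<open>Brings quotients into the shape for which the operators are known to be linear.\<close>

lemma difference_quotient_eq:
  "(\<lambda>r. (f r - g r) / complex_of_real h) = (\<lambda>r. (1 / complex_of_real h) * f r + (- 1 / complex_of_real h) * g r)"
  by (auto simp: fun_eq_iff field_simps diff_divide_distrib)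

text \<open>Each further derivative is a limit in \<open>T\<close> of difference quotients that
  vanish below \<epsilon>, and such limits vanish there too.\<close>

lemma smooth_family_vanishing:
  assumes V: "openin (Euclidean_space n) V" and D: "smooth_family n V D"
    and start: "\<And>x. x \<in> V \<Longrightarrow> D [] x \<in> vanishing \<epsilon>"
    and "set is \<subseteq> {..<n}" "x \<in> V"
  shows "D is x \<in> vanishing \<epsilon>"
  using assms(4,5)
proof (induction "is" arbitrary: x)
  case Nil
  then show ?case
    using start by blast
next
  case (Cons i "is")
  then have i: "i < n" "set is \<subseteq> {..<n}"
    by auto
  show ?case
  proof (rule vanishing_limit[OF smooth_family_deriv[OF D i(2) \<open>x \<in> V\<close> i(1)]])
    show "\<forall>\<^sub>F h in at 0. (\<lambda>r. (D is (x(i := x i + h)) r - D is x r) / complex_of_real h) \<in> vanishing \<epsilon>"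
      using eventually_slice[OF V \<open>x \<in> V\<close> i(1)]
    proof eventually_elim
      case (elim h)
      then show ?case
        unfolding difference_quotient_eq using Cons.IH i(2) \<open>x \<in> V\<close> by (intro vanishing_lincomb) auto
    qed
  qed simp
qed

text \<open>Limits in \<open>T\<close> are uniform on compact intervals together with all
  \<open>r\<close>-derivatives. Hence differentiation in \<open>r\<close> commutes with
  differentiation along V, and all mixed derivatives are jointly continuous on the cylinder.\<close>

lemma
  assumes V: "openin (Euclidean_space n) V" and D: "smooth_family n V D"
    and f: "\<And>y. y \<in> cyl n V \<Longrightarrow> f y = D [] (y(n := 0)) (y n)"
  shows smooth_family_cyl: "smooth_coords (Suc n) (cyl n V) f"
    and pd_cyl: "\<And>i y. i < n \<Longrightarrow> y \<in> cyl n V \<Longrightarrow> pd (cyl n V) i f y = D [i] (y(n := 0)) (y n)"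
    and pd_cyl_last: "\<And>y. y \<in> cyl n V \<Longrightarrow> pd (cyl n V) n f y = ddx (D [] (y(n := 0))) (y n)"
proof -
  \<comment> \<open>The candidate for the derivative along the list \<open>is\<close>: entries equal
    to \<open>n\<close> are counted and become derivatives in \<open>r\<close>, whatever their
    position; the other entries go to \<open>D\<close>.\<close>
  define E where "E is y = (ddx ^^ count_list is n) (D (filter (\<lambda>i. i < n) is) (y(n := 0))) (y n)" for "is" y
  have set: "set (filter (\<lambda>i. i < n) is) \<subseteq> {..<n}" for "is" :: "nat list"
    by auto
  have cont: "continuous_on (cyl n V) (E is)" for "is"
    unfolding continuous_on_def
  proof
    fix y0 assume y0: "y0 \<in> cyl n V"
    define c where "c = count_list is n"
    define g where "g = D (filter (\<lambda>i. i < n) is)"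
    define z0 where "z0 = y0(n := 0)"
    have z0: "z0 \<in> V"
      using y0 unfolding z0_def cyl_def by auto
    have gA: "g x \<in> topspace T" if "x \<in> V" for x
      unfolding g_def using smooth_family_mem[OF D set that] .
    \<comment> \<open>Covers the derivative of order \<open>c\<close> on an interval reaching one
      unit beyond the last coordinate of \<open>y0\<close>, hence all nearby points.\<close>
    define N where "N = max c (nat \<lceil>y0 n + 1\<rceil>)"
    have N: "c \<le> N" "y0 n + 1 \<le> real N"
      unfolding N_def by (auto intro: order_trans[OF real_nat_ceiling_ge])
    have tv: "((\<lambda>y. y(n := 0)) \<longlongrightarrow> z0) (at y0 within cyl n V)"
    proof -
      have "continuous_on UNIV (\<lambda>y::nat \<Rightarrow> real. y(n := 0))"
      proof (rule continuous_on_coordinatewise_then_product)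
        show "continuous_on UNIV (\<lambda>y::nat \<Rightarrow> real. (y(n := 0)) j)" for j
          by (cases "j = n") auto
      qed
      then have "((\<lambda>y. y(n := 0)) \<longlongrightarrow> z0) (at y0)"
        unfolding continuous_on_def z0_def by auto
      then show ?thesis
        by (rule tendsto_within_subset) auto
    qed
    have "limitin smooth_topology g (g z0) (at z0 within V)"
      unfolding g_def by (intro limitin_smooth smooth_family_limit[OF D set z0])
    then have "((\<lambda>x. smooth_seminorm N (g x - g z0)) \<longlongrightarrow> 0) (at z0 within V)"
      unfolding smooth_topology_alt smooth_half_line.limitin_seminorm_topology by blast
    then have "((\<lambda>x. smooth_seminorm N (g x - g z0)) \<longlongrightarrow> smooth_seminorm N (g z0 - g z0)) (at z0 within V)"
      using smooth_half_line.seminorm_zero by simp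
    then have "continuous (at z0 within V) (\<lambda>x. smooth_seminorm N (g x - g z0))"
      unfolding continuous_within .
    moreover have "\<forall>\<^sub>F y in at y0 within cyl n V. y(n := 0) \<in> V"
      by (simp add: eventually_at_filter cyl_def)
    ultimately have "((\<lambda>y. smooth_seminorm N (g (y(n := 0)) - g z0)) \<longlongrightarrow> smooth_seminorm N (g z0 - g z0))
        (at y0 within cyl n V)"
      using tv by (rule continuous_within_tendsto_compose)
    then have lim1: "((\<lambda>y. smooth_seminorm N (g (y(n := 0)) - g z0)) \<longlongrightarrow> 0) (at y0 within cyl n V)"
      using smooth_half_line.seminorm_zero by simp
    have lim2: "((\<lambda>y. (ddx ^^ c) (g z0) (y n)) \<longlongrightarrow> (ddx ^^ c) (g z0) (y0 n)) (at y0 within cyl n V)"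
    proof -
      have "continuous_on {0..} ((ddx ^^ c) (g z0))"
        using gA[OF z0] by (intro continuous_on_smooth_half_line smooth_half_line_funpow_ddx mem_smooth)
      moreover have "continuous_on (cyl n V) (\<lambda>y. y n)"
        by (rule continuous_on_subset[OF continuous_on_product_coordinates]) simp
      ultimately have "continuous_on (cyl n V) (\<lambda>y. (ddx ^^ c) (g z0) (y n))"
        by (rule continuous_on_compose2) (auto simp: cyl_def)
      with y0 show ?thesis
        unfolding continuous_on_def by blast
    qed
    \<comment> \<open>Joint continuity splits in two: functions over nearby base points are close
      uniformly in \<open>r\<close>, and the one function over \<open>z0\<close> is continuous in
      \<open>r\<close>.\<close>
    have "((\<lambda>y. E is y - (ddx ^^ c) (g z0) (y n)) \<longlongrightarrow> 0) (at y0 within cyl n V)"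
    proof (rule Lim_null_comparison[OF _ lim1])
      have "((\<lambda>y. y n) \<longlongrightarrow> y0 n) (at y0 within cyl n V)"
        by (rule tendsto_within_subset[OF continuous_on_product_coordinates[unfolded continuous_on_def, rule_format]])
          simp_all
      then have "\<forall>\<^sub>F y in at y0 within cyl n V. y n < y0 n + 1"
        by (rule order_tendstoD) simp
      moreover have "\<forall>\<^sub>F y in at y0 within cyl n V. y \<in> cyl n V"
        by (simp add: eventually_at_filter)
      ultimately show "\<forall>\<^sub>F y in at y0 within cyl n V.
         norm (E is y - (ddx ^^ c) (g z0) (y n)) \<le> smooth_seminorm N (g (y(n := 0)) - g z0)"
      proof eventually_elim
        case (elim y)
        then have y: "y(n := 0) \<in> V" "0 \<le> y n"
          by (auto simp: cyl_def)
        note s = mem_smooth[OF gA[OF y(1)]] mem_smooth[OF gA[OF z0]]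
        have "(ddx ^^ c) (g (y(n := 0)) - g z0) (y n) = E is y - (ddx ^^ c) (g z0) (y n)"
          using ddx_funpow_lincomb[OF s, of c 1 "-1"] by (simp add: fun_diff_def E_def c_def g_def)
        moreover have "cmod ((ddx ^^ c) (g (y(n := 0)) - g z0) (y n)) \<le> smooth_seminorm N (g (y(n := 0)) - g z0)"
          using elim(1) y N s by (intro smooth_seminorm_upper smooth_half_line.diff_mem) auto
        ultimately show ?case
          by simp
      qed
    qed
    from tendsto_add[OF this lim2] show "(E is \<longlongrightarrow> E is y0) (at y0 within cyl n V)"
      by (simp add: E_def[abs_def] c_def g_def z0_def)
  qed
  have deriv: "((\<lambda>t. E is (y(i := t))) has_vector_derivative E (i # is) y) (at (y i) within {t. y(i := t) \<in> cyl n V})"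
    if i: "i < Suc n" and y: "y \<in> cyl n V" for "is" i y
  proof -
    define c where "c = count_list is n"
    define js where "js = filter (\<lambda>i. i < n) is"
    define z where "z = y(n := 0)"
    have z: "z \<in> V" and r: "0 \<le> y n"
      using y unfolding z_def cyl_def by auto
    have js: "set js \<subseteq> {..<n}"
      unfolding js_def by auto
    have DA: "D js x \<in> smooth_half_line" if "x \<in> V" for x
      using mem_smooth[OF smooth_family_mem[OF D js that]] .
    consider "i = n" | "i < n"
      using i by linarith
    then show ?thesis
    proof cases
      case 1
      have "((ddx ^^ c) (D js z) has_vector_derivative ddx ((ddx ^^ c) (D js z)) (y n)) (at (y n) within {0..})"
        by (intro has_ddx smooth_half_line_funpow_ddx DA z r)
      with 1 show ?thesis
        unfolding 1 slice_cyl_last[OF y] E_def by (simp add: c_def js_def z_def)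
    next
      case 2
      \<comment> \<open>Convergence of the quotients in \<open>T\<close> includes that of their
        \<open>c\<close>-th derivatives at the point \<open>y n\<close>, so the derivative along
        \<open>i\<close> may be taken after \<open>ddx ^^ c\<close>.\<close>
      have "((\<lambda>h. (ddx ^^ c) (\<lambda>r. (D js (z(i := z i + h)) r - D js z r) / complex_of_real h) (y n))
        \<longlongrightarrow> (ddx ^^ c) (D (i # js) z) (y n)) (at 0)"
        by (rule limitin_ddx_pointwise[OF smooth_family_deriv[OF D js z 2] r])
      then have "((\<lambda>h. ((ddx ^^ c) (D js (z(i := z i + h))) (y n) - (ddx ^^ c) (D js z) (y n)) / complex_of_real h)
        \<longlongrightarrow> (ddx ^^ c) (D (i # js) z) (y n)) (at 0)"
      proof (rule Lim_transform_eventually)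
        show "\<forall>\<^sub>F h in at 0. (ddx ^^ c) (\<lambda>r. (D js (z(i := z i + h)) r - D js z r) / complex_of_real h) (y n)
           = ((ddx ^^ c) (D js (z(i := z i + h))) (y n) - (ddx ^^ c) (D js z) (y n)) / complex_of_real h"
          using eventually_slice[OF V z 2]
        proof eventually_elim
          case (elim h)
          show ?case
            unfolding difference_quotient_eq ddx_funpow_lincomb[OF DA[OF elim] DA[OF z]]
            by (simp add: diff_divide_distrib)
        qed
      qed
      then have "((\<lambda>t. (ddx ^^ c) (D js (z(i := t))) (y n)) has_vector_derivative (ddx ^^ c) (D (i # js) z) (y n)) (at (z i))"
        unfolding has_vector_derivative_at_iff by simp
      moreover have "z i = y i"
        using 2 by (simp add: z_def)
      ultimately have "((\<lambda>t. (ddx ^^ c) (D js (z(i := t))) (y n)) has_vector_derivative (ddx ^^ c) (D (i # js) z) (y n))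
        (at (y i) within {t. y(i := t) \<in> cyl n V})"
        using has_vector_derivative_at_within by metis
      moreover have "(\<lambda>t. E is (y(i := t))) = (\<lambda>t. (ddx ^^ c) (D js (z(i := t))) (y n))"
        using 2 by (simp add: E_def c_def js_def z_def fun_upd_twist)
      moreover have "E (i # is) y = (ddx ^^ c) (D (i # js) z) (y n)"
        using 2 by (simp add: E_def c_def js_def z_def)
      ultimately show ?thesis
        by simp
    qed
  qed
  have start: "f y = E [] y" if "y \<in> cyl n V" for y
    using f[OF that] by (simp add: E_def)
  note N = nondegenerate_cyl[OF V]
  show "smooth_coords (Suc n) (cyl n V) f"
    by (rule smooth_coordsI[where D = E, OF N start cont deriv])
  have eq: "foldr (pd (cyl n V)) is f y = E is y" if "set is \<subseteq> {..<Suc n}" "y \<in> cyl n V" for "is" y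
    by (rule iterated_pd_eqI[where D = E, OF N start cont deriv]) (use that in auto)
  show "pd (cyl n V) i f y = D [i] (y(n := 0)) (y n)" if "i < n" "y \<in> cyl n V" for i y
    using eq[of "[i]" y] that by (simp add: E_def)
  show "pd (cyl n V) n f y = ddx (D [] (y(n := 0))) (y n)" if "y \<in> cyl n V" for y
    using eq[of "[n]" y] that by (simp add: E_def)
qed

text \<open>Differentiation under \<open>fint\<close>: the quotients all vanish below \<epsilon>,
  where \<open>fint\<close> respects limits.\<close>

lemma
  assumes V: "openin (Euclidean_space n) V" and D: "smooth_family n V D"
    and start: "\<And>x. x \<in> V \<Longrightarrow> D [] x \<in> vanishing \<epsilon>" and \<epsilon>: "0 < \<epsilon>" "\<epsilon> \<le> 1"
    and g: "\<And>x. x \<in> V \<Longrightarrow> g x = fint (D [] x)"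
  shows smooth_coords_fint: "smooth_coords n V g"
    and pd_fint: "\<And>i x. i < n \<Longrightarrow> x \<in> V \<Longrightarrow> pd V i g x = fint (D [i] x)"
proof -
  note DV = smooth_family_vanishing[OF V D start]
  have cont: "continuous_on V (\<lambda>x. fint (D is x))" if "is": "set is \<subseteq> {..<n}" for "is"
    unfolding continuous_on_def
  proof
    fix x assume "x \<in> V"
    show "((\<lambda>x. fint (D is x)) \<longlongrightarrow> fint (D is x)) (at x within V)"
      by (rule tendsto_fint[OF \<epsilon> smooth_family_limit[OF D "is" \<open>x \<in> V\<close>] _ DV[OF _ "is" \<open>x \<in> V\<close>]])
        (use DV[OF _ "is"] in \<open>auto simp: eventually_at_filter\<close>)
  qed
  have deriv: "((\<lambda>t. fint (D is (x(i := t)))) has_vector_derivative fint (D (i # is) x)) (at (x i) within {t. x(i := t) \<in> V})"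
    if "is": "set is \<subseteq> {..<n}" and i: "i < n" and x: "x \<in> V" for "is" i x
  proof -
    let ?q = "\<lambda>h r. (D is (x(i := x i + h)) r - D is x r) / complex_of_real h"
    have ev: "\<forall>\<^sub>F h in at 0. ?q h \<in> vanishing \<epsilon> \<and>
      fint (?q h) = (fint (D is (x(i := x i + h))) - fint (D is x)) / complex_of_real h"
      using eventually_slice[OF V x i]
    proof eventually_elim
      case (elim h)
      have D1: "D is (x(i := x i + h)) \<in> vanishing \<epsilon>" and D2: "D is x \<in> vanishing \<epsilon>"
        using DV "is" elim x by auto
      have "?q h \<in> vanishing \<epsilon>"
        unfolding difference_quotient_eq by (rule vanishing_lincomb[OF D1 D2])
      moreover have "fint (?q h) = (fint (D is (x(i := x i + h))) - fint (D is x)) / complex_of_real h"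
        unfolding difference_quotient_eq fint_lincomb[OF vanishing_mem[OF D1] vanishing_mem[OF D2]]
        by (simp add: diff_divide_distrib)
      ultimately show ?case ..
    qed
    have "((\<lambda>h. fint (?q h)) \<longlongrightarrow> fint (D (i # is) x)) (at 0)"
      by (rule tendsto_fint[OF \<epsilon> smooth_family_deriv[OF D "is" x i]])
        (use ev DV[of "i # is" x] "is" i x in \<open>auto elim: eventually_mono\<close>)
    then have "((\<lambda>h. (fint (D is (x(i := x i + h))) - fint (D is x)) / complex_of_real h) \<longlongrightarrow> fint (D (i # is) x)) (at 0)"
      by (rule Lim_transform_eventually) (use ev in \<open>auto elim: eventually_mono\<close>)
    then show ?thesis
      unfolding at_within_slice[OF V x i] has_vector_derivative_at_iff by simp
  qed
  note N = nondegenerate_openin[OF V]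
  show "smooth_coords n V g"
    by (rule smooth_coordsI[where D = "\<lambda>is x. fint (D is x)", OF N g cont deriv])
  have "foldr (pd V) [i] g x = fint (D [i] x)" if "i < n" "x \<in> V" for i x
    by (rule iterated_pd_eqI[where D = "\<lambda>is x. fint (D is x)", OF N g cont deriv]) (use that in auto)
  then show "pd V i g x = fint (D [i] x)" if "i < n" "x \<in> V" for i x
    using that by simp
qed

lemma smooth_family_fprim:
  assumes V: "openin (Euclidean_space n) V" and D: "smooth_family n V D"
    and start: "\<And>x. x \<in> V \<Longrightarrow> D [] x \<in> vanishing \<epsilon>" and \<epsilon>: "0 < \<epsilon>" "\<epsilon> \<le> 1"
  shows "smooth_family n V (\<lambda>is x. fprim (D is x))"
  unfolding smooth_family_def
proof (intro allI impI ballI conjI)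
  note DV = smooth_family_vanishing[OF V D start]
  fix "is" x assume "is": "set is \<subseteq> {..<n}" and x: "x \<in> V"
  show "limitin T (\<lambda>x. fprim (D is x)) (fprim (D is x)) (at x within V)"
    by (rule limitin_fprim[OF \<epsilon> smooth_family_limit[OF D "is" x] _ DV[OF _ "is" x]])
      (use DV[OF _ "is"] in \<open>auto simp: eventually_at_filter\<close>)
  fix i assume i: "i < n"
  let ?q = "\<lambda>h r. (D is (x(i := x i + h)) r - D is x r) / complex_of_real h"
  have ev: "\<forall>\<^sub>F h in at 0. ?q h \<in> vanishing \<epsilon> \<and>
    fprim (?q h) = (\<lambda>r. (fprim (D is (x(i := x i + h))) r - fprim (D is x) r) / complex_of_real h)"
    using eventually_slice[OF V x i]
  proof eventually_elim
    case (elim h)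
    have D1: "D is (x(i := x i + h)) \<in> vanishing \<epsilon>" and D2: "D is x \<in> vanishing \<epsilon>"
      using DV "is" elim x by auto
    have "?q h \<in> vanishing \<epsilon>"
      unfolding difference_quotient_eq by (rule vanishing_lincomb[OF D1 D2])
    moreover have "fprim (?q h) = (\<lambda>r. (fprim (D is (x(i := x i + h))) r - fprim (D is x) r) / complex_of_real h)"
      unfolding difference_quotient_eq fprim_lincomb[OF vanishing_mem[OF D1] vanishing_mem[OF D2]] ..
    ultimately show ?case ..
  qed
  have "limitin T (\<lambda>h. fprim (?q h)) (fprim (D (i # is) x)) (at 0)"
    by (rule limitin_fprim[OF \<epsilon> smooth_family_deriv[OF D "is" x i]])
      (use ev DV[of "i # is" x] "is" i x in \<open>auto elim: eventually_mono\<close>)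
  then show "limitin T (\<lambda>h r. (fprim (D is (x(i := x i + h))) r - fprim (D is x) r) / complex_of_real h)
     (fprim (D (i # is) x)) (at 0)"
    by (rule limitin_transform_eventually[rotated]) (use ev in \<open>auto elim: eventually_mono\<close>)
qed

section \<open>Algebraic operations on smooth families\<close>

lemma limitin_scale:
  assumes "(c \<longlongrightarrow> d) F" "f \<in> topspace T"
  shows "limitin T (\<lambda>t r. c t * f r) (\<lambda>r. d * f r) F"
  unfolding limitin_iff
proof (intro conjI allI)
  fix j
  have "((\<lambda>t. cmod (c t - d) * seminorms j f) \<longlongrightarrow> 0) F"
    using LIM_zero[OF assms(1)] by (intro tendsto_mult_left_zero tendsto_norm_zero)
  moreover have "seminorms j ((\<lambda>r. c t * f r) - (\<lambda>r. d * f r)) = cmod (c t - d) * seminorms j f" for t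
    using seminorm_scale[OF assms(2), of j "c t - d"] by (simp add: fun_diff_def algebra_simps)
  ultimately show "((\<lambda>t. seminorms j ((\<lambda>r. c t * f r) - (\<lambda>r. d * f r))) \<longlongrightarrow> 0) F"
    by simp
qed (use assms scale_mem in \<open>auto intro: always_eventually\<close>)

text \<open>Covers the coefficients of \<phi> \<and> e dr, which are scalar functions on M times one
  fixed function of \<open>r\<close>.\<close>

lemma smooth_family_scale:
  assumes V: "openin (Euclidean_space n) V" and \<phi>: "smooth_coords n V \<phi>" and f: "f \<in> topspace T"
  shows "smooth_family n V (\<lambda>is x r. foldr (pd V) is \<phi> x * f r)"
  unfolding smooth_family_def
proof (intro allI impI ballI conjI)
  fix "is" x assume "is": "set is \<subseteq> {..<n}" and x: "x \<in> V"
  have "continuous_on V (foldr (pd V) is \<phi>)"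
    using \<phi> "is" unfolding smooth_coords_def by blast
  then show "limitin T (\<lambda>x r. foldr (pd V) is \<phi> x * f r) (\<lambda>r. foldr (pd V) is \<phi> x * f r) (at x within V)"
    using x unfolding continuous_on_def by (intro limitin_scale f) blast
  fix i assume i: "i < n"
  let ?q = "\<lambda>h. (foldr (pd V) is \<phi> (x(i := x i + h)) - foldr (pd V) is \<phi> x) / complex_of_real h"
  have "(?q \<longlongrightarrow> foldr (pd V) (i # is) \<phi> x) (at 0)"
    using smooth_coords_has_pd[OF \<phi> "is" i x]
    unfolding at_within_slice[OF V x i] has_vector_derivative_at_iff by simp
  from limitin_scale[OF this f]
  show "limitin T (\<lambda>h r. (foldr (pd V) is \<phi> (x(i := x i + h)) * f r - foldr (pd V) is \<phi> x * f r) / complex_of_real h)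
      (\<lambda>r. foldr (pd V) (i # is) \<phi> x * f r) (at 0)"
    by (simp add: algebra_simps diff_divide_distrib)
qed

lemma limitin_lincomb:
  assumes f: "limitin T f k F" and g: "limitin T g l F"
  shows "limitin T (\<lambda>t r. a * f t r + b * g t r) (\<lambda>r. a * k r + b * l r) F"
  unfolding limitin_iff
proof (intro conjI allI)
  have kl: "k \<in> topspace T" "l \<in> topspace T"
    and ev: "\<forall>\<^sub>F t in F. f t \<in> topspace T" "\<forall>\<^sub>F t in F. g t \<in> topspace T"
    using f g unfolding limitin_iff by auto
  show "(\<lambda>r. a * k r + b * l r) \<in> topspace T"
    using kl by (intro lincomb_mem)
  show ev': "\<forall>\<^sub>F t in F. (\<lambda>r. a * f t r + b * g t r) \<in> topspace T"
    using ev by eventually_elim (rule lincomb_mem)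
  fix j
  have "((\<lambda>t. cmod a * seminorms j (f t - k) + cmod b * seminorms j (g t - l)) \<longlongrightarrow> cmod a * 0 + cmod b * 0) F"
    using f g unfolding limitin_iff by (intro tendsto_intros) auto
  then have lim: "((\<lambda>t. cmod a * seminorms j (f t - k) + cmod b * seminorms j (g t - l)) \<longlongrightarrow> 0) F"
    by simp
  show "((\<lambda>t. seminorms j ((\<lambda>r. a * f t r + b * g t r) - (\<lambda>r. a * k r + b * l r))) \<longlongrightarrow> 0) F"
  proof (rule Lim_null_comparison[OF _ lim])
    show "\<forall>\<^sub>F t in F. norm (seminorms j ((\<lambda>r. a * f t r + b * g t r) - (\<lambda>r. a * k r + b * l r)))
      \<le> cmod a * seminorms j (f t - k) + cmod b * seminorms j (g t - l)"
      using ev ev'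
    proof eventually_elim
      case (elim t)
      have d: "f t - k \<in> topspace T" "g t - l \<in> topspace T"
        using elim kl by auto
      have "(\<lambda>r. a * f t r + b * g t r) - (\<lambda>r. a * k r + b * l r)
        = (\<lambda>r. a * (f t - k) r) + (\<lambda>r. b * (g t - l) r)"
        by (auto simp: algebra_simps)
      then show ?case
        using seminorm_add[OF scale_mem[OF d(1)] scale_mem[OF d(2)], of j a b]
          seminorm_nonneg[OF add_mem[OF scale_mem[OF d(1)] scale_mem[OF d(2)]], of j a b]
        unfolding seminorm_scale[OF d(1)] seminorm_scale[OF d(2)] by simp
    qed
  qed
qed

lemma smooth_family_lincomb:
  assumes D: "smooth_family n V D" and E: "smooth_family n V E"
  shows "smooth_family n V (\<lambda>is x r. a * D is x r + b * E is x r)"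
  unfolding smooth_family_def
proof (intro allI impI ballI conjI)
  fix "is" x assume "is": "set is \<subseteq> {..<n}" and x: "x \<in> V"
  show "limitin T (\<lambda>x r. a * D is x r + b * E is x r) (\<lambda>r. a * D is x r + b * E is x r) (at x within V)"
    by (intro limitin_lincomb smooth_family_limit[OF D "is" x] smooth_family_limit[OF E "is" x])
  fix i assume i: "i < n"
  from limitin_lincomb[OF smooth_family_deriv[OF D "is" x i] smooth_family_deriv[OF E "is" x i], of a b]
  show "limitin T (\<lambda>h r. (a * D is (x(i := x i + h)) r + b * E is (x(i := x i + h)) r - (a * D is x r + b * E is x r)) / complex_of_real h)
      (\<lambda>r. a * D (i # is) x r + b * E (i # is) x r) (at 0)"
    by (simp add: algebra_simps diff_divide_distrib add_divide_distrib)
qed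

end

section \<open>Minors of the Jacobian of a product chart\<close>

text \<open>Minors of an arbitrary doubly indexed family, which separates the linear algebra from
  the derivatives in \<open>jacobian_minor\<close>.\<close>

definition minor :: "(nat \<Rightarrow> nat \<Rightarrow> real) \<Rightarrow> nat set \<Rightarrow> nat set \<Rightarrow> real" where
  "minor P J I = Determinant.det (Matrix.mat (card J) (card I)
     (\<lambda>(a, b). P (sorted_list_of_set J ! a) (sorted_list_of_set I ! b)))"

lemma jacobian_minor_eq:
  "jacobian_minor c d J I x = minor (\<lambda>j i. pd (overlap c d) i (\<lambda>y. transition c d y j) x) J I"
  unfolding jacobian_minor_def minor_def ..

lemma sorted_list_nth_mem: "finite J \<Longrightarrow> a < card J \<Longrightarrow> sorted_list_of_set J ! a \<in> J"
  by (metis length_sorted_list_of_set nth_mem set_sorted_list_of_set)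

lemma sorted_list_nth_surj:
  assumes "finite J" "j \<in> J" shows "\<exists>a<card J. sorted_list_of_set J ! a = j"
  using assms by (metis in_set_conv_nth length_sorted_list_of_set set_sorted_list_of_set)

lemma minor_cong:
  assumes "finite J" "finite I" "\<And>j i. j \<in> J \<Longrightarrow> i \<in> I \<Longrightarrow> P j i = Q j i"
  shows "minor P J I = minor Q J I"
proof -
  have "Matrix.mat (card J) (card I) (\<lambda>(a, b). P (sorted_list_of_set J ! a) (sorted_list_of_set I ! b))
    = Matrix.mat (card J) (card I) (\<lambda>(a, b). Q (sorted_list_of_set J ! a) (sorted_list_of_set I ! b))"
    using assms by (intro eq_matI) (auto simp: sorted_list_nth_mem)
  then show ?thesis
    unfolding minor_def by simp
qed

text \<open>Every product in the Leibniz expansion contains a factor from row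
  \<open>j\<close>.\<close>

lemma minor_zero_row:
  assumes "finite J" "finite I" "card J = card I" "j \<in> J" "\<And>i. i \<in> I \<Longrightarrow> P j i = 0"
  shows "minor P J I = 0"
proof -
  define A where "A = Matrix.mat (card J) (card I)
     (\<lambda>(a, b). P (sorted_list_of_set J ! a) (sorted_list_of_set I ! b))"
  obtain a where a: "a < card J" "sorted_list_of_set J ! a = j"
    using sorted_list_nth_surj assms by blast
  have "(\<Prod>i = 0..<card J. A $$ (i, p i)) = 0" if "p permutes {0..<card J}" for p
  proof (rule prod_zero)
    have "p a < card J"
      using permutes_in_image[OF that, of a] a by simp
    then have "A $$ (a, p a) = 0"
      unfolding A_def using a assms by (simp add: sorted_list_nth_mem)
    then show "\<exists>i\<in>{0..<card J}. A $$ (i, p i) = 0"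
      using a by auto
  qed simp
  moreover have "A \<in> carrier_mat (card J) (card J)"
    unfolding A_def using assms by simp
  ultimately show ?thesis
    unfolding minor_def A_def[symmetric] by (subst det_def') (auto intro!: sum.neutral)
qed

lemma minor_zero_column:
  assumes "finite J" "finite I" "card J = card I" "i \<in> I" "\<And>j. j \<in> J \<Longrightarrow> P j i = 0"
  shows "minor P J I = 0"
proof -
  define A where "A = Matrix.mat (card J) (card I)
     (\<lambda>(a, b). P (sorted_list_of_set J ! a) (sorted_list_of_set I ! b))"
  obtain b where b: "b < card J" "sorted_list_of_set I ! b = i"
    using sorted_list_nth_surj assms by metis
  have "(\<Prod>k<card J. A $$ (p k, k)) = 0" if "p permutes {0..<card J}" for p
  proof (rule prod_zero)
    have "p b < card J"
      using permutes_in_image[OF that, of b] b by simp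
    then have "A $$ (p b, b) = 0"
      unfolding A_def using b assms by (simp add: sorted_list_nth_mem)
    then show "\<exists>k\<in>{..<card J}. A $$ (p k, k) = 0"
      using b by auto
  qed simp
  moreover have "A \<in> carrier_mat (card J) (card J)"
    unfolding A_def using assms by simp
  ultimately show ?thesis
    unfolding minor_def A_def[symmetric] by (subst det_col) (auto intro!: sum.neutral)
qed

text \<open>Distinct index sets of equal size leave some \<open>j\<close> in \<open>J\<close>
  outside \<open>I\<close>, and its row is zero.\<close>

lemma minor_identity:
  assumes "finite J" "finite I" "card J = card I"
  shows "minor (\<lambda>j i. of_bool (j = i)) J I = of_bool (J = I)"
proof (cases "J = I")
  case True
  have "Matrix.mat (card I) (card I) (\<lambda>(a, b). of_bool (sorted_list_of_set I ! a = sorted_list_of_set I ! b)) = (1\<^sub>m (card I) :: real mat)"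
    using assms by (intro eq_matI) (auto simp: nth_eq_iff_index_eq)
  with True show ?thesis
    unfolding minor_def by simp
next
  case False
  then obtain j where "j \<in> J" "j \<notin> I"
    using assms card_subset_eq by blast
  then show ?thesis
    using False assms by (subst minor_zero_row[of _ _ j]) auto
qed

text \<open>The index of dr exceeds all others and so ends the sorted list that orders rows and
  columns; this puts it in the corner of the matrix.\<close>

lemma sorted_list_of_set_insert_last:
  fixes n :: nat
  assumes "J \<subseteq> {..<n}" shows "sorted_list_of_set (insert n J) = sorted_list_of_set J @ [n]"
proof -
  have fin: "finite J"
    using assms finite_subset by blast
  have "sorted (sorted_list_of_set J @ [n])" "distinct (sorted_list_of_set J @ [n])"
    using assms fin by (auto simp: sorted_append less_imp_le subset_iff)
  then have "sorted_list_of_set (set (sorted_list_of_set J @ [n])) = sorted_list_of_set J @ [n]"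
    by (rule sorted_list_of_set.idem_if_sorted_distinct)
  moreover have "set (sorted_list_of_set J @ [n]) = insert n J"
    using fin by auto
  ultimately show ?thesis
    by (simp only:)
qed

text \<open>The last row is zero except for the corner entry 1, so the matrix is block triangular;
  the column above the corner is arbitrary.\<close>

lemma minor_insert_last:
  assumes J: "J \<subseteq> {..<n}" and I: "I \<subseteq> {..<n}" and "card J = card I"
    and "P n n = 1" "\<And>i. i \<in> I \<Longrightarrow> P n i = 0"
  shows "minor P (insert n J) (insert n I) = minor P J I"
proof -
  have fin: "finite J" "finite I" and n: "n \<notin> J" "n \<notin> I"
    using J I finite_subset by blast+
  define k where "k = card I"
  let ?J = "sorted_list_of_set J" and ?I = "sorted_list_of_set I"
  let ?A = "Matrix.mat k k (\<lambda>(a, b). P (?J ! a) (?I ! b))"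
  have len: "length ?J = k" "length ?I = k"
    using assms(3) unfolding k_def by auto
  have "Matrix.mat (Suc k) (Suc k) (\<lambda>(a, b). P ((?J @ [n]) ! a) ((?I @ [n]) ! b))
    = four_block_mat ?A (Matrix.mat k 1 (\<lambda>(a, b). P (?J ! a) n)) (0\<^sub>m 1 k) (1\<^sub>m 1)"
    using assms(4,5) fin len by (intro eq_matI) (auto simp: nth_append less_Suc_eq sorted_list_nth_mem k_def)
  moreover have "Determinant.det (four_block_mat ?A (Matrix.mat k 1 (\<lambda>(a, b). P (?J ! a) n)) (0\<^sub>m 1 k) (1\<^sub>m 1))
    = Determinant.det ?A * Determinant.det (1\<^sub>m 1)"
    by (rule det_four_block_mat_lower_left_zero) auto
  ultimately show ?thesis
    unfolding minor_def sorted_list_of_set_insert_last[OF J] sorted_list_of_set_insert_last[OF I]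
    using fin n assms(3) by (simp add: k_def)
qed

section \<open>Product charts\<close>

lemma chart_inj:
  assumes "is_chart n X c" shows "inj_on (snd c) (fst c)"
proof -
  have "homeomorphic_map (subtopology X (fst c)) (subtopology (Euclidean_space n) (chart_image c)) (snd c)" "openin X (fst c)"
    using assms unfolding is_chart_def by auto
  then show ?thesis
    using openin_subset[of X "fst c"] unfolding homeomorphic_map_def by (simp add: Int_absorb1)
qed

lemma chart_zero:
  assumes "is_chart n X c" "p \<in> fst c" "i \<ge> n" shows "snd c p i = 0"
proof -
  have "openin (Euclidean_space n) (chart_image c)" "snd c p \<in> chart_image c"
    using assms unfolding is_chart_def chart_image_def by auto
  then show ?thesis
    using openin_Euclidean_subset assms(3) by blast
qed

lemma chart_upd_last:
  assumes "is_chart n X c" "p \<in> fst c" shows "(snd c p)(n := 0) = snd c p"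
  using chart_zero[OF assms, of n] by auto

lemma openin_overlap:
  assumes c: "is_chart n X c" and d: "is_chart n X d"
  shows "openin (Euclidean_space n) (overlap c d)"
proof -
  have h: "homeomorphic_map (subtopology X (fst c)) (subtopology (Euclidean_space n) (chart_image c)) (snd c)"
    and o: "openin X (fst c)" "openin X (fst d)" "openin (Euclidean_space n) (chart_image c)"
    using c d unfolding is_chart_def by auto
  have "openin (subtopology X (fst c)) (fst c \<inter> fst d)"
    using o by (simp add: openin_subtopology_Int2)
  then have "openin (subtopology (Euclidean_space n) (chart_image c)) (overlap c d)"
    using homeomorphic_imp_open_map[OF h] unfolding open_map_def overlap_def by blast
  then show ?thesis
    using o(3) openin_trans_full by blast
qed

lemma openin_chart_image: "is_chart n X c \<Longrightarrow> openin (Euclidean_space n) (chart_image c)"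
  unfolding is_chart_def by blast

lemma chart_image_last: "is_chart n X c \<Longrightarrow> x \<in> chart_image c \<Longrightarrow> x n = 0"
  using openin_chart_image openin_Euclidean_subset by blast

lemma transition_chart: "is_chart n X c \<Longrightarrow> p \<in> fst c \<Longrightarrow> transition c d (snd c p) = snd d p"
  unfolding transition_def by (simp add: chart_inj)

lemma chart_image_cyl:
  assumes c: "is_chart n X c" shows "chart_image (cyl_chart n c) = cyl n (chart_image c)"
proof (intro equalityI subsetI)
  fix y assume "y \<in> chart_image (cyl_chart n c)"
  then obtain r p where "0 \<le> r" "p \<in> fst c" "y = (snd c p)(n := r)"
    unfolding chart_image_def cyl_chart_def by auto
  then show "y \<in> cyl n (chart_image c)"
    unfolding cyl_def chart_image_def by (auto simp: chart_upd_last[OF c])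
next
  fix y assume "y \<in> cyl n (chart_image c)"
  then obtain p where "p \<in> fst c" "snd c p = y(n := 0)" "0 \<le> y n"
    unfolding cyl_def chart_image_def by auto
  then show "y \<in> chart_image (cyl_chart n c)"
    unfolding chart_image_def cyl_chart_def by (auto intro!: image_eqI[of _ _ "(y n, p)"])
qed

lemma overlap_cyl:
  assumes c: "is_chart n X c" shows "overlap (cyl_chart n c) (cyl_chart n d) = cyl n (overlap c d)"
proof (intro equalityI subsetI)
  fix y assume "y \<in> overlap (cyl_chart n c) (cyl_chart n d)"
  then obtain r p where "0 \<le> r" "p \<in> fst c" "p \<in> fst d" "y = (snd c p)(n := r)"
    unfolding overlap_def cyl_chart_def by auto
  then show "y \<in> cyl n (overlap c d)"
    unfolding cyl_def overlap_def by (auto simp: chart_upd_last[OF c])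
next
  fix y assume "y \<in> cyl n (overlap c d)"
  then obtain p where "p \<in> fst c" "p \<in> fst d" "snd c p = y(n := 0)" "0 \<le> y n"
    unfolding cyl_def overlap_def by auto
  then show "y \<in> overlap (cyl_chart n c) (cyl_chart n d)"
    unfolding overlap_def cyl_chart_def by (auto intro!: image_eqI[of _ _ "(y n, p)"])
qed

lemma transition_cyl:
  assumes c: "is_chart n X c" and y: "y \<in> cyl n (overlap c d)"
  shows "transition (cyl_chart n c) (cyl_chart n d) y = (transition c d (y(n := 0)))(n := y n)"
proof -
  obtain p where p: "p \<in> fst c" "p \<in> fst d" "snd c p = y(n := 0)" "0 \<le> y n"
    using y unfolding cyl_def overlap_def by auto
  have "inj_on (snd (cyl_chart n c)) (fst (cyl_chart n c))"
  proof (rule inj_onI, clarsimp simp: cyl_chart_def)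
    fix r p s q assume *: "p \<in> fst c" "q \<in> fst c" "(snd c p)(n := r) = (snd c q)(n := s)"
    have "r = s"
      using fun_cong[OF *(3), of n] by simp
    moreover have "((snd c p)(n := r))(n := 0) = ((snd c q)(n := s))(n := 0)"
      using *(3) by simp
    then have "snd c p = snd c q"
      using chart_upd_last[OF c] *(1,2) by simp
    then have "p = q"
      using chart_inj[OF c] *(1,2) by (auto dest: inj_onD)
    ultimately show "r = s \<and> p = q" ..
  qed
  moreover have "y = snd (cyl_chart n c) (y n, p)" "(y n, p) \<in> fst (cyl_chart n c)"
    using p by (auto simp: cyl_chart_def)
  ultimately have "inv_into (fst (cyl_chart n c)) (snd (cyl_chart n c)) y = (y n, p)"
    by (metis inv_into_f_f)
  then have "transition (cyl_chart n c) (cyl_chart n d) y = snd (cyl_chart n d) (y n, p)"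
    unfolding transition_def by simp
  also have "\<dots> = (snd d p)(n := y n)"
    by (simp add: cyl_chart_def)
  finally show ?thesis
    using p transition_chart[OF c p(1), of d] by simp
qed

lemma pd_cyl_comp:
  assumes g: "\<And>y. y \<in> cyl n W \<Longrightarrow> g y = h (y(n := 0))" and y: "y \<in> cyl n W" and i: "i < n"
  shows "pd (cyl n W) i g y = pd W i h (y(n := 0))"
proof -
  have "vector_derivative (\<lambda>t. g (y(i := t))) (at (y i) within {t. y(i := t) \<in> cyl n W})
    = vector_derivative (\<lambda>t. h ((y(n := 0))(i := t))) (at (y i) within {t. y(i := t) \<in> cyl n W})"
    using g i y by (intro vector_derivative_within_cong) (auto simp: fun_upd_twist)
  moreover have "y(n := 0) \<in> W" "(y(n := 0)) i = y i"
    using y i by (auto simp: cyl_def)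
  ultimately show ?thesis
    unfolding pd_def slice_cyl[OF y i] using y by (simp only: if_True)
qed

lemma pd_cyl_comp_last:
  assumes W: "openin (Euclidean_space n) W"
    and g: "\<And>y. y \<in> cyl n W \<Longrightarrow> g y = h (y(n := 0))" and y: "y \<in> cyl n W"
  shows "pd (cyl n W) n g y = 0"
proof (rule pd_eqI[OF nondegenerate_cyl[OF W] y])
  show "((\<lambda>t. g (y(n := t))) has_vector_derivative 0) (at (y n) within {t. y(n := t) \<in> cyl n W})"
    by (rule has_vector_derivative_transform[OF _ _ has_vector_derivative_const[of "h (y(n := 0))"]])
      (use y g in auto)
qed simp

text \<open>The last component of the transition is \<open>r\<close> itself and the other components
  do not depend on \<open>r\<close>, whence the corner entry 1 and the zeros beside and above
  it.\<close>

lemma jacobian_entry_cyl: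
  assumes c: "is_chart n X c" and d: "is_chart n X d" and y: "y \<in> cyl n (overlap c d)"
    and i: "i < Suc n" and j: "j < Suc n"
  shows "pd (overlap (cyl_chart n c) (cyl_chart n d)) i (\<lambda>y. transition (cyl_chart n c) (cyl_chart n d) y j) y =
    (if i < n \<and> j < n then pd (overlap c d) i (\<lambda>x. transition c d x j) (y(n := 0)) else of_bool (i = j))"
proof -
  let ?W = "overlap c d"
  note W = openin_overlap[OF c d]
  have tr: "transition (cyl_chart n c) (cyl_chart n d) y j = (if j = n then y n else transition c d (y(n := 0)) j)"
    if "y \<in> cyl n ?W" for y
    using transition_cyl[OF c that] by simp
  consider "i < n" "j < n" | "i = n" "j < n" | "j = n"
    using i j by linarith
  then show ?thesis
    unfolding overlap_cyl[OF c]
  proof cases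
    case 1
    then show "pd (cyl n ?W) i (\<lambda>y. transition (cyl_chart n c) (cyl_chart n d) y j) y =
      (if i < n \<and> j < n then pd ?W i (\<lambda>x. transition c d x j) (y(n := 0)) else of_bool (i = j))"
      using tr y by (subst pd_cyl_comp[where h = "\<lambda>x. transition c d x j"]) auto
  next
    case 2
    then show "pd (cyl n ?W) i (\<lambda>y. transition (cyl_chart n c) (cyl_chart n d) y j) y =
      (if i < n \<and> j < n then pd ?W i (\<lambda>x. transition c d x j) (y(n := 0)) else of_bool (i = j))"
      using tr y pd_cyl_comp_last[OF W, of _ "\<lambda>x. transition c d x j"] by simp
  next
    case 3
    have "((\<lambda>t. transition (cyl_chart n c) (cyl_chart n d) (y(i := t)) n) has_vector_derivative of_bool (i = n))
       (at (y i) within {t. y(i := t) \<in> cyl n ?W})"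
    proof (rule has_vector_derivative_transform)
      show "((\<lambda>t. (y(i := t)) n) has_vector_derivative of_bool (i = n)) (at (y i) within {t. y(i := t) \<in> cyl n ?W})"
        by (cases "i = n") (auto intro!: derivative_eq_intros)
    qed (use y tr 3 in \<open>auto simp del: fun_upd_apply\<close>)
    then have "pd (cyl n ?W) i (\<lambda>y. transition (cyl_chart n c) (cyl_chart n d) y j) y = of_bool (i = n)"
      unfolding 3 by (intro pd_eqI[OF nondegenerate_cyl[OF W] y i])
    with 3 show "pd (cyl n ?W) i (\<lambda>y. transition (cyl_chart n c) (cyl_chart n d) y j) y =
      (if i < n \<and> j < n then pd ?W i (\<lambda>x. transition c d x j) (y(n := 0)) else of_bool (i = j))"
      by simp
  qed
qed

lemma
  assumes c: "is_chart n X c" and d: "is_chart n X d" and y: "y \<in> cyl n (overlap c d)"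
    and J: "J \<subseteq> {..<n}" and I: "I \<subseteq> {..<n}"
  shows jacobian_minor_cyl: "jacobian_minor (cyl_chart n c) (cyl_chart n d) J I y = jacobian_minor c d J I (y(n := 0))"
    and jacobian_minor_cyl_insert: "card J = card I \<Longrightarrow>
      jacobian_minor (cyl_chart n c) (cyl_chart n d) (insert n J) (insert n I) y = jacobian_minor c d J I (y(n := 0))"
proof -
  have fin: "finite J" "finite I"
    using J I finite_subset by blast+
  let ?P = "\<lambda>j i. pd (overlap (cyl_chart n c) (cyl_chart n d)) i (\<lambda>y. transition (cyl_chart n c) (cyl_chart n d) y j) y"
  note entry = jacobian_entry_cyl[OF c d y]
  show *: "jacobian_minor (cyl_chart n c) (cyl_chart n d) J I y = jacobian_minor c d J I (y(n := 0))"
    unfolding jacobian_minor_eq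
  proof (rule minor_cong[OF fin])
    fix j i assume "j \<in> J" "i \<in> I"
    then have "j < n" "i < n"
      using I J by auto
    then show "?P j i = pd (overlap c d) i (\<lambda>x. transition c d x j) (y(n := 0))"
      using entry[of i j] by simp
  qed
  assume "card J = card I"
  then have "minor ?P (insert n J) (insert n I) = minor ?P J I"
  proof (rule minor_insert_last[OF J I])
    show "?P n n = 1"
      using entry[of n n] by simp
    fix i assume "i \<in> I"
    then have "i < n"
      using I by auto
    then show "?P n i = 0"
      using entry[of i n] by simp
  qed
  with * show "jacobian_minor (cyl_chart n c) (cyl_chart n d) (insert n J) (insert n I) y = jacobian_minor c d J I (y(n := 0))"
    unfolding jacobian_minor_eq by simp
qed

text \<open>The index \<open>n\<close>, present on one side only, contributes a zero row or a zero
  column. This keeps the coefficients with dr and those without dr from mixing under changes of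
  product charts.\<close>

lemma jacobian_minor_cyl_mixed:
  assumes c: "is_chart n X c" and d: "is_chart n X d" and y: "y \<in> cyl n (overlap c d)"
    and J: "J \<subseteq> {..<Suc n}" and I: "I \<subseteq> {..<Suc n}" and card: "card J = card I" and mixed: "(n \<in> J) \<noteq> (n \<in> I)"
  shows "jacobian_minor (cyl_chart n c) (cyl_chart n d) J I y = 0"
proof -
  have fin: "finite J" "finite I"
    using J I finite_subset by blast+
  note entry = jacobian_entry_cyl[OF c d y]
  show ?thesis
  proof (cases "n \<in> J")
    case True
    show ?thesis
      unfolding jacobian_minor_eq
    proof (rule minor_zero_row[OF fin card True])
      fix i assume "i \<in> I"
      then have "i < n"
        using mixed True I by (metis lessThan_iff less_antisym subsetD)
      then show "pd (overlap (cyl_chart n c) (cyl_chart n d)) i (\<lambda>y. transition (cyl_chart n c) (cyl_chart n d) y n) y = 0"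
        using entry[of i n] by simp
    qed
  next
    case False
    then have "n \<in> I"
      using mixed by simp
    show ?thesis
      unfolding jacobian_minor_eq
    proof (rule minor_zero_column[OF fin card \<open>n \<in> I\<close>])
      fix j assume "j \<in> J"
      then have "j < n"
        using False J by (metis lessThan_iff less_antisym subsetD)
      then show "pd (overlap (cyl_chart n c) (cyl_chart n d)) n (\<lambda>y. transition (cyl_chart n c) (cyl_chart n d) y j) y = 0"
        using entry[of n j] by simp
    qed
  qed
qed

text \<open>The update at \<open>n\<close> erases that coordinate. On the domain of a chart of M it
  is 0 anyway, so the chart can be recovered there; off the domain its value is lost.\<close>

lemma cyl_chart_eqD:
  assumes "cyl_chart n c = cyl_chart n d" "is_chart n X c" "is_chart n X d"
  shows "fst c = fst d" "\<And>p. p \<in> fst c \<Longrightarrow> snd c p = snd d p"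
proof -
  have "{0::real..} \<times> fst c = {0..} \<times> fst d"
    using assms(1) unfolding cyl_chart_def by simp
  then show fst: "fst c = fst d"
    by (metis atLeast_eq_UNIV_iff atLeast_iff empty_iff order_refl times_eq_iff)
  fix p assume p: "p \<in> fst c"
  have "(snd c p)(n := 0) = (snd d p)(n := 0)"
    using fun_cong[OF arg_cong[OF assms(1), of snd], of "(0, p)"] unfolding cyl_chart_def by simp
  then show "snd c p = snd d p"
    using chart_upd_last assms(2,3) p fst by metis
qed

section \<open>Forms and index sets under changes of charts\<close>

lemma diff_forms_outside:
  assumes "\<omega> \<in> diff_forms N S k" "\<not> (c \<in> S \<and> I \<subseteq> {..<N} \<and> card I = k \<and> x \<in> chart_image c)"
  shows "\<omega> c I x = 0"
  using assms unfolding diff_forms_def mem_Collect_eq by (elim conjE allE[of _ c] allE[of _ I] allE[of _ x] mp)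

lemma diff_forms_transform:
  assumes "\<omega> \<in> diff_forms N S k" "c \<in> S" "d \<in> S" "I \<subseteq> {..<N}" "card I = k" "x \<in> overlap c d"
  shows "\<omega> c I x = (\<Sum>J | J \<subseteq> {..<N} \<and> card J = k.
          \<omega> d J (transition c d x) * complex_of_real (jacobian_minor c d J I x))"
  using assms unfolding diff_forms_def by blast

lemma diff_forms_smooth_coords:
  assumes "\<omega> \<in> diff_forms N S k" "c \<in> S" "nondegenerate N (chart_image c)"
  shows "smooth_coords N (chart_image c) (\<omega> c I)"
proof (cases "I \<subseteq> {..<N} \<and> card I = k")
  case True
  then show ?thesis
    using assms(1,2) unfolding diff_forms_def by blast
next
  case False
  then have "\<omega> c I = (\<lambda>_. 0)"
    using diff_forms_outside[OF assms(1)] by blast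
  then show ?thesis
    using smooth_coords_zero[OF assms(3)] by simp
qed

text \<open>The transition between two such charts is the identity, so the transformation rule has
  identity minors and compares the coefficients directly. This makes constructions on the cylinder
  independent of the chart of M chosen below a product chart.\<close>

lemma diff_forms_cyl_chart_eq:
  assumes \<phi>: "\<phi> \<in> diff_forms n S k" and S: "c \<in> S" "d \<in> S"
    and eq: "cyl_chart n c = cyl_chart n d" and c: "is_chart n X c" and d: "is_chart n X d"
  shows "\<phi> c = \<phi> d"
proof (intro ext)
  note fsteq = cyl_chart_eqD(1)[OF eq c d] and sndeq = cyl_chart_eqD(2)[OF eq c d]
  have img: "chart_image c = chart_image d" "overlap c d = chart_image c"
    using fsteq sndeq by (auto simp: chart_image_def overlap_def)
  have tr: "transition c d x = x" if x: "x \<in> chart_image c" for x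
  proof -
    obtain p where p: "p \<in> fst c" "x = snd c p"
      using x by (auto simp: chart_image_def)
    show ?thesis
      using transition_chart[OF c p(1), of d] sndeq[OF p(1)] p(2) by simp
  qed
  fix I x
  show "\<phi> c I x = \<phi> d I x"
  proof (cases "I \<subseteq> {..<n} \<and> card I = k \<and> x \<in> chart_image c")
    case False
    then have "\<not> (I \<subseteq> {..<n} \<and> card I = k \<and> x \<in> chart_image d)"
      using img by simp
    with False show ?thesis
      using diff_forms_outside[OF \<phi>, of c I x] diff_forms_outside[OF \<phi>, of d I x] by auto
  next
    case True
    have minor: "jacobian_minor c d J I x = of_bool (J = I)" if J: "J \<subseteq> {..<n}" "card J = k" for J
    proof -
      have fin: "finite J" "finite I"
        using J True finite_subset by blast+
      have "jacobian_minor c d J I x = minor (\<lambda>j i. of_bool (j = i)) J I"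
        unfolding jacobian_minor_eq
      proof (rule minor_cong[OF fin])
        fix j i assume "j \<in> J" "i \<in> I"
        then have i: "i < n"
          using True by auto
        show "pd (overlap c d) i (\<lambda>y. transition c d y j) x = of_bool (j = i)"
          unfolding img(2)
        proof (rule pd_eqI[OF nondegenerate_openin[OF openin_chart_image[OF c]] _ i])
          show "((\<lambda>t. transition c d (x(i := t)) j) has_vector_derivative of_bool (j = i))
            (at (x i) within {t. x(i := t) \<in> chart_image c})"
          proof (rule has_vector_derivative_transform)
            show "((\<lambda>t. (x(i := t)) j) has_vector_derivative of_bool (j = i)) (at (x i) within {t. x(i := t) \<in> chart_image c})"
              by (cases "i = j") (auto intro!: derivative_eq_intros)
          qed (use True tr in auto)
        qed (use True in auto)
      qed
      with minor_identity[OF fin] J True show ?thesis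
        by simp
    qed
    have "\<phi> c I x = (\<Sum>J | J \<subseteq> {..<n} \<and> card J = k. \<phi> d J (transition c d x) * complex_of_real (jacobian_minor c d J I x))"
      by (rule diff_forms_transform[OF \<phi> S]) (use True img in auto)
    also have "\<dots> = (\<Sum>J | J \<subseteq> {..<n} \<and> card J = k. \<phi> d J x * of_bool (J = I))"
      by (intro sum.cong refl) (use True tr minor in auto)
    also have "\<dots> = (\<Sum>J\<in>{I}. \<phi> d J x * of_bool (J = I))"
      using True by (intro sum.mono_neutral_right) (auto intro: finite_subset[of _ "Pow {..<n}"])
    finally show ?thesis
      by simp
  qed
qed

text \<open>Reindexing along \<open>insert n\<close>; used on transformation rules and on wedge
  products, where only index sets containing dr survive.\<close>

lemma sum_index_sets_insert:
  fixes f :: "nat set \<Rightarrow> 'a::comm_monoid_add"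
  assumes "\<And>J. J \<subseteq> {..<n} \<Longrightarrow> card J = Suc k \<Longrightarrow> f J = 0"
  shows "(\<Sum>J | J \<subseteq> {..<Suc n} \<and> card J = Suc k. f J) = (\<Sum>J | J \<subseteq> {..<n} \<and> card J = k. f (insert n J))"
proof -
  have fin: "finite {J. J \<subseteq> {..<Suc n} \<and> card J = Suc k}"
    by (rule finite_subset[of _ "Pow {..<Suc n}"]) auto
  have finJ: "finite J" if "J \<subseteq> {..<n}" for J
    using that finite_subset by blast
  have inj: "inj_on (insert n) {J. J \<subseteq> {..<n} \<and> card J = k}"
  proof (rule inj_onI)
    fix J J' assume "J \<in> {J. J \<subseteq> {..<n} \<and> card J = k}" "J' \<in> {J. J \<subseteq> {..<n} \<and> card J = k}"
      and eq: "insert n J = insert n J'"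
    then have "n \<notin> J" "n \<notin> J'"
      by blast+
    with eq show "J = J'"
      by (simp add: insert_ident)
  qed
  have "(\<Sum>J | J \<subseteq> {..<n} \<and> card J = k. f (insert n J)) = (\<Sum>J\<in>insert n ` {J. J \<subseteq> {..<n} \<and> card J = k}. f J)"
    using sum.reindex[OF inj, of f] by (simp add: o_def)
  also have "\<dots> = (\<Sum>J | J \<subseteq> {..<Suc n} \<and> card J = Suc k. f J)"
  proof (rule sum.mono_neutral_left[OF fin])
    show "insert n ` {J. J \<subseteq> {..<n} \<and> card J = k} \<subseteq> {J. J \<subseteq> {..<Suc n} \<and> card J = Suc k}"
      using finJ by (auto simp: card_insert_if)
    show "\<forall>J\<in>{J. J \<subseteq> {..<Suc n} \<and> card J = Suc k} - insert n ` {J. J \<subseteq> {..<n} \<and> card J = k}. f J = 0"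
    proof
      fix J assume J: "J \<in> {J. J \<subseteq> {..<Suc n} \<and> card J = Suc k} - insert n ` {J. J \<subseteq> {..<n} \<and> card J = k}"
      then have sub: "J \<subseteq> {..<Suc n}" and card: "card J = Suc k"
        by simp_all
      have "n \<notin> J"
      proof
        assume n: "n \<in> J"
        have "J - {n} \<subseteq> {..<n}"
          using sub by (auto simp: less_Suc_eq)
        moreover have "card (J - {n}) = k"
          using card n by (simp add: card_Diff_singleton_if)
        moreover have "J = insert n (J - {n})"
          using n by (rule insert_Diff[symmetric])
        ultimately have "J \<in> insert n ` {J. J \<subseteq> {..<n} \<and> card J = k}"
          by (intro image_eqI[of _ _ "J - {n}"] CollectI conjI)
        with J show False
          by (rule DiffD2)
      qed
      then have "J \<subseteq> {..<n}"
        using sub by (auto simp: less_Suc_eq)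
      then show "f J = 0"
        using card by (rule assms)
    qed
  qed
  finally show ?thesis ..
qed

lemma sum_index_sets_lower:
  fixes f :: "nat set \<Rightarrow> 'a::comm_monoid_add"
  assumes "\<And>J. J \<subseteq> {..<Suc n} \<Longrightarrow> card J = k \<Longrightarrow> n \<in> J \<Longrightarrow> f J = 0"
  shows "(\<Sum>J | J \<subseteq> {..<Suc n} \<and> card J = k. f J) = (\<Sum>J | J \<subseteq> {..<n} \<and> card J = k. f J)"
proof (rule sum.mono_neutral_right)
  show "finite {J. J \<subseteq> {..<Suc n} \<and> card J = k}"
    by (rule finite_subset[of _ "Pow {..<Suc n}"]) auto
  show "\<forall>J\<in>{J. J \<subseteq> {..<Suc n} \<and> card J = k} - {J. J \<subseteq> {..<n} \<and> card J = k}. f J = 0"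
  proof
    fix J assume J: "J \<in> {J. J \<subseteq> {..<Suc n} \<and> card J = k} - {J. J \<subseteq> {..<n} \<and> card J = k}"
    then have "n \<in> J"
      by (auto simp: less_Suc_eq)
    with J assms show "f J = 0"
      by blast
  qed
qed auto

section \<open>Linear combinations of forms\<close>

text \<open>One operation that specialises to sum, difference and scalar multiple, so that each
  linearity statement is proved once.\<close>

definition form_lincomb :: "complex \<Rightarrow> 'p form \<Rightarrow> complex \<Rightarrow> 'p form \<Rightarrow> 'p form" where
  "form_lincomb a \<omega> b \<eta> = (\<lambda>c I x. a * \<omega> c I x + b * \<eta> c I x)"

lemma form_add_eq: "\<omega> + \<eta> = form_lincomb 1 \<omega> 1 \<eta>"
  and form_diff_eq: "\<omega> - \<eta> = form_lincomb 1 \<omega> (-1) \<eta>"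
  and form_scale_eq: "form_scale a \<omega> = form_lincomb a \<omega> 0 \<omega>"
  by (auto simp: form_lincomb_def form_scale_def fun_eq_iff)

lemma diff_formsI:
  assumes outside: "\<And>c I x. \<not> (c \<in> S \<and> I \<subseteq> {..<N} \<and> card I = k \<and> x \<in> chart_image c) \<Longrightarrow> \<omega> c I x = 0"
    and smooth: "\<And>c I. c \<in> S \<Longrightarrow> I \<subseteq> {..<N} \<Longrightarrow> card I = k \<Longrightarrow> smooth_coords N (chart_image c) (\<omega> c I)"
    and transform: "\<And>c d I x. c \<in> S \<Longrightarrow> d \<in> S \<Longrightarrow> I \<subseteq> {..<N} \<Longrightarrow> card I = k \<Longrightarrow> x \<in> overlap c d \<Longrightarrow>
      \<omega> c I x = (\<Sum>J | J \<subseteq> {..<N} \<and> card J = k.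
          \<omega> d J (transition c d x) * complex_of_real (jacobian_minor c d J I x))"
  shows "\<omega> \<in> diff_forms N S k"
  unfolding diff_forms_def mem_Collect_eq
proof (intro conjI allI ballI impI, goal_cases)
  case (1 c I x)
  then show ?case by (rule outside)
next
  case (2 c I)
  then show ?case by (intro smooth) auto
next
  case (3 c d I x)
  then show ?case by (intro transform) auto
qed

lemma diff_forms_lincomb:
  assumes nd: "\<And>c. c \<in> S \<Longrightarrow> nondegenerate N (chart_image c)"
    and \<omega>: "\<omega> \<in> diff_forms N S k" and \<eta>: "\<eta> \<in> diff_forms N S k"
  shows "form_lincomb a \<omega> b \<eta> \<in> diff_forms N S k"
proof (rule diff_formsI)
  show "smooth_coords N (chart_image c) (form_lincomb a \<omega> b \<eta> c I)" if "c \<in> S" for c I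
    unfolding form_lincomb_def using that
    by (intro smooth_coords_lincomb diff_forms_smooth_coords[OF \<omega>] diff_forms_smooth_coords[OF \<eta>] nd)
  show "form_lincomb a \<omega> b \<eta> c I x = 0" if "\<not> (c \<in> S \<and> I \<subseteq> {..<N} \<and> card I = k \<and> x \<in> chart_image c)" for c I x
    using diff_forms_outside[OF \<omega> that] diff_forms_outside[OF \<eta> that] by (simp add: form_lincomb_def)
  show "form_lincomb a \<omega> b \<eta> c I x = (\<Sum>J | J \<subseteq> {..<N} \<and> card J = k.
          form_lincomb a \<omega> b \<eta> d J (transition c d x) * complex_of_real (jacobian_minor c d J I x))"
    if "c \<in> S" "d \<in> S" "I \<subseteq> {..<N}" "card I = k" "x \<in> overlap c d" for c d I x
    unfolding form_lincomb_def diff_forms_transform[OF \<omega> that] diff_forms_transform[OF \<eta> that] sum_distrib_left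
      sum.distrib[symmetric]
    by (simp add: algebra_simps)
qed

lemma ext_d_lincomb:
  assumes nd: "\<And>c. c \<in> S \<Longrightarrow> nondegenerate N (chart_image c)"
    and \<omega>: "\<omega> \<in> diff_forms N S k" and \<eta>: "\<eta> \<in> diff_forms N S k"
  shows "ext_d N S (form_lincomb a \<omega> b \<eta>) = form_lincomb a (ext_d N S \<omega>) b (ext_d N S \<eta>)"
proof (intro ext)
  fix c I x
  show "ext_d N S (form_lincomb a \<omega> b \<eta>) c I x = form_lincomb a (ext_d N S \<omega>) b (ext_d N S \<eta>) c I x"
  proof (cases "c \<in> S \<and> I \<subseteq> {..<N} \<and> x \<in> chart_image c")
    case True
    then have d: "ext_d N S \<zeta> c I x = (\<Sum>i\<in>I. (-1) ^ card {j\<in>I. j < i} * pd (chart_image c) i (\<zeta> c (I - {i})) x)" for \<zeta>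
      by (simp add: ext_d_def)
    have pd: "pd (chart_image c) i (form_lincomb a \<omega> b \<eta> c (I - {i}))
      = (\<lambda>x. a * pd (chart_image c) i (\<omega> c (I - {i})) x + b * pd (chart_image c) i (\<eta> c (I - {i})) x)" if "i \<in> I" for i
      unfolding form_lincomb_def using True that
      by (intro pd_lincomb[OF nd] diff_forms_smooth_coords[OF \<omega>] diff_forms_smooth_coords[OF \<eta>] nd) auto
    have "ext_d N S (form_lincomb a \<omega> b \<eta>) c I x = a * ext_d N S \<omega> c I x + b * ext_d N S \<eta> c I x"
      unfolding d sum_distrib_left sum.distrib[symmetric]
      by (intro sum.cong refl) (simp add: pd algebra_simps)
    then show ?thesis
      by (simp add: form_lincomb_def)
  qed (auto simp: ext_d_def form_lincomb_def)
qed

section \<open>Forms on the half-cylinder\<close>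

lemma (in admissible_space)
  assumes "finite J" "\<And>i. i \<in> J \<Longrightarrow> f i \<in> topspace T"
  shows sum_mem: "(\<lambda>r. \<Sum>i\<in>J. s i * f i r) \<in> topspace T"
    and fint_sum: "fint (\<lambda>r. \<Sum>i\<in>J. s i * f i r) = (\<Sum>i\<in>J. s i * fint (f i))"
    and fprim_sum: "fprim (\<lambda>r. \<Sum>i\<in>J. s i * f i r) = (\<lambda>r. \<Sum>i\<in>J. s i * fprim (f i) r)"
proof -
  have zero: "(\<lambda>_. 0) \<in> topspace T"
    using zero_mem by (simp add: zero_fun_def)
  have "(\<lambda>r. \<Sum>i\<in>J. s i * f i r) \<in> topspace T \<and> fint (\<lambda>r. \<Sum>i\<in>J. s i * f i r) = (\<Sum>i\<in>J. s i * fint (f i))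
    \<and> fprim (\<lambda>r. \<Sum>i\<in>J. s i * f i r) = (\<lambda>r. \<Sum>i\<in>J. s i * fprim (f i) r)"
    using assms
  proof (induction J rule: finite_induct)
    case empty
    show ?case
      using zero fint_lincomb[OF zero zero, of 0 0] fprim_lincomb[OF zero zero, of 0 0] by simp
  next
    case (insert j J)
    then have *: "(\<lambda>r. \<Sum>i\<in>J. s i * f i r) \<in> topspace T" "f j \<in> topspace T"
      by auto
    have "(\<lambda>r. \<Sum>i\<in>insert j J. s i * f i r) = (\<lambda>r. s j * f j r + 1 * (\<Sum>i\<in>J. s i * f i r))"
      using insert by simp
    then show ?case
      using lincomb_mem[OF *(2,1), of "s j" 1] fint_lincomb[OF *(2,1), of "s j" 1] fprim_lincomb[OF *(2,1), of "s j" 1] insert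
      by simp
  qed
  then show "(\<lambda>r. \<Sum>i\<in>J. s i * f i r) \<in> topspace T"
    "fint (\<lambda>r. \<Sum>i\<in>J. s i * f i r) = (\<Sum>i\<in>J. s i * fint (f i))"
    "fprim (\<lambda>r. \<Sum>i\<in>J. s i * f i r) = (\<lambda>r. \<Sum>i\<in>J. s i * fprim (f i) r)"
    by blast+
qed

locale half_cylinder = admissible_space T fint
  for T :: "(real \<Rightarrow> complex) topology" and fint :: "(real \<Rightarrow> complex) \<Rightarrow> complex" +
  fixes n :: nat and X :: "'m topology" and S :: "'m chart set"
  assumes charts: "\<And>c. c \<in> S \<Longrightarrow> is_chart n X c"
begin

abbreviation cyl_atlas :: "(real \<times> 'm) chart set" where
  "cyl_atlas \<equiv> cyl_chart n ` S"

abbreviation forms :: "nat \<Rightarrow> (real \<times> 'm) form set" where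
  "forms k \<equiv> forms_A0 n S T k"

abbreviation cyl_d :: "(real \<times> 'm) form \<Rightarrow> (real \<times> 'm) form" where
  "cyl_d \<equiv> ext_d (Suc n) cyl_atlas"

abbreviation coef :: "(real \<times> 'm) form \<Rightarrow> 'm chart \<Rightarrow> nat set \<Rightarrow> (nat \<Rightarrow> real) \<Rightarrow> real \<Rightarrow> complex" where
  "coef \<omega> c I x \<equiv> (\<lambda>r. \<omega> (cyl_chart n c) I (x(n := r)))"

abbreviation dcoef :: "(real \<times> 'm) form \<Rightarrow> 'm chart \<Rightarrow> nat set \<Rightarrow> nat \<Rightarrow> (nat \<Rightarrow> real) \<Rightarrow> real \<Rightarrow> complex" where
  "dcoef \<omega> c I i x \<equiv> (\<lambda>r. pd (cyl n (chart_image c)) i (\<omega> (cyl_chart n c) I) (x(n := r)))"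

lemma image_cyl: "c \<in> S \<Longrightarrow> chart_image (cyl_chart n c) = cyl n (chart_image c)"
  using chart_image_cyl charts by blast

lemma open_image: "c \<in> S \<Longrightarrow> openin (Euclidean_space n) (chart_image c)"
  using openin_chart_image charts by blast

lemma nondegenerate_image: "c \<in> S \<Longrightarrow> nondegenerate n (chart_image c)"
  using nondegenerate_openin open_image by blast

lemma nondegenerate_cyl_image: "C \<in> cyl_atlas \<Longrightarrow> nondegenerate (Suc n) (chart_image C)"
  using nondegenerate_cyl open_image image_cyl by auto

lemma upd_last: "c \<in> S \<Longrightarrow> x \<in> chart_image c \<Longrightarrow> x(n := 0) = x"
  using chart_image_last[OF charts] by (simp add: fun_upd_idem)

lemma upd_mem_cyl: "c \<in> S \<Longrightarrow> x \<in> chart_image c \<Longrightarrow> x(n := r) \<in> cyl n (chart_image c) \<longleftrightarrow> 0 \<le> r"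
  using upd_last by (simp add: cyl_def)

lemma cyl_base: "y \<in> cyl n (chart_image c) \<Longrightarrow> y(n := 0) \<in> chart_image c"
  by (simp add: cyl_def)

lemma forms_diff_forms: "\<omega> \<in> forms k \<Longrightarrow> \<omega> \<in> diff_forms (Suc n) cyl_atlas k"
  unfolding forms_A0_def by blast

lemma forms_outside:
  "\<omega> \<in> forms k \<Longrightarrow> \<not> (C \<in> cyl_atlas \<and> I \<subseteq> {..<Suc n} \<and> card I = k \<and> y \<in> chart_image C) \<Longrightarrow> \<omega> C I y = 0"
  using diff_forms_outside[OF forms_diff_forms] by blast

lemma coef_neg:
  assumes "\<omega> \<in> forms k" "c \<in> S" "x \<in> chart_image c" "r < 0"
  shows "\<omega> (cyl_chart n c) I (x(n := r)) = 0"
proof (rule forms_outside[OF assms(1)])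
  have "x(n := r) \<notin> chart_image (cyl_chart n c)"
    unfolding image_cyl[OF assms(2)] upd_mem_cyl[OF assms(2,3)] using assms(4) by simp
  then show "\<not> (cyl_chart n c \<in> cyl_atlas \<and> I \<subseteq> {..<Suc n} \<and> card I = k \<and> x(n := r) \<in> chart_image (cyl_chart n c))"
    by blast
qed

lemma coef_trivial:
  "\<omega> \<in> forms k \<Longrightarrow> \<not> (I \<subseteq> {..<Suc n} \<and> card I = k) \<Longrightarrow> coef \<omega> c I x = (\<lambda>_. 0)"
  using forms_outside by blast

lemma forms_vanish_below:
  assumes "\<omega> \<in> forms k" shows "\<exists>\<epsilon>>0. \<forall>c\<in>S. \<forall>I y. y n < \<epsilon> \<longrightarrow> \<omega> (cyl_chart n c) I y = 0"
  using assms unfolding forms_A0_def by blast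

text \<open>The bound 1 lets the same \<epsilon> serve for \<open>unit\<close>. All index sets are
  included, since coefficients of the wrong degree are 0.\<close>

lemma forms_vanishing:
  assumes \<omega>: "\<omega> \<in> forms k"
  shows "\<exists>\<epsilon>. 0 < \<epsilon> \<and> \<epsilon> \<le> 1 \<and> (\<forall>c\<in>S. \<forall>I. \<forall>x\<in>chart_image c. coef \<omega> c I x \<in> vanishing \<epsilon>)"
proof -
  obtain \<epsilon> where \<epsilon>: "0 < \<epsilon>" "\<And>c I y. c \<in> S \<Longrightarrow> y n < \<epsilon> \<Longrightarrow> \<omega> (cyl_chart n c) I y = 0"
    using forms_vanish_below[OF \<omega>] by blast
  have "coef \<omega> c I x \<in> topspace T" if "c \<in> S" "x \<in> chart_image c" for c I x
  proof (cases "I \<subseteq> {..<Suc n} \<and> card I = k")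
    case True
    then show ?thesis
      using \<omega> that unfolding forms_A0_def by blast
  next
    case False
    then show ?thesis
      using coef_trivial[OF \<omega>] zero_mem by (simp add: zero_fun_def)
  qed
  moreover have "coef \<omega> c I x r = 0" if "c \<in> S" "r < min \<epsilon> 1" for c I x r
    using \<epsilon>(2)[OF that(1)] that(2) by simp
  ultimately have "\<forall>c\<in>S. \<forall>I. \<forall>x\<in>chart_image c. coef \<omega> c I x \<in> vanishing (min \<epsilon> 1)"
    unfolding vanishing_def by blast
  moreover have "0 < min \<epsilon> 1" "min \<epsilon> 1 \<le> 1"
    using \<epsilon>(1) by auto
  ultimately show ?thesis
    by blast
qed

lemma coef_mem: "\<omega> \<in> forms k \<Longrightarrow> c \<in> S \<Longrightarrow> x \<in> chart_image c \<Longrightarrow> coef \<omega> c I x \<in> topspace T"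
  using forms_vanishing vanishing_mem by meson

lemma smooth_family_zero: "smooth_family n V (\<lambda>is x r. 0)"
  using zero_mem unfolding smooth_family_def by (simp add: zero_fun_def)

text \<open>For coefficients of the wrong degree the zero family is taken, so that later arguments
  apply to every index set.\<close>

lemma forms_family:
  assumes \<omega>: "\<omega> \<in> forms k" and c: "c \<in> S"
  obtains D where "smooth_family n (chart_image c) D" "\<And>x. x \<in> chart_image c \<Longrightarrow> D [] x = coef \<omega> c I x"
proof (cases "I \<subseteq> {..<Suc n} \<and> card I = k")
  case True
  then have "smooth_into n (chart_image c) T (coef \<omega> c I)"
    using \<omega> c unfolding forms_A0_def by blast
  then show thesis
    using that unfolding smooth_into_iff[OF open_image[OF c]] by blast
next
  case False
  then show thesis
    using that[OF smooth_family_zero] coef_trivial[OF \<omega>] by metis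
qed

text \<open>Smoothness of the coefficients on the cylinder is deduced from smoothness as a map into
  \<open>T\<close>. The transformation rule is stated with the transition of M, to which transitions
  of product charts reduce.\<close>

lemma formsI:
  assumes outside: "\<And>C I y. \<not> (C \<in> cyl_atlas \<and> I \<subseteq> {..<Suc n} \<and> card I = k \<and> y \<in> chart_image C) \<Longrightarrow> \<eta> C I y = 0"
    and transform: "\<And>c d I y. c \<in> S \<Longrightarrow> d \<in> S \<Longrightarrow> I \<subseteq> {..<Suc n} \<Longrightarrow> card I = k \<Longrightarrow> y \<in> cyl n (overlap c d) \<Longrightarrow>
      \<eta> (cyl_chart n c) I y = (\<Sum>J | J \<subseteq> {..<Suc n} \<and> card J = k. \<eta> (cyl_chart n d) J ((transition c d (y(n := 0)))(n := y n))
        * complex_of_real (jacobian_minor (cyl_chart n c) (cyl_chart n d) J I y))"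
    and vanish: "0 < \<epsilon>" "\<And>c I x r. c \<in> S \<Longrightarrow> r < \<epsilon> \<Longrightarrow> x \<in> chart_image c \<Longrightarrow> \<eta> (cyl_chart n c) I (x(n := r)) = 0"
    and family: "\<And>c I. c \<in> S \<Longrightarrow> I \<subseteq> {..<Suc n} \<Longrightarrow> card I = k \<Longrightarrow>
      \<exists>D. smooth_family n (chart_image c) D \<and> (\<forall>x\<in>chart_image c. D [] x = coef \<eta> c I x)"
  shows "\<eta> \<in> forms k"
proof -
  have smooth: "smooth_coords (Suc n) (chart_image (cyl_chart n c)) (\<eta> (cyl_chart n c) I)"
    and into: "smooth_into n (chart_image c) T (coef \<eta> c I)"
    and mem: "\<forall>x\<in>chart_image c. coef \<eta> c I x \<in> topspace T"
    if c: "c \<in> S" and I: "I \<subseteq> {..<Suc n}" "card I = k" for c I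
  proof -
    obtain D where D: "smooth_family n (chart_image c) D" "\<forall>x\<in>chart_image c. D [] x = coef \<eta> c I x"
      using family[OF c I] by blast
    show "smooth_coords (Suc n) (chart_image (cyl_chart n c)) (\<eta> (cyl_chart n c) I)"
      unfolding image_cyl[OF c]
    proof (rule smooth_family_cyl[OF open_image[OF c] D(1)])
      fix y assume "y \<in> cyl n (chart_image c)"
      from bspec[OF D(2) cyl_base[OF this]] show "\<eta> (cyl_chart n c) I y = D [] (y(n := 0)) (y n)"
        by simp
    qed
    show "smooth_into n (chart_image c) T (coef \<eta> c I)"
      unfolding smooth_into_iff[OF open_image[OF c]] using D by blast
    show "\<forall>x\<in>chart_image c. coef \<eta> c I x \<in> topspace T"
    proof
      fix x assume x: "x \<in> chart_image c"
      have "D [] x \<in> topspace T"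
        by (rule smooth_family_mem[OF D(1) _ x]) simp
      with x D(2) show "coef \<eta> c I x \<in> topspace T"
        by simp
    qed
  qed
  have tr: "\<eta> (cyl_chart n c) I y = (\<Sum>J | J \<subseteq> {..<Suc n} \<and> card J = k.
          \<eta> (cyl_chart n d) J (transition (cyl_chart n c) (cyl_chart n d) y)
            * complex_of_real (jacobian_minor (cyl_chart n c) (cyl_chart n d) J I y))"
    if "c \<in> S" "d \<in> S" "I \<subseteq> {..<Suc n}" "card I = k" "y \<in> overlap (cyl_chart n c) (cyl_chart n d)" for c d I y
  proof -
    have y: "y \<in> cyl n (overlap c d)"
      using that overlap_cyl[OF charts] by blast
    show ?thesis
      unfolding transition_cyl[OF charts[OF that(1)] y] using that y by (intro transform)
  qed
  have "\<eta> \<in> diff_forms (Suc n) cyl_atlas k"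
  proof (rule diff_formsI[OF outside])
    fix C I assume "C \<in> cyl_atlas" and I: "I \<subseteq> {..<Suc n}" "card I = k"
    then obtain c where c: "c \<in> S" "C = cyl_chart n c"
      by blast
    show "smooth_coords (Suc n) (chart_image C) (\<eta> C I)"
      unfolding c(2) by (rule smooth[OF c(1) I])
    fix D y assume "D \<in> cyl_atlas" and y: "y \<in> overlap C D"
    then obtain d where d: "d \<in> S" "D = cyl_chart n d"
      by blast
    show "\<eta> C I y = (\<Sum>J | J \<subseteq> {..<Suc n} \<and> card J = k.
          \<eta> D J (transition C D y) * complex_of_real (jacobian_minor C D J I y))"
      using y unfolding c(2) d(2) by (rule tr[OF c(1) d(1) I])
  qed
  moreover have "\<eta> (cyl_chart n c) I y = 0" if c: "c \<in> S" and "y n < \<epsilon>" for c I y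
  proof (cases "y \<in> cyl n (chart_image c)")
    case True
    then show ?thesis
      using vanish(2)[OF c \<open>y n < \<epsilon>\<close> cyl_base[OF True], of I] by simp
  next
    case False
    then show ?thesis
      using outside image_cyl[OF c] by blast
  qed
  ultimately show ?thesis
    unfolding forms_A0_def mem_Collect_eq using vanish(1) mem into by (intro conjI exI[of _ \<epsilon>] ballI allI impI) auto
qed

lemma forms_lincomb:
  assumes \<omega>: "\<omega> \<in> forms k" and \<eta>: "\<eta> \<in> forms k"
  shows "form_lincomb a \<omega> b \<eta> \<in> forms k"
proof -
  have df: "form_lincomb a \<omega> b \<eta> \<in> diff_forms (Suc n) cyl_atlas k"
    by (intro diff_forms_lincomb nondegenerate_cyl_image forms_diff_forms \<omega> \<eta>)
  obtain \<epsilon> where "0 < \<epsilon>" "\<And>c I y. c \<in> S \<Longrightarrow> y n < \<epsilon> \<Longrightarrow> \<omega> (cyl_chart n c) I y = 0"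
    using forms_vanish_below[OF \<omega>] by blast
  moreover obtain \<delta> where "0 < \<delta>" "\<And>c I y. c \<in> S \<Longrightarrow> y n < \<delta> \<Longrightarrow> \<eta> (cyl_chart n c) I y = 0"
    using forms_vanish_below[OF \<eta>] by blast
  ultimately have ex: "\<exists>\<epsilon>>0. \<forall>c\<in>S. \<forall>I y. y n < \<epsilon> \<longrightarrow> form_lincomb a \<omega> b \<eta> (cyl_chart n c) I y = 0"
    by (intro exI[of _ "min \<epsilon> \<delta>"]) (auto simp: form_lincomb_def)
  have "(\<forall>x\<in>chart_image c. coef (form_lincomb a \<omega> b \<eta>) c I x \<in> topspace T) \<and>
        smooth_into n (chart_image c) T (coef (form_lincomb a \<omega> b \<eta>) c I)" if c: "c \<in> S" for c I
  proof -
    obtain D where D: "smooth_family n (chart_image c) D" "\<And>x. x \<in> chart_image c \<Longrightarrow> D [] x = coef \<omega> c I x"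
      using forms_family[OF \<omega> c] by blast
    obtain E where E: "smooth_family n (chart_image c) E" "\<And>x. x \<in> chart_image c \<Longrightarrow> E [] x = coef \<eta> c I x"
      using forms_family[OF \<eta> c] by blast
    have "smooth_into n (chart_image c) T (coef (form_lincomb a \<omega> b \<eta>) c I)"
      unfolding smooth_into_iff[OF open_image[OF c]]
      using smooth_family_lincomb[OF D(1) E(1), of a b] D(2) E(2)
      by (intro exI[of _ "\<lambda>is x r. a * D is x r + b * E is x r"]) (auto simp: form_lincomb_def)
    then show ?thesis
      using lincomb_mem coef_mem[OF \<omega> c] coef_mem[OF \<eta> c] by (simp add: form_lincomb_def)
  qed
  then show ?thesis
    unfolding forms_A0_def mem_Collect_eq using df ex by (intro conjI ballI allI impI) simp_all
qed

section \<open>The exterior derivative and changes of charts in product coordinates\<close>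

lemma ext_d_cyl:
  "c \<in> S \<Longrightarrow> I \<subseteq> {..<Suc n} \<Longrightarrow> y \<in> cyl n (chart_image c) \<Longrightarrow> cyl_d \<omega> (cyl_chart n c) I y =
    (\<Sum>i\<in>I. (-1) ^ card {j\<in>I. j < i} * pd (cyl n (chart_image c)) i (\<omega> (cyl_chart n c) (I - {i})) y)"
  by (simp add: ext_d_def image_cyl)

text \<open>As dr comes last, moving it there from the front costs \<open>(-1) ^ card J\<close>,
  while the signs of the other terms are those of M.\<close>

lemma ext_d_cyl_insert:
  assumes c: "c \<in> S" and J: "J \<subseteq> {..<n}" and y: "y \<in> cyl n (chart_image c)"
  shows "cyl_d \<omega> (cyl_chart n c) (insert n J) y =
    (-1) ^ card J * pd (cyl n (chart_image c)) n (\<omega> (cyl_chart n c) J) y +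
    (\<Sum>i\<in>J. (-1) ^ card {j\<in>J. j < i} * pd (cyl n (chart_image c)) i (\<omega> (cyl_chart n c) (insert n (J - {i}))) y)"
proof -
  have fin: "finite J" and n: "n \<notin> J"
    using J finite_subset by auto
  have "insert n J \<subseteq> {..<Suc n}"
    using J by auto
  moreover have "{j \<in> insert n J. j < n} = J" "insert n J - {n} = J"
    using J by auto
  moreover have "{j \<in> insert n J. j < i} = {j\<in>J. j < i}" "insert n J - {i} = insert n (J - {i})" if "i \<in> J" for i
    using J that by auto
  ultimately show ?thesis
    using fin n by (simp add: ext_d_cyl[OF c _ y])
qed

text \<open>The minors do not depend on \<open>r\<close>, so linear operators acting in
  \<open>r\<close>, such as \<open>fint\<close> and \<open>fprim\<close>, are compatible with
  changes of charts. For negative \<open>r\<close> both sides are 0 by convention.\<close>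

lemma coef_transform:
  assumes \<omega>: "\<omega> \<in> forms (Suc k)" and c: "c \<in> S" and d: "d \<in> S"
    and I: "I \<subseteq> {..<n}" "card I = k" and x: "x \<in> overlap c d"
  shows "coef \<omega> c (insert n I) x = (\<lambda>r. \<Sum>J | J \<subseteq> {..<n} \<and> card J = k.
     complex_of_real (jacobian_minor c d J I x) * coef \<omega> d (insert n J) (transition c d x) r)"
proof
  fix r
  have xc: "x \<in> chart_image c" and td: "transition c d x \<in> chart_image d"
    using x transition_chart[OF charts[OF c], where d = d] by (auto simp: overlap_def chart_image_def)
  show "coef \<omega> c (insert n I) x r = (\<Sum>J | J \<subseteq> {..<n} \<and> card J = k.
     complex_of_real (jacobian_minor c d J I x) * coef \<omega> d (insert n J) (transition c d x) r)"
  proof (cases "r < 0")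
    case True
    then show ?thesis
      using coef_neg[OF \<omega> c xc] coef_neg[OF \<omega> d td] by simp
  next
    case False
    let ?y = "x(n := r)" and ?C = "cyl_chart n c" and ?D = "cyl_chart n d"
    have y0: "?y(n := 0) = x"
      using upd_last[OF c xc] by simp
    with False x have y: "?y \<in> cyl n (overlap c d)"
      by (simp add: cyl_def)
    have finI: "finite I"
      using I finite_subset by blast
    have I': "insert n I \<subseteq> {..<Suc n}" "card (insert n I) = Suc k"
      using I finI by (auto simp: card_insert_if)
    have "\<omega> ?C (insert n I) ?y = (\<Sum>J | J \<subseteq> {..<Suc n} \<and> card J = Suc k.
        \<omega> ?D J (transition ?C ?D ?y) * complex_of_real (jacobian_minor ?C ?D J (insert n I) ?y))"
      by (rule diff_forms_transform[OF forms_diff_forms[OF \<omega>]])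
        (use c d I' y overlap_cyl[OF charts[OF c]] in auto)
    also have "\<dots> = (\<Sum>J | J \<subseteq> {..<n} \<and> card J = k.
        \<omega> ?D (insert n J) (transition ?C ?D ?y) * complex_of_real (jacobian_minor ?C ?D (insert n J) (insert n I) ?y))"
    proof (rule sum_index_sets_insert)
      fix J assume J: "J \<subseteq> {..<n}" "card J = Suc k"
      have "jacobian_minor ?C ?D J (insert n I) ?y = 0"
        by (rule jacobian_minor_cyl_mixed[OF charts[OF c] charts[OF d] y]) (use J I' in auto)
      then show "\<omega> ?D J (transition ?C ?D ?y) * complex_of_real (jacobian_minor ?C ?D J (insert n I) ?y) = 0"
        by simp
    qed
    also have "\<dots> = (\<Sum>J | J \<subseteq> {..<n} \<and> card J = k.
     complex_of_real (jacobian_minor c d J I x) * coef \<omega> d (insert n J) (transition c d x) r)"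
    proof (rule sum.cong[OF refl])
      fix J assume J: "J \<in> {J. J \<subseteq> {..<n} \<and> card J = k}"
      then have "jacobian_minor ?C ?D (insert n J) (insert n I) ?y = jacobian_minor c d J I (?y(n := 0))"
        using I by (intro jacobian_minor_cyl_insert[OF charts[OF c] charts[OF d] y]) auto
      then show "\<omega> ?D (insert n J) (transition ?C ?D ?y) * complex_of_real (jacobian_minor ?C ?D (insert n J) (insert n I) ?y)
         = complex_of_real (jacobian_minor c d J I x) * coef \<omega> d (insert n J) (transition c d x) r"
        unfolding y0 transition_cyl[OF charts[OF c] y] by simp
    qed
    finally show ?thesis .
  qed
qed

text \<open>A dictionary between slices in \<open>r\<close> and derivatives on the cylinder: if the
  family \<open>D\<close> witnesses the smoothness of a coefficient, the slice of its
  \<open>i\<close>-th partial derivative is \<open>D [i]\<close>, and \<open>fint\<close> and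
  \<open>fprim\<close> commute with passing from \<open>D []\<close> to
  \<open>D [i]\<close>.\<close>

lemma
  assumes \<omega>: "\<omega> \<in> forms k" and c: "c \<in> S" and x: "x \<in> chart_image c"
  shows dcoef_last: "dcoef \<omega> c I n x = ddx (coef \<omega> c I x)"
    and dcoef_vanishing: "\<And>i \<epsilon>. i < n \<Longrightarrow> \<forall>x\<in>chart_image c. coef \<omega> c I x \<in> vanishing \<epsilon> \<Longrightarrow> dcoef \<omega> c I i x \<in> vanishing \<epsilon>"
    and pd_fint_coef: "\<And>i g. i < n \<Longrightarrow> (\<And>x. x \<in> chart_image c \<Longrightarrow> g x = fint (coef \<omega> c I x)) \<Longrightarrow>
      pd (chart_image c) i g x = fint (dcoef \<omega> c I i x)"
    and pd_fprim_coef: "\<And>i a g r. i < n \<Longrightarrow> 0 \<le> r \<Longrightarrow>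
      (\<And>y. y \<in> cyl n (chart_image c) \<Longrightarrow> g y = a * fprim (coef \<omega> c I (y(n := 0))) (y n)) \<Longrightarrow>
      pd (cyl n (chart_image c)) i g (x(n := r)) = a * fprim (dcoef \<omega> c I i x) r"
    and pd_last_fprim_coef: "\<And>a g r. 0 \<le> r \<Longrightarrow>
      (\<And>y. y \<in> cyl n (chart_image c) \<Longrightarrow> g y = a * fprim (coef \<omega> c I (y(n := 0))) (y n)) \<Longrightarrow>
      pd (cyl n (chart_image c)) n g (x(n := r)) = a * reduce (coef \<omega> c I x) r"
proof -
  let ?V = "chart_image c"
  note V = open_image[OF c]
  obtain D where D: "smooth_family n ?V D" "\<And>x. x \<in> ?V \<Longrightarrow> D [] x = coef \<omega> c I x"
    using forms_family[OF \<omega> c] by blast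
  have f: "\<omega> (cyl_chart n c) I y = D [] (y(n := 0)) (y n)" if "y \<in> cyl n ?V" for y
    using D(2)[OF cyl_base[OF that]] by simp
  note x0 = upd_last[OF c x]
  have dc: "dcoef \<omega> c I i x = D [i] x" if "i < n" for i
  proof
    fix r show "dcoef \<omega> c I i x r = D [i] x r"
    proof (cases "r < 0")
      case True
      then have "x(n := r) \<notin> cyl n ?V"
        using upd_mem_cyl[OF c x] by simp
      moreover have "D [i] x \<in> topspace T"
        by (rule smooth_family_mem[OF D(1) _ x]) (use that in simp)
      ultimately show ?thesis
        using mem_neg True by simp
    next
      case False
      then have "x(n := r) \<in> cyl n ?V"
        using upd_mem_cyl[OF c x] by simp
      from pd_cyl[OF V D(1) f that this] show ?thesis
        using x0 by simp
    qed
  qed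
  show "dcoef \<omega> c I n x = ddx (coef \<omega> c I x)"
  proof
    fix r show "dcoef \<omega> c I n x r = ddx (coef \<omega> c I x) r"
    proof (cases "r < 0")
      case True
      then have "x(n := r) \<notin> cyl n ?V"
        using upd_mem_cyl[OF c x] by simp
      with True show ?thesis
        by simp
    next
      case False
      then have "x(n := r) \<in> cyl n ?V"
        using upd_mem_cyl[OF c x] by simp
      from pd_cyl_last[OF V D(1) f this] show ?thesis
        using x0 D(2)[OF x] by simp
    qed
  qed
  show "dcoef \<omega> c I i x \<in> vanishing \<epsilon>" if "i < n" "\<forall>x\<in>?V. coef \<omega> c I x \<in> vanishing \<epsilon>" for i \<epsilon>
    unfolding dc[OF that(1)] by (rule smooth_family_vanishing[OF V D(1) _ _ x]) (use that D(2) in auto)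
  obtain \<epsilon> where \<epsilon>: "0 < \<epsilon>" "\<epsilon> \<le> 1" "\<And>x. x \<in> ?V \<Longrightarrow> coef \<omega> c I x \<in> vanishing \<epsilon>"
    using forms_vanishing[OF \<omega>] c by blast
  have start: "D [] x \<in> vanishing \<epsilon>" if "x \<in> ?V" for x
    using D(2)[OF that] \<epsilon>(3)[OF that] by simp
  show "pd ?V i g x = fint (dcoef \<omega> c I i x)" if i: "i < n" and g: "\<And>x. x \<in> ?V \<Longrightarrow> g x = fint (coef \<omega> c I x)" for i g
    unfolding dc[OF i] by (rule pd_fint[OF V D(1) start \<epsilon>(1,2) _ i x]) (use g D(2) in auto)
  fix a g and r :: real assume r: "0 \<le> r" and g: "\<And>y. y \<in> cyl n ?V \<Longrightarrow> g y = a * fprim (coef \<omega> c I (y(n := 0))) (y n)"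
  have y: "x(n := r) \<in> cyl n ?V"
    using r upd_mem_cyl[OF c x] by simp
  \<comment> \<open>The second summand is 0; it presents the scalar multiple as a linear combination
    of two families.\<close>
  let ?E = "\<lambda>is x r. a * fprim (D is x) r + 0 * D is x r"
  have E: "smooth_family n ?V ?E"
    by (rule smooth_family_lincomb[OF smooth_family_fprim[OF V D(1) start \<epsilon>(1,2)] D(1)])
  have gE: "g y = ?E [] (y(n := 0)) (y n)" if "y \<in> cyl n ?V" for y
    using g[OF that] D(2)[OF cyl_base[OF that]] by simp
  show "pd (cyl n ?V) i g (x(n := r)) = a * fprim (dcoef \<omega> c I i x) r" if "i < n" for i
    using pd_cyl[where D = ?E, OF V E gE that y] x0 dc[OF that] by simp
  have "ddx (\<lambda>r. a * fprim (D [] x) r + 0 * D [] x r) = (\<lambda>r. a * ddx (fprim (D [] x)) r + 0 * ddx (D [] x) r)"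
    by (intro ddx_lincomb mem_smooth vanishing_mem[OF fprim_vanishing[OF start[OF x] \<epsilon>(1,2)]]
        vanishing_mem[OF start[OF x]])
  then show "pd (cyl n ?V) n g (x(n := r)) = a * reduce (coef \<omega> c I x) r"
    using pd_cyl_last[where D = ?E, OF V E gE y] x0 D(2)[OF x] ddx_fprim[OF coef_mem[OF \<omega> c x]] by simp
qed

section \<open>Fiber integration\<close>

abbreviation push :: "(real \<times> 'm) form \<Rightarrow> 'm form" where
  "push \<equiv> fiber_integral n S fint"

lemma push_eq: "c \<in> S \<Longrightarrow> J \<subseteq> {..<n} \<Longrightarrow> x \<in> chart_image c \<Longrightarrow> push \<omega> c J x = fint (coef \<omega> c (insert n J) x)"
  by (simp add: fiber_integral_def)

lemma fint_zero [simp]: "fint (\<lambda>_. 0) = 0"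
  using fint_sum[of "{}" "\<lambda>_ _. 0" "\<lambda>_. 0"] by simp

lemma fprim_zero [simp]: "fprim (\<lambda>_. 0) = (\<lambda>_. 0)"
  using fprim_sum[of "{}" "\<lambda>_ _. 0" "\<lambda>_. 0"] by simp

lemma card_insert_last: "J \<subseteq> {..<n} \<Longrightarrow> card (insert n J) = Suc (card J)"
  using finite_subset[of J "{..<n}"] by (subst card_insert_disjoint) auto

lemma insert_last_subset: "J \<subseteq> {..<n} \<Longrightarrow> insert n J \<subseteq> {..<Suc n}"
  by auto

lemma chart_image_overlap:
  assumes "c \<in> S" "x \<in> overlap c d" shows "x \<in> chart_image c" "transition c d x \<in> chart_image d"
  using assms transition_chart[OF charts[OF assms(1)], where d = d] by (auto simp: overlap_def chart_image_def)

lemma push_diff_forms: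
  assumes \<omega>: "\<omega> \<in> forms (Suc k)" shows "push \<omega> \<in> diff_forms n S k"
proof (rule diff_formsI)
  fix c I x assume not: "\<not> (c \<in> S \<and> I \<subseteq> {..<n} \<and> card I = k \<and> x \<in> chart_image c)"
  show "push \<omega> c I x = 0"
  proof (cases "c \<in> S \<and> I \<subseteq> {..<n} \<and> x \<in> chart_image c")
    case True
    with not have "card (insert n I) \<noteq> Suc k"
      using card_insert_last by auto
    then have "coef \<omega> c (insert n I) x = (\<lambda>_. 0)"
      by (intro coef_trivial[OF \<omega>]) simp
    with True show ?thesis
      by (simp add: push_eq)
  qed (auto simp: fiber_integral_def)
next
  fix c I assume c: "c \<in> S" and I: "I \<subseteq> {..<n}"
  obtain D where D: "smooth_family n (chart_image c) D" "\<And>x. x \<in> chart_image c \<Longrightarrow> D [] x = coef \<omega> c (insert n I) x"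
    using forms_family[OF \<omega> c] by blast
  obtain \<epsilon> where \<epsilon>: "0 < \<epsilon>" "\<epsilon> \<le> 1" "\<And>x. x \<in> chart_image c \<Longrightarrow> coef \<omega> c (insert n I) x \<in> vanishing \<epsilon>"
    using forms_vanishing[OF \<omega>] c by blast
  show "smooth_coords n (chart_image c) (push \<omega> c I)"
    by (rule smooth_coords_fint[OF open_image[OF c] D(1) _ \<epsilon>(1,2)])
      (use D(2) \<epsilon>(3) push_eq[OF c I] in auto)
next
  fix c d I x assume c: "c \<in> S" and d: "d \<in> S" and I: "I \<subseteq> {..<n}" "card I = k" and x: "x \<in> overlap c d"
  have xc: "x \<in> chart_image c" and td: "transition c d x \<in> chart_image d"
    using chart_image_overlap[OF c x] .
  have fin: "finite {J. J \<subseteq> {..<n} \<and> card J = k}"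
    by (rule finite_subset[of _ "Pow {..<n}"]) auto
  have "push \<omega> c I x = (\<Sum>J | J \<subseteq> {..<n} \<and> card J = k.
      complex_of_real (jacobian_minor c d J I x) * fint (coef \<omega> d (insert n J) (transition c d x)))"
    unfolding push_eq[OF c I(1) xc] coef_transform[OF \<omega> c d I x]
    by (rule fint_sum[OF fin]) (rule coef_mem[OF \<omega> d td])
  also have "\<dots> = (\<Sum>J | J \<subseteq> {..<n} \<and> card J = k. push \<omega> d J (transition c d x) * complex_of_real (jacobian_minor c d J I x))"
    by (intro sum.cong refl) (simp add: push_eq[OF d _ td])
  finally show "push \<omega> c I x = (\<Sum>J | J \<subseteq> {..<n} \<and> card J = k. push \<omega> d J (transition c d x) * complex_of_real (jacobian_minor c d J I x))" .
qed

lemma push_lincomb: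
  assumes \<omega>: "\<omega> \<in> forms k" and \<eta>: "\<eta> \<in> forms k"
  shows "push (form_lincomb a \<omega> b \<eta>) = form_lincomb a (push \<omega>) b (push \<eta>)"
proof (intro ext)
  fix c J x
  show "push (form_lincomb a \<omega> b \<eta>) c J x = form_lincomb a (push \<omega>) b (push \<eta>) c J x"
  proof (cases "c \<in> S \<and> J \<subseteq> {..<n} \<and> x \<in> chart_image c")
    case True
    then have "coef \<omega> c (insert n J) x \<in> topspace T" "coef \<eta> c (insert n J) x \<in> topspace T"
      using coef_mem \<omega> \<eta> by blast+
    from fint_lincomb[OF this, of a b] True show ?thesis
      by (simp add: push_eq form_lincomb_def)
  qed (auto simp: fiber_integral_def form_lincomb_def)
qed

text \<open>An identity of functions on the whole line, so that \<open>fint\<close> and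
  \<open>fprim\<close> can be applied to both sides. The factor \<open>1\<close> makes the right
  side a linear combination in the expected shape.\<close>

lemma cyl_d_insert_coef:
  assumes \<omega>: "\<omega> \<in> forms k" and c: "c \<in> S" and J: "J \<subseteq> {..<n}" and x: "x \<in> chart_image c"
  shows "coef (cyl_d \<omega>) c (insert n J) x = (\<lambda>r. (-1) ^ card J * ddx (coef \<omega> c J x) r +
    1 * (\<Sum>i\<in>J. (-1) ^ card {j\<in>J. j < i} * dcoef \<omega> c (insert n (J - {i})) i x r))"
proof
  fix r
  have dl: "pd (cyl n (chart_image c)) n (\<omega> (cyl_chart n c) J) (x(n := r)) = ddx (coef \<omega> c J x) r"
    using fun_cong[OF dcoef_last[OF \<omega> c x]] .
  show "coef (cyl_d \<omega>) c (insert n J) x r = (-1) ^ card J * ddx (coef \<omega> c J x) r +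
    1 * (\<Sum>i\<in>J. (-1) ^ card {j\<in>J. j < i} * dcoef \<omega> c (insert n (J - {i})) i x r)"
  proof (cases "r < 0")
    case True
    then have "x(n := r) \<notin> cyl n (chart_image c)"
      using upd_mem_cyl[OF c x] by simp
    moreover from this have "cyl_d \<omega> (cyl_chart n c) (insert n J) (x(n := r)) = 0"
      unfolding ext_d_def image_cyl[OF c] by simp
    ultimately show ?thesis
      using True by simp
  next
    case False
    then have "x(n := r) \<in> cyl n (chart_image c)"
      using upd_mem_cyl[OF c x] by simp
    from ext_d_cyl_insert[OF c J this, of \<omega>] show ?thesis
      unfolding dl by simp
  qed
qed

text \<open>The term with the \<open>r\<close>-derivative integrates to 0 by axiom (b), and the
  remaining terms are differentiated under \<open>fint\<close>. No sign arises because dr is the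
  last factor.\<close>

lemma push_ext_d:
  assumes \<omega>: "\<omega> \<in> forms k" shows "push (cyl_d \<omega>) = ext_d n S (push \<omega>)"
proof (intro ext)
  fix c J x
  show "push (cyl_d \<omega>) c J x = ext_d n S (push \<omega>) c J x"
  proof (cases "c \<in> S \<and> J \<subseteq> {..<n} \<and> x \<in> chart_image c")
    case True
    then have c: "c \<in> S" and J: "J \<subseteq> {..<n}" and x: "x \<in> chart_image c"
      by auto
    have fin: "finite J"
      using J finite_subset by blast
    obtain \<epsilon> where \<epsilon>: "0 < \<epsilon>" "\<epsilon> \<le> 1" and van: "\<And>I. \<forall>x\<in>chart_image c. coef \<omega> c I x \<in> vanishing \<epsilon>"
      using forms_vanishing[OF \<omega>] c by blast
    have dmem: "dcoef \<omega> c I i x \<in> topspace T" if "i \<in> J" for I i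
      by (rule vanishing_mem[OF dcoef_vanishing[OF \<omega> c x _ van]]) (use that J in auto)
    have cmem: "ddx (coef \<omega> c J x) \<in> topspace T"
      by (intro ddx_mem coef_mem[OF \<omega> c x])
    have zero: "fint (ddx (coef \<omega> c J x)) = 0"
      using van x by (intro fint_ddx[OF _ \<epsilon>(1)]) blast
    have "push (cyl_d \<omega>) c J x = (-1) ^ card J * fint (ddx (coef \<omega> c J x)) +
       1 * fint (\<lambda>r. \<Sum>i\<in>J. (-1) ^ card {j\<in>J. j < i} * dcoef \<omega> c (insert n (J - {i})) i x r)"
      unfolding push_eq[OF c J x] cyl_d_insert_coef[OF \<omega> c J x]
      by (rule fint_lincomb[OF cmem sum_mem[OF fin dmem]])
    also have "\<dots> = (\<Sum>i\<in>J. (-1) ^ card {j\<in>J. j < i} * fint (dcoef \<omega> c (insert n (J - {i})) i x))"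
      unfolding zero using fint_sum[OF fin dmem] by simp
    also have "\<dots> = (\<Sum>i\<in>J. (-1) ^ card {j\<in>J. j < i} * pd (chart_image c) i (push \<omega> c (J - {i})) x)"
    proof (rule sum.cong[OF refl])
      fix i assume "i \<in> J"
      then have sub: "J - {i} \<subseteq> {..<n}" and i: "i < n"
        using J by auto
      have "pd (chart_image c) i (push \<omega> c (J - {i})) x = fint (dcoef \<omega> c (insert n (J - {i})) i x)"
        by (rule pd_fint_coef[OF \<omega> c x i]) (rule push_eq[OF c sub])
      then show "(-1) ^ card {j\<in>J. j < i} * fint (dcoef \<omega> c (insert n (J - {i})) i x) =
          (-1) ^ card {j\<in>J. j < i} * pd (chart_image c) i (push \<omega> c (J - {i})) x"
        by simp
    qed
    finally show ?thesis
      using True by (simp add: ext_d_def)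
  qed (auto simp: fiber_integral_def ext_d_def)
qed

lemma push_degree_0:
  assumes \<omega>: "\<omega> \<in> forms 0" shows "push \<omega> = 0"
proof (intro ext)
  fix c J x
  show "push \<omega> c J x = 0 c J x"
  proof (cases "c \<in> S \<and> J \<subseteq> {..<n} \<and> x \<in> chart_image c")
    case True
    then have "card (insert n J) \<noteq> 0"
      using card_insert_last by auto
    then have "coef \<omega> c (insert n J) x = (\<lambda>_. 0)"
      by (intro coef_trivial[OF \<omega>]) simp
    with True show ?thesis
      by (simp add: push_eq)
  qed (auto simp: fiber_integral_def)
qed

section \<open>The wedge product with \<open>e dr\<close>\<close>

text \<open>The chart of \<open>M\<close> underlying a product chart is determined only up to its values off its domain.\<close>

definition base_chart :: "(real \<times> 'm) chart \<Rightarrow> 'm chart" where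
  "base_chart = inv_into S (cyl_chart n)"

lemma base_chart:
  assumes "C \<in> cyl_atlas" shows "base_chart C \<in> S" "cyl_chart n (base_chart C) = C"
  using inv_into_into[OF assms] f_inv_into_f[OF assms] by (simp_all add: base_chart_def)

lemma base_chart_cyl:
  assumes c: "c \<in> S" and \<phi>: "\<phi> \<in> diff_forms n S k" shows "\<phi> (base_chart (cyl_chart n c)) = \<phi> c"
proof -
  have "cyl_chart n c \<in> cyl_atlas"
    using c by blast
  note b = base_chart[OF this]
  show ?thesis
    by (rule diff_forms_cyl_chart_eq[OF \<phi> b(1) c b(2) charts[OF b(1)] charts[OF c]])
qed

text \<open>The form \<phi> \<and> e dr of the overview; with dr in the last place its coefficients
  carry no sign.\<close>

definition wedge :: "'m form \<Rightarrow> (real \<times> 'm) form" where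
  "wedge \<phi> = (\<lambda>C I y. if C \<in> cyl_atlas \<and> I \<subseteq> {..<Suc n} \<and> n \<in> I \<and> y \<in> chart_image C
     then \<phi> (base_chart C) (I - {n}) (y(n := 0)) * unit (y n) else 0)"

lemma wedge_not_last: "n \<notin> I \<Longrightarrow> wedge \<phi> C I = (\<lambda>_. 0)"
  by (auto simp: wedge_def)

lemma wedge_insert:
  assumes "C \<in> cyl_atlas" "J \<subseteq> {..<n}" "y \<in> chart_image C"
  shows "wedge \<phi> C (insert n J) y = \<phi> (base_chart C) J (y(n := 0)) * unit (y n)"
proof -
  have eq: "insert n J - {n} = J"
    using assms(2) by auto
  have "C \<in> cyl_atlas \<and> insert n J \<subseteq> {..<Suc n} \<and> n \<in> insert n J \<and> y \<in> chart_image C"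
    by (intro conjI assms insert_last_subset insertI1)
  then show ?thesis
    unfolding wedge_def if_P eq by (rule if_P)
qed

lemma coef_wedge:
  assumes c: "c \<in> S" and \<phi>: "\<phi> \<in> diff_forms n S k" and J: "J \<subseteq> {..<n}" and x: "x \<in> chart_image c"
  shows "coef (wedge \<phi>) c (insert n J) x = (\<lambda>r. \<phi> c J x * unit r)"
proof
  fix r show "coef (wedge \<phi>) c (insert n J) x r = \<phi> c J x * unit r"
  proof (cases "r < 0")
    case True
    then have "x(n := r) \<notin> chart_image (cyl_chart n c)"
      unfolding image_cyl[OF c] using upd_mem_cyl[OF c x] by simp
    with True show ?thesis
      using mem_neg[OF unit_mem] by (simp add: wedge_def del: fun_upd_apply)
  next
    case False
    then have "x(n := r) \<in> chart_image (cyl_chart n c)"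
      unfolding image_cyl[OF c] using upd_mem_cyl[OF c x] by simp
    from wedge_insert[OF _ J this] c show ?thesis
      using upd_last[OF c x] base_chart_cyl[OF c \<phi>] by simp
  qed
qed

lemma insert_last_cases:
  assumes "I \<subseteq> {..<Suc n}"
  obtains "I \<subseteq> {..<n}" "n \<notin> I" | J where "J \<subseteq> {..<n}" "I = insert n J"
proof (cases "n \<in> I")
  case True
  have "I - {n} \<subseteq> {..<n}"
    using assms by (auto simp: less_Suc_eq)
  moreover have "I = insert n (I - {n})"
    using True by (rule insert_Diff[symmetric])
  ultimately show thesis
    using that(2) by blast
next
  case False
  then have "I \<subseteq> {..<n}"
    using assms by (auto simp: less_Suc_eq)
  with False show thesis
    using that(1) by blast
qed

text \<open>Mixed minors remove the index sets without dr. For the others the rule is that of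
  \<open>\<phi>\<close> times \<open>unit (y n)\<close>, as the transition leaves \<open>r\<close>
  unchanged.\<close>

lemma wedge_forms:
  assumes \<phi>: "\<phi> \<in> diff_forms n S k" shows "wedge \<phi> \<in> forms (Suc k)"
proof (rule formsI[of _ _ 1])
  fix C I y assume not: "\<not> (C \<in> cyl_atlas \<and> I \<subseteq> {..<Suc n} \<and> card I = Suc k \<and> y \<in> chart_image C)"
  show "wedge \<phi> C I y = 0"
  proof (cases "C \<in> cyl_atlas \<and> I \<subseteq> {..<Suc n} \<and> n \<in> I \<and> y \<in> chart_image C")
    case True
    with not have "card I \<noteq> Suc k"
      by blast
    then have "card (I - {n}) \<noteq> k"
      using True by (auto simp: card_Diff_singleton_if) (metis Suc_pred card_gt_0_iff empty_iff finite_lessThan finite_subset)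
    then have "\<phi> (base_chart C) (I - {n}) (y(n := 0)) = 0"
      by (intro diff_forms_outside[OF \<phi>]) blast
    then show ?thesis
      by (simp add: wedge_def del: fun_upd_apply)
  qed (auto simp: wedge_def)
next
  fix c d I y assume c: "c \<in> S" and d: "d \<in> S" and I: "I \<subseteq> {..<Suc n}" "card I = Suc k" and y: "y \<in> cyl n (overlap c d)"
  let ?C = "cyl_chart n c" and ?D = "cyl_chart n d" and ?x = "y(n := 0)"
  let ?ty = "(transition c d ?x)(n := y n)"
  have x: "?x \<in> overlap c d" and r: "0 \<le> y n"
    using y by (auto simp: cyl_def)
  have xc: "?x \<in> chart_image c" and td: "transition c d ?x \<in> chart_image d"
    using chart_image_overlap[OF c x] .
  let ?sum = "\<Sum>J | J \<subseteq> {..<Suc n} \<and> card J = Suc k. wedge \<phi> ?D J ?ty * complex_of_real (jacobian_minor ?C ?D J I y)"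
  from I(1) show "wedge \<phi> ?C I y = ?sum"
  proof (cases rule: insert_last_cases)
    case 1
    have "wedge \<phi> ?D J ?ty * complex_of_real (jacobian_minor ?C ?D J I y) = 0"
      if "J \<subseteq> {..<Suc n}" "card J = Suc k" for J
    proof (cases "n \<in> J")
      case True
      then have "jacobian_minor ?C ?D J I y = 0"
        using 1 that I by (intro jacobian_minor_cyl_mixed[OF charts[OF c] charts[OF d] y]) auto
      then show ?thesis
        by simp
    qed (simp add: wedge_not_last)
    then have "?sum = 0"
      by (intro sum.neutral) auto
    with 1 show ?thesis
      by (simp add: wedge_not_last)
  next
    case (2 K)
    then have K: "K \<subseteq> {..<n}" "card K = k"
      using I card_insert_last by auto
    have "?sum = (\<Sum>J | J \<subseteq> {..<n} \<and> card J = k. wedge \<phi> ?D (insert n J) ?ty * complex_of_real (jacobian_minor ?C ?D (insert n J) I y))"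
    proof (rule sum_index_sets_insert)
      fix J assume "J \<subseteq> {..<n}"
      then have "n \<notin> J"
        by auto
      then show "wedge \<phi> ?D J ?ty * complex_of_real (jacobian_minor ?C ?D J I y) = 0"
        by (simp add: wedge_not_last)
    qed
    also have "\<dots> = (\<Sum>J | J \<subseteq> {..<n} \<and> card J = k. \<phi> d J (transition c d ?x) * complex_of_real (jacobian_minor c d J K ?x) * unit (y n))"
    proof (rule sum.cong[OF refl])
      fix J assume J: "J \<in> {J. J \<subseteq> {..<n} \<and> card J = k}"
      then have "jacobian_minor ?C ?D (insert n J) (insert n K) y = jacobian_minor c d J K ?x"
        using K by (intro jacobian_minor_cyl_insert[OF charts[OF c] charts[OF d] y]) auto
      moreover have "wedge \<phi> ?D (insert n J) ?ty = \<phi> d J (transition c d ?x) * unit (y n)"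
        using fun_cong[OF coef_wedge[OF d \<phi> _ td], of J "y n"] J by blast
      ultimately show "wedge \<phi> ?D (insert n J) ?ty * complex_of_real (jacobian_minor ?C ?D (insert n J) I y)
         = \<phi> d J (transition c d ?x) * complex_of_real (jacobian_minor c d J K ?x) * unit (y n)"
        unfolding 2 by simp
    qed
    also have "\<dots> = \<phi> c K ?x * unit (y n)"
      unfolding diff_forms_transform[OF \<phi> c d K x] sum_distrib_right ..
    also have "\<dots> = wedge \<phi> ?C I y"
      using fun_cong[OF coef_wedge[OF c \<phi> K(1) xc], of "y n"] unfolding 2 by simp
    finally show ?thesis ..
  qed
next
  fix c I x and r :: real assume "c \<in> S" "r < 1" "x \<in> chart_image c"
  then show "wedge \<phi> (cyl_chart n c) I (x(n := r)) = 0"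
    using unit_vanishing_1 by (simp add: wedge_def vanishing_def)
next
  fix c I assume c: "c \<in> S" and I: "I \<subseteq> {..<Suc n}"
  from I show "\<exists>D. smooth_family n (chart_image c) D \<and> (\<forall>x\<in>chart_image c. D [] x = coef (wedge \<phi>) c I x)"
  proof (cases rule: insert_last_cases)
    case 1
    then show ?thesis
      using smooth_family_zero by (intro exI[of _ "\<lambda>is x r. 0"]) (simp add: wedge_not_last)
  next
    case (2 J)
    have "smooth_family n (chart_image c) (\<lambda>is x r. foldr (pd (chart_image c)) is (\<phi> c J) x * unit r)"
      by (intro smooth_family_scale open_image[OF c] diff_forms_smooth_coords[OF \<phi> c] nondegenerate_image[OF c] unit_mem)
    then show ?thesis
      using coef_wedge[OF c \<phi> 2(1)] unfolding 2
      by (intro exI[of _ "\<lambda>is x r. foldr (pd (chart_image c)) is (\<phi> c J) x * unit r"]) simp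
  qed
qed simp

lemma push_wedge:
  assumes \<phi>: "\<phi> \<in> diff_forms n S k" shows "push (wedge \<phi>) = \<phi>"
proof (intro ext)
  fix c J x
  show "push (wedge \<phi>) c J x = \<phi> c J x"
  proof (cases "c \<in> S \<and> J \<subseteq> {..<n} \<and> x \<in> chart_image c")
    case True
    have "fint (\<lambda>r. \<phi> c J x * unit r) = \<phi> c J x"
      using fint_lincomb[OF unit_mem unit_mem, of "\<phi> c J x" 0] by simp
    with True show ?thesis
      using coef_wedge[OF _ \<phi>] by (simp add: push_eq)
  next
    case False
    then have "\<phi> c J x = 0"
      by (intro diff_forms_outside[OF \<phi>]) blast
    with False show ?thesis
      by (auto simp: fiber_integral_def)
  qed
qed

lemma pd_wedge:
  assumes C: "C \<in> cyl_atlas" and \<phi>: "\<phi> \<in> diff_forms n S k" and J: "J \<subseteq> {..<n}" and i: "i < n" and y: "y \<in> chart_image C"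
  shows "pd (chart_image C) i (wedge \<phi> C (insert n J)) y = pd (chart_image (base_chart C)) i (\<phi> (base_chart C) J) (y(n := 0)) * unit (y n)"
proof -
  let ?c = "base_chart C"
  have c: "?c \<in> S" and img: "chart_image C = cyl n (chart_image ?c)"
    using base_chart[OF C] image_cyl[of ?c] by auto
  have "smooth_family n (chart_image ?c) (\<lambda>is x r. foldr (pd (chart_image ?c)) is (\<phi> ?c J) x * unit r)"
    by (intro smooth_family_scale open_image[OF c] diff_forms_smooth_coords[OF \<phi> c] nondegenerate_image[OF c] unit_mem)
  from pd_cyl[OF open_image[OF c] this _ i, of "wedge \<phi> C (insert n J)" y] show ?thesis
    using y wedge_insert[OF C J] unfolding img by simp
qed

text \<open>Every non-zero coefficient of \<open>wedge \<phi>\<close> carries dr, so no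
  \<open>r\<close>-derivative occurs in \<open>d\<close>, and the derivatives along M act on
  \<open>\<phi>\<close> alone.\<close>

lemma cyl_d_wedge:
  assumes \<phi>: "\<phi> \<in> diff_forms n S k" shows "cyl_d (wedge \<phi>) = wedge (ext_d n S \<phi>)"
proof (intro ext)
  fix C I y
  show "cyl_d (wedge \<phi>) C I y = wedge (ext_d n S \<phi>) C I y"
  proof (cases "C \<in> cyl_atlas \<and> I \<subseteq> {..<Suc n} \<and> y \<in> chart_image C")
    case True
    let ?c = "base_chart C"
    from True have C: "C \<in> cyl_atlas" and y: "y \<in> chart_image C" and I: "I \<subseteq> {..<Suc n}"
      by auto
    have c: "?c \<in> S" and Cc: "C = cyl_chart n ?c" and img: "chart_image C = cyl n (chart_image ?c)"
      using base_chart[OF C] image_cyl[of ?c] by auto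
    have zero: "pd (chart_image C) i (\<lambda>_. 0 :: complex) = (\<lambda>_. 0)" if "i < Suc n" for i
      using that by (rule pd_zero[OF nondegenerate_cyl_image[OF C]])
    from I show ?thesis
    proof (cases rule: insert_last_cases)
      case 1
      then have "cyl_d (wedge \<phi>) C I y = 0"
        using True I zero by (auto simp: ext_d_def wedge_not_last intro!: sum.neutral)
      with 1 show ?thesis
        by (simp add: wedge_not_last)
    next
      case (2 J)
      have "n \<notin> J"
        using 2(1) by auto
      have "cyl_d (wedge \<phi>) C I y = (-1) ^ card J * pd (chart_image C) n (wedge \<phi> C J) y +
        (\<Sum>i\<in>J. (-1) ^ card {j\<in>J. j < i} * pd (chart_image C) i (wedge \<phi> C (insert n (J - {i}))) y)"
        using ext_d_cyl_insert[OF c 2(1), of y "wedge \<phi>"] y unfolding 2(2) img Cc[symmetric] by blast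
      also have "pd (chart_image C) n (wedge \<phi> C J) y = 0"
        using \<open>n \<notin> J\<close> zero[of n] by (simp add: wedge_not_last)
      also have "(\<Sum>i\<in>J. (-1) ^ card {j\<in>J. j < i} * pd (chart_image C) i (wedge \<phi> C (insert n (J - {i}))) y)
        = (\<Sum>i\<in>J. (-1) ^ card {j\<in>J. j < i} * pd (chart_image ?c) i (\<phi> ?c (J - {i})) (y(n := 0)) * unit (y n))"
      proof (rule sum.cong[OF refl])
        fix i assume "i \<in> J"
        then have "i < n" "J - {i} \<subseteq> {..<n}"
          using 2(1) by auto
        then show "(-1) ^ card {j\<in>J. j < i} * pd (chart_image C) i (wedge \<phi> C (insert n (J - {i}))) y
          = (-1) ^ card {j\<in>J. j < i} * pd (chart_image ?c) i (\<phi> ?c (J - {i})) (y(n := 0)) * unit (y n)"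
          using pd_wedge[OF C \<phi> _ _ y] by simp
      qed
      also have "\<dots> = ext_d n S \<phi> ?c J (y(n := 0)) * unit (y n)"
        using c 2(1) cyl_base[of y ?c] y unfolding img by (simp add: ext_d_def sum_distrib_right)
      finally show ?thesis
        using wedge_insert[OF C 2(1) y, of "ext_d n S \<phi>"] 2(2) by simp
    qed
  qed (auto simp: wedge_def ext_d_def)
qed

section \<open>The homotopy operator\<close>

text \<open>The operator \<open>K\<close> of the overview: it removes dr and integrates in
  \<open>r\<close>. The sign is the one with which the \<open>r\<close>-derivative enters
  \<open>ext_d_cyl_insert\<close>, so that the two cancel.\<close>

definition homotopy :: "(real \<times> 'm) form \<Rightarrow> (real \<times> 'm) form" where
  "homotopy \<omega> = (\<lambda>C J y. if C \<in> cyl_atlas \<and> J \<subseteq> {..<n} \<and> y \<in> chart_image C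
     then (-1) ^ card J * fprim (\<lambda>r. \<omega> C (insert n J) (y(n := r))) (y n) else 0)"

lemma homotopy_not_lower: "\<not> J \<subseteq> {..<n} \<Longrightarrow> homotopy \<omega> C J = (\<lambda>_. 0)"
  by (auto simp: homotopy_def)

lemma homotopy_eq:
  assumes "c \<in> S" "J \<subseteq> {..<n}" "y \<in> cyl n (chart_image c)"
  shows "homotopy \<omega> (cyl_chart n c) J y = (-1) ^ card J * fprim (coef \<omega> c (insert n J) (y(n := 0))) (y n)"
  using assms by (simp add: homotopy_def image_cyl)

lemma coef_homotopy:
  assumes \<omega>: "\<omega> \<in> forms k" and c: "c \<in> S" and J: "J \<subseteq> {..<n}" and x: "x \<in> chart_image c"
  shows "coef (homotopy \<omega>) c J x = (\<lambda>r. (-1) ^ card J * fprim (coef \<omega> c (insert n J) x) r)"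
proof
  fix r show "coef (homotopy \<omega>) c J x r = (-1) ^ card J * fprim (coef \<omega> c (insert n J) x) r"
  proof (cases "r < 0")
    case True
    then have "x(n := r) \<notin> chart_image (cyl_chart n c)"
      unfolding image_cyl[OF c] using upd_mem_cyl[OF c x] by simp
    then have "homotopy \<omega> (cyl_chart n c) J (x(n := r)) = 0"
      by (simp add: homotopy_def del: fun_upd_apply)
    with True show ?thesis
      by (simp add: fprim_def primitive_def)
  next
    case False
    then have "x(n := r) \<in> cyl n (chart_image c)"
      using upd_mem_cyl[OF c x] by simp
    from homotopy_eq[OF c J this, of \<omega>] show ?thesis
      using upd_last[OF c x] by simp
  qed
qed

text \<open>Compatibility with changes of charts holds because \<open>fprim\<close> acts in
  \<open>r\<close> only and the sign depends only on the degree.\<close>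

lemma homotopy_forms:
  assumes \<omega>: "\<omega> \<in> forms (Suc k)" shows "homotopy \<omega> \<in> forms k"
proof -
  obtain \<epsilon> where \<epsilon>: "0 < \<epsilon>" "\<epsilon> \<le> 1" and van: "\<And>c I x. c \<in> S \<Longrightarrow> x \<in> chart_image c \<Longrightarrow> coef \<omega> c I x \<in> vanishing \<epsilon>"
    using forms_vanishing[OF \<omega>] by blast
  show ?thesis
  proof (rule formsI[OF _ _ \<epsilon>(1)])
    fix C I y assume not: "\<not> (C \<in> cyl_atlas \<and> I \<subseteq> {..<Suc n} \<and> card I = k \<and> y \<in> chart_image C)"
    show "homotopy \<omega> C I y = 0"
    proof (cases "C \<in> cyl_atlas \<and> I \<subseteq> {..<n} \<and> y \<in> chart_image C")
      case True
      then have "I \<subseteq> {..<Suc n}"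
        by auto
      with True not have "card (insert n I) \<noteq> Suc k"
        using card_insert_last by auto
      then have "(\<lambda>r. \<omega> C (insert n I) (y(n := r))) = (\<lambda>_. 0)"
        using forms_outside[OF \<omega>] by blast
      then show ?thesis
        by (simp add: homotopy_def del: fun_upd_apply)
    qed (auto simp: homotopy_def)
  next
    fix c d I y assume c: "c \<in> S" and d: "d \<in> S" and I: "I \<subseteq> {..<Suc n}" "card I = k" and y: "y \<in> cyl n (overlap c d)"
    let ?C = "cyl_chart n c" and ?D = "cyl_chart n d" and ?x = "y(n := 0)"
    let ?ty = "(transition c d ?x)(n := y n)"
    have x: "?x \<in> overlap c d" and r: "0 \<le> y n"
      using y by (auto simp: cyl_def)
    have xc: "?x \<in> chart_image c" and td: "transition c d ?x \<in> chart_image d"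
      using chart_image_overlap[OF c x] .
    let ?sum = "\<Sum>J | J \<subseteq> {..<Suc n} \<and> card J = k. homotopy \<omega> ?D J ?ty * complex_of_real (jacobian_minor ?C ?D J I y)"
    \<comment> \<open>No component of \<open>homotopy \<omega>\<close> contains dr, so index sets
      with \<open>n\<close> drop out.\<close>
    have sum: "?sum = (\<Sum>J | J \<subseteq> {..<n} \<and> card J = k. homotopy \<omega> ?D J ?ty * complex_of_real (jacobian_minor ?C ?D J I y))"
    proof (rule sum_index_sets_lower)
      fix J assume "n \<in> J"
      then have "\<not> J \<subseteq> {..<n}"
        by auto
      then show "homotopy \<omega> ?D J ?ty * complex_of_real (jacobian_minor ?C ?D J I y) = 0"
        by (simp add: homotopy_not_lower)
    qed
    from I(1) show "homotopy \<omega> ?C I y = ?sum"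
    proof (cases rule: insert_last_cases)
      case 1
      have fin: "finite {J. J \<subseteq> {..<n} \<and> card J = k}"
        by (rule finite_subset[of _ "Pow {..<n}"]) auto
      have "homotopy \<omega> ?C I y = (-1) ^ k * fprim (coef \<omega> c (insert n I) ?x) (y n)"
        using fun_cong[OF coef_homotopy[OF \<omega> c 1(1) xc], of "y n"] I(2) by simp
      also have "fprim (coef \<omega> c (insert n I) ?x) = (\<lambda>r. \<Sum>J | J \<subseteq> {..<n} \<and> card J = k.
         complex_of_real (jacobian_minor c d J I ?x) * fprim (coef \<omega> d (insert n J) (transition c d ?x)) r)"
        unfolding coef_transform[OF \<omega> c d 1(1) I(2) x] by (rule fprim_sum[OF fin]) (rule coef_mem[OF \<omega> d td])
      also have "(-1) ^ k * (\<Sum>J | J \<subseteq> {..<n} \<and> card J = k.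
         complex_of_real (jacobian_minor c d J I ?x) * fprim (coef \<omega> d (insert n J) (transition c d ?x)) (y n))
        = (\<Sum>J | J \<subseteq> {..<n} \<and> card J = k. homotopy \<omega> ?D J ?ty * complex_of_real (jacobian_minor ?C ?D J I y))"
        unfolding sum_distrib_left
      proof (rule sum.cong[OF refl])
        fix J assume "J \<in> {J. J \<subseteq> {..<n} \<and> card J = k}"
        then have J: "J \<subseteq> {..<n}" "card J = k"
          by auto
        show "(-1) ^ k * (complex_of_real (jacobian_minor c d J I ?x) * fprim (coef \<omega> d (insert n J) (transition c d ?x)) (y n))
          = homotopy \<omega> ?D J ?ty * complex_of_real (jacobian_minor ?C ?D J I y)"
          unfolding jacobian_minor_cyl[OF charts[OF c] charts[OF d] y J(1) 1(1)]
          using fun_cong[OF coef_homotopy[OF \<omega> d J(1) td], of "y n"] J(2) by simp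
      qed
      finally show ?thesis
        unfolding sum .
    next
      case (2 K)
      have "homotopy \<omega> ?D J ?ty * complex_of_real (jacobian_minor ?C ?D J I y) = 0"
        if J: "J \<subseteq> {..<n}" "card J = k" for J
      proof -
        have "jacobian_minor ?C ?D J I y = 0"
          by (rule jacobian_minor_cyl_mixed[OF charts[OF c] charts[OF d] y]) (use J I 2 in auto)
        then show ?thesis
          by simp
      qed
      then have "?sum = 0"
        unfolding sum by (intro sum.neutral) auto
      moreover have "\<not> I \<subseteq> {..<n}"
        using 2 by auto
      ultimately show ?thesis
        by (simp add: homotopy_not_lower)
    qed
  next
    fix c I x and r :: real assume c: "c \<in> S" and r: "r < \<epsilon>" and x: "x \<in> chart_image c"
    show "homotopy \<omega> (cyl_chart n c) I (x(n := r)) = 0"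
    proof (cases "I \<subseteq> {..<n}")
      case True
      have "fprim (coef \<omega> c (insert n I) x) r = 0"
        using fprim_vanishing[OF van[OF c x] \<epsilon>] r unfolding vanishing_def by blast
      then show ?thesis
        using fun_cong[OF coef_homotopy[OF \<omega> c True x], of r] by simp
    qed (simp add: homotopy_not_lower)
  next
    fix c I assume c: "c \<in> S" and "I \<subseteq> {..<Suc n}"
    show "\<exists>D. smooth_family n (chart_image c) D \<and> (\<forall>x\<in>chart_image c. D [] x = coef (homotopy \<omega>) c I x)"
    proof (cases "I \<subseteq> {..<n}")
      case True
      obtain D where D: "smooth_family n (chart_image c) D"
        "\<And>x. x \<in> chart_image c \<Longrightarrow> D [] x = coef \<omega> c (insert n I) x"
        using forms_family[OF \<omega> c] by blast
      have "smooth_family n (chart_image c) (\<lambda>is x. fprim (D is x))"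
        by (rule smooth_family_fprim[OF open_image[OF c] D(1) _ \<epsilon>]) (use D(2) van[OF c] in auto)
      from smooth_family_lincomb[OF this D(1), of "(-1) ^ card I" 0] show ?thesis
        using D(2) coef_homotopy[OF \<omega> c True]
        by (intro exI[of _ "\<lambda>is x r. (-1) ^ card I * fprim (D is x) r + 0 * D is x r"]) simp
    next
      case False
      then show ?thesis
        using smooth_family_zero by (intro exI[of _ "\<lambda>is x r. 0"]) (simp add: homotopy_not_lower)
    qed
  qed
qed

text \<open>On coefficients with dr, the \<open>r\<close>-derivative of \<open>fprim\<close> is
  \<open>reduce\<close>, that is, the coefficient minus its fiber integral times
  \<open>unit\<close>. On those without dr, the equation is the image under \<open>fprim\<close> of
  the closedness of \<open>\<omega>\<close>.\<close>

lemma homotopy_formula: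
  assumes \<omega>: "\<omega> \<in> forms (Suc k)" and closed: "cyl_d \<omega> = 0"
  shows "\<omega> = cyl_d (homotopy \<omega>) + wedge (push \<omega>)"
proof (intro ext)
  fix C I y
  show "\<omega> C I y = (cyl_d (homotopy \<omega>) + wedge (push \<omega>)) C I y"
  proof (cases "C \<in> cyl_atlas \<and> I \<subseteq> {..<Suc n} \<and> y \<in> chart_image C")
    case False
    then have "\<omega> C I y = 0"
      by (intro forms_outside[OF \<omega>]) blast
    with False show ?thesis
      by (auto simp: wedge_def ext_d_def)
  next
    case True
    let ?c = "base_chart C" and ?x = "y(n := 0)"
    let ?V = "chart_image ?c"
    from True have C: "C \<in> cyl_atlas" and y: "y \<in> chart_image C" and I: "I \<subseteq> {..<Suc n}"
      by auto
    have c: "?c \<in> S" and Cc: "cyl_chart n ?c = C" and img: "chart_image C = cyl n ?V"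
      using base_chart[OF C] image_cyl[of ?c] by auto
    have x: "?x \<in> ?V" and r: "0 \<le> y n" and y': "y \<in> cyl n ?V" and yx: "?x(n := y n) = y"
      using y unfolding img by (auto simp: cyl_def)
    obtain \<epsilon> where \<epsilon>: "0 < \<epsilon>" "\<epsilon> \<le> 1" and van: "\<And>I. \<forall>x\<in>?V. coef \<omega> ?c I x \<in> vanishing \<epsilon>"
      using forms_vanishing[OF \<omega>] c by blast
    from I show ?thesis
    proof (cases rule: insert_last_cases)
      case (2 J)
      have "pd (cyl n ?V) n (homotopy \<omega> C J) (?x(n := y n)) = (-1) ^ card J * reduce (coef \<omega> ?c (insert n J) ?x) (y n)"
        by (rule pd_last_fprim_coef[OF \<omega> c x r]) (use homotopy_eq[OF c 2(1), of _ \<omega>] in \<open>simp add: Cc\<close>)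
      then have last: "pd (cyl n ?V) n (homotopy \<omega> C J) y = (-1) ^ card J * reduce (coef \<omega> ?c (insert n J) ?x) (y n)"
        unfolding yx .
      \<comment> \<open>The terms of \<open>d\<close> along M involve components of
        \<open>homotopy \<omega>\<close> with dr, all of which are 0; only the
        \<open>r\<close>-derivative is left.\<close>
      have "pd (cyl n ?V) i (homotopy \<omega> C (insert n (J - {i}))) y = 0" if "i \<in> J" for i
      proof -
        have "\<not> insert n (J - {i}) \<subseteq> {..<n}" "i < Suc n"
          using that 2(1) by auto
        then show ?thesis
          using pd_zero[where 'a = complex, OF nondegenerate_cyl_image[OF C], of i] unfolding img
          by (simp add: homotopy_not_lower)
      qed
      then have "cyl_d (homotopy \<omega>) C I y = (-1) ^ card J * ((-1) ^ card J * reduce (coef \<omega> ?c (insert n J) ?x) (y n))"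
        using ext_d_cyl_insert[OF c 2(1) y', of "homotopy \<omega>"] unfolding Cc 2(2) last by simp
      also have "\<dots> = reduce (coef \<omega> ?c (insert n J) ?x) (y n)"
        by (simp flip: mult.assoc power_add add: mult_2[symmetric] power_mult)
      also have "\<dots> = \<omega> C I y - push \<omega> ?c J ?x * unit (y n)"
        using push_eq[OF c 2(1) x, of \<omega>] 2(2) by (simp add: reduce_def Cc)
      also have "push \<omega> ?c J ?x * unit (y n) = wedge (push \<omega>) C I y"
        using wedge_insert[OF C 2(1) y, of "push \<omega>"] 2(2) by simp
      finally show ?thesis
        by simp
    next
      case 1
      note J = 1(1)
      have fin: "finite I"
        using J finite_subset by blast
      have wedge0: "wedge (push \<omega>) C I y = 0"
        using 1(2) by (simp add: wedge_not_last)
      define s where "s i = (-1 :: complex) ^ card {j\<in>I. j < i}" for i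
      define g where "g i = dcoef \<omega> ?c (insert n (I - {i})) i ?x" for i
      have g: "g i \<in> topspace T" if "i \<in> I" for i
        unfolding g_def by (rule vanishing_mem[OF dcoef_vanishing[OF \<omega> c x _ van]]) (use that J in auto)
      \<comment> \<open>The component of the closedness equation with one additional dr; applying
        \<open>fprim\<close> to it cancels the \<open>r\<close>-derivative of the coefficient
        sought.\<close>
      have "coef (cyl_d \<omega>) ?c (insert n I) ?x = (\<lambda>_. 0)"
        unfolding closed by simp
      then have "(\<lambda>_. 0) = (\<lambda>r. (-1) ^ card I * ddx (coef \<omega> ?c I ?x) r + 1 * (\<Sum>i\<in>I. s i * g i r))"
        unfolding cyl_d_insert_coef[OF \<omega> c J x] s_def g_def by simp
      then have "fprim (\<lambda>_. 0) = fprim (\<lambda>r. (-1) ^ card I * ddx (coef \<omega> ?c I ?x) r + 1 * (\<Sum>i\<in>I. s i * g i r))"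
        by (rule arg_cong)
      also have "\<dots> = (\<lambda>r. (-1) ^ card I * fprim (ddx (coef \<omega> ?c I ?x)) r + 1 * fprim (\<lambda>r. \<Sum>i\<in>I. s i * g i r) r)"
        by (intro fprim_lincomb ddx_mem coef_mem[OF \<omega> c x] sum_mem[OF fin g])
      also have "fprim (ddx (coef \<omega> ?c I ?x)) = coef \<omega> ?c I ?x"
        using van x by (intro fprim_ddx[OF _ \<epsilon>(1)]) blast
      also have "fprim (\<lambda>r. \<Sum>i\<in>I. s i * g i r) = (\<lambda>r. \<Sum>i\<in>I. s i * fprim (g i) r)"
        by (rule fprim_sum[OF fin g])
      finally have "fprim (\<lambda>_. 0) = (\<lambda>r. (-1) ^ card I * coef \<omega> ?c I ?x r + 1 * (\<Sum>i\<in>I. s i * fprim (g i) r))" .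
      from fun_cong[OF this, of "y n"]
      have "0 = (-1) ^ card I * \<omega> C I y + (\<Sum>i\<in>I. s i * fprim (g i) (y n))"
        unfolding yx Cc by simp
      then have key: "(\<Sum>i\<in>I. s i * fprim (g i) (y n)) = - ((-1) ^ card I * \<omega> C I y)"
        by (simp add: eq_neg_iff_add_eq_0 add.commute)
      have "cyl_d (homotopy \<omega>) C I y = (\<Sum>i\<in>I. s i * pd (cyl n ?V) i (homotopy \<omega> C (I - {i})) y)"
        using ext_d_cyl[OF c I y', of "homotopy \<omega>"] unfolding Cc s_def .
      \<comment> \<open>The homotopy is evaluated at \<open>I - {i}\<close>, which has one index
        less than \<open>I\<close>; hence the extra minus sign.\<close>
      also have "\<dots> = (\<Sum>i\<in>I. - ((-1) ^ card I) * (s i * fprim (g i) (y n)))"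
      proof (rule sum.cong[OF refl])
        fix i assume i: "i \<in> I"
        have sub: "I - {i} \<subseteq> {..<n}" and "i < n"
          using J i by auto
        have "pd (cyl n ?V) i (homotopy \<omega> C (I - {i})) (?x(n := y n)) = (-1) ^ card (I - {i}) * fprim (g i) (y n)"
          unfolding g_def by (rule pd_fprim_coef[OF \<omega> c x \<open>i < n\<close> r])
            (use homotopy_eq[OF c sub, of _ \<omega>] in \<open>simp add: Cc\<close>)
        moreover have "(-1 :: complex) ^ card I = - ((-1) ^ card (I - {i}))"
          using card_Suc_Diff1[OF fin i] by (metis power_Suc mult_minus1)
        ultimately show "s i * pd (cyl n ?V) i (homotopy \<omega> C (I - {i})) y = - ((-1) ^ card I) * (s i * fprim (g i) (y n))"
          unfolding yx by simp
      qed
      also have "\<dots> = - ((-1) ^ card I) * - ((-1) ^ card I * \<omega> C I y)"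
        unfolding sum_distrib_left[symmetric] key ..
      also have "\<dots> = \<omega> C I y"
        by (simp flip: mult.assoc power_add add: mult_2[symmetric] power_mult)
      finally show ?thesis
        using wedge0 by simp
    qed
  qed
qed

text \<open>The \<open>r\<close>-derivative of a closed function is 0, and \<open>fprim_ddx\<close>
  recovers a function vanishing near 0 from its derivative.\<close>

lemma closed_degree_0:
  assumes \<omega>: "\<omega> \<in> forms 0" and closed: "cyl_d \<omega> = 0" shows "\<omega> = 0"
proof (intro ext)
  fix C I y
  show "\<omega> C I y = 0 C I y"
  proof (cases "C \<in> cyl_atlas \<and> I \<subseteq> {..<Suc n} \<and> card I = 0 \<and> y \<in> chart_image C")
    case False
    then show ?thesis
      using forms_outside[OF \<omega>] by simp
  next
    case True
    let ?c = "base_chart C" and ?x = "y(n := 0)"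
    from True have C: "C \<in> cyl_atlas" and y: "y \<in> chart_image C" and I: "I = {}"
      using finite_subset[of I "{..<Suc n}"] by auto
    have c: "?c \<in> S" and Cc: "cyl_chart n ?c = C" and x: "?x \<in> chart_image ?c"
      using base_chart[OF C] image_cyl[of ?c] y cyl_base[of y ?c] by auto
    obtain \<epsilon> where \<epsilon>: "0 < \<epsilon>" and van: "coef \<omega> ?c {} ?x \<in> vanishing \<epsilon>"
      using forms_vanishing[OF \<omega>] c x by blast
    have "coef (cyl_d \<omega>) ?c (insert n {}) ?x = (\<lambda>_. 0)"
      unfolding closed by simp
    then have "ddx (coef \<omega> ?c {} ?x) = (\<lambda>_. 0)"
      unfolding cyl_d_insert_coef[OF \<omega> c empty_subsetI x] by simp
    with fprim_ddx[OF van \<epsilon>] have "coef \<omega> ?c {} ?x = (\<lambda>_. 0)"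
      by simp
    from fun_cong[OF this, of "y n"] show ?thesis
      by (simp add: Cc I)
  qed
qed

end

section \<open>Passing to cohomology\<close>

lemma coho_class_eq: "coho_class \<Omega> d k \<omega> = (\<lambda>\<beta>. \<beta> + \<omega>) ` coboundaries \<Omega> d k"
  by (auto simp: coho_class_def r_coset_def cocycle_group_def)

lemma carrier_cohomology: "carrier (cohomology \<Omega> d k) = coho_class \<Omega> d k ` cocycles \<Omega> d k"
  by (auto simp: cohomology_def FactGroup_def RCOSETS_def coho_class_def cocycle_group_def)

text \<open>The usual coset criterion, argued with translates in the additive group of all
  forms.\<close>

lemma coho_class_eq_iff:
  assumes "0 \<in> coboundaries \<Omega> d k"
    and diff: "\<And>\<alpha> \<beta>. \<alpha> \<in> coboundaries \<Omega> d k \<Longrightarrow> \<beta> \<in> coboundaries \<Omega> d k \<Longrightarrow> \<alpha> - \<beta> \<in> coboundaries \<Omega> d k"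
  shows "coho_class \<Omega> d k \<omega> = coho_class \<Omega> d k \<eta> \<longleftrightarrow> \<omega> - \<eta> \<in> coboundaries \<Omega> d k"
proof
  assume eq: "coho_class \<Omega> d k \<omega> = coho_class \<Omega> d k \<eta>"
  have "0 + \<omega> \<in> coho_class \<Omega> d k \<omega>"
    unfolding coho_class_eq using assms(1) by (rule imageI)
  then obtain \<beta> where "\<beta> \<in> coboundaries \<Omega> d k" "0 + \<omega> = \<beta> + \<eta>"
    unfolding eq unfolding coho_class_eq by blast
  moreover from this have "\<omega> - \<eta> = \<beta>"
    by (simp add: algebra_simps)
  ultimately show "\<omega> - \<eta> \<in> coboundaries \<Omega> d k"
    by (simp only:)
next
  assume *: "\<omega> - \<eta> \<in> coboundaries \<Omega> d k"
  have plus: "\<alpha> + \<beta> \<in> coboundaries \<Omega> d k" if "\<alpha> \<in> coboundaries \<Omega> d k" "\<beta> \<in> coboundaries \<Omega> d k" for \<alpha> \<beta>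
    using diff[OF that(1) diff[OF assms(1) that(2)]] by (simp only: diff_0 diff_minus_eq_add)
  show "coho_class \<Omega> d k \<omega> = coho_class \<Omega> d k \<eta>"
    unfolding coho_class_eq
  proof (intro equalityI subsetI)
    fix \<zeta> assume "\<zeta> \<in> (\<lambda>\<beta>. \<beta> + \<omega>) ` coboundaries \<Omega> d k"
    then obtain \<beta> where \<beta>: "\<beta> \<in> coboundaries \<Omega> d k" "\<zeta> = \<beta> + \<omega>"
      by blast
    have "\<zeta> = (\<beta> + (\<omega> - \<eta>)) + \<eta>"
      unfolding \<beta>(2) by (simp only: add.assoc diff_add_cancel)
    then show "\<zeta> \<in> (\<lambda>\<beta>. \<beta> + \<eta>) ` coboundaries \<Omega> d k"
      using plus[OF \<beta>(1) *] by (rule image_eqI)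
  next
    fix \<zeta> assume "\<zeta> \<in> (\<lambda>\<beta>. \<beta> + \<eta>) ` coboundaries \<Omega> d k"
    then obtain \<beta> where \<beta>: "\<beta> \<in> coboundaries \<Omega> d k" "\<zeta> = \<beta> + \<eta>"
      by blast
    have "\<zeta> = (\<beta> - (\<omega> - \<eta>)) + \<omega>"
      unfolding \<beta>(2) by (simp only: diff_diff_eq2 diff_add_cancel)
    then show "\<zeta> \<in> (\<lambda>\<beta>. \<beta> + \<omega>) ` coboundaries \<Omega> d k"
      using diff[OF \<beta>(1) *] by (rule image_eqI)
  qed
qed

lemma mult_cohomology:
  assumes "0 \<in> coboundaries \<Omega> d k"
    and add: "\<And>\<alpha> \<beta>. \<alpha> \<in> coboundaries \<Omega> d k \<Longrightarrow> \<beta> \<in> coboundaries \<Omega> d k \<Longrightarrow> \<alpha> + \<beta> \<in> coboundaries \<Omega> d k"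
  shows "coho_class \<Omega> d k \<omega> \<otimes>\<^bsub>cohomology \<Omega> d k\<^esub> coho_class \<Omega> d k \<eta> = coho_class \<Omega> d k (\<omega> + \<eta>)"
proof -
  let ?B = "coboundaries \<Omega> d k"
  have "coho_class \<Omega> d k \<omega> \<otimes>\<^bsub>cohomology \<Omega> d k\<^esub> coho_class \<Omega> d k \<eta> = {\<alpha> + \<omega> + (\<beta> + \<eta>) | \<alpha> \<beta>. \<alpha> \<in> ?B \<and> \<beta> \<in> ?B}"
    unfolding coho_class_eq by (auto simp: cohomology_def FactGroup_def set_mult_def cocycle_group_def)
  also have "\<dots> = (\<lambda>\<beta>. \<beta> + (\<omega> + \<eta>)) ` ?B"
  proof (intro equalityI subsetI)
    fix \<zeta> assume "\<zeta> \<in> {\<alpha> + \<omega> + (\<beta> + \<eta>) | \<alpha> \<beta>. \<alpha> \<in> ?B \<and> \<beta> \<in> ?B}"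
    then obtain \<alpha> \<beta> where *: "\<alpha> \<in> ?B" "\<beta> \<in> ?B" "\<zeta> = \<alpha> + \<omega> + (\<beta> + \<eta>)"
      by blast
    have "\<zeta> = (\<alpha> + \<beta>) + (\<omega> + \<eta>)"
      unfolding *(3) by (simp only: ac_simps)
    then show "\<zeta> \<in> (\<lambda>\<beta>. \<beta> + (\<omega> + \<eta>)) ` ?B"
      using add[OF *(1,2)] by (rule image_eqI)
  next
    fix \<zeta> assume "\<zeta> \<in> (\<lambda>\<beta>. \<beta> + (\<omega> + \<eta>)) ` ?B"
    then obtain \<beta> where *: "\<beta> \<in> ?B" "\<zeta> = \<beta> + (\<omega> + \<eta>)"
      by blast
    have "\<zeta> = \<beta> + \<omega> + (0 + \<eta>)"
      unfolding *(2) by (simp only: add_0 add.assoc)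
    then show "\<zeta> \<in> {\<alpha> + \<omega> + (\<beta> + \<eta>) | \<alpha> \<beta>. \<alpha> \<in> ?B \<and> \<beta> \<in> ?B}"
      using *(1) assms(1) by (intro CollectI exI[of _ \<beta>] exI[of _ 0] conjI)
  qed
  finally show ?thesis
    unfolding coho_class_eq .
qed

text \<open>
  The coboundaries need not be known to be cocycles: the cosets and their products make sense
  as soon as the coboundaries form an additive subgroup of all forms.
\<close>

lemma induces_cohomology_isoI:
  assumes Z: "\<And>a b \<omega> \<eta>. \<omega> \<in> cocycles \<Omega> d k \<Longrightarrow> \<eta> \<in> cocycles \<Omega> d k \<Longrightarrow> form_lincomb a \<omega> b \<eta> \<in> cocycles \<Omega> d k"
    and B: "0 \<in> coboundaries \<Omega> d k" "\<And>a b \<alpha> \<beta>. \<alpha> \<in> coboundaries \<Omega> d k \<Longrightarrow> \<beta> \<in> coboundaries \<Omega> d k \<Longrightarrow>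
        form_lincomb a \<alpha> b \<beta> \<in> coboundaries \<Omega> d k"
    and B': "0 \<in> coboundaries \<Omega>' d' l" "\<And>a b \<alpha> \<beta>. \<alpha> \<in> coboundaries \<Omega>' d' l \<Longrightarrow> \<beta> \<in> coboundaries \<Omega>' d' l \<Longrightarrow>
        form_lincomb a \<alpha> b \<beta> \<in> coboundaries \<Omega>' d' l"
    and linear: "\<And>a b \<omega> \<eta>. \<omega> \<in> cocycles \<Omega> d k \<Longrightarrow> \<eta> \<in> cocycles \<Omega> d k \<Longrightarrow>
        f (form_lincomb a \<omega> b \<eta>) = form_lincomb a (f \<omega>) b (f \<eta>)"
    and fZ: "f ` cocycles \<Omega> d k \<subseteq> cocycles \<Omega>' d' l" and fB: "f ` coboundaries \<Omega> d k \<subseteq> coboundaries \<Omega>' d' l"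
    and inj: "\<And>\<omega>. \<omega> \<in> cocycles \<Omega> d k \<Longrightarrow> f \<omega> \<in> coboundaries \<Omega>' d' l \<Longrightarrow> \<omega> \<in> coboundaries \<Omega> d k"
    and surj: "\<And>\<phi>. \<phi> \<in> cocycles \<Omega>' d' l \<Longrightarrow> \<exists>\<omega>\<in>cocycles \<Omega> d k. f \<omega> = \<phi>"
  shows "induces_cohomology_iso f \<Omega> d k \<Omega>' d' l"
proof -
  let ?cl = "coho_class \<Omega> d k" and ?cl' = "coho_class \<Omega>' d' l" and ?Z = "cocycles \<Omega> d k"
  have iff: "?cl \<omega> = ?cl \<eta> \<longleftrightarrow> \<omega> - \<eta> \<in> coboundaries \<Omega> d k" for \<omega> \<eta>
    by (rule coho_class_eq_iff[OF B(1)]) (simp add: form_diff_eq B(2))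
  have iff': "?cl' \<omega> = ?cl' \<eta> \<longleftrightarrow> \<omega> - \<eta> \<in> coboundaries \<Omega>' d' l" for \<omega> \<eta>
    by (rule coho_class_eq_iff[OF B'(1)]) (simp add: form_diff_eq B'(2))
  have mult: "?cl \<omega> \<otimes>\<^bsub>cohomology \<Omega> d k\<^esub> ?cl \<eta> = ?cl (\<omega> + \<eta>)" for \<omega> \<eta>
    by (rule mult_cohomology[OF B(1)]) (simp add: form_add_eq B(2))
  have mult': "?cl' \<omega> \<otimes>\<^bsub>cohomology \<Omega>' d' l\<^esub> ?cl' \<eta> = ?cl' (\<omega> + \<eta>)" for \<omega> \<eta>
    by (rule mult_cohomology[OF B'(1)]) (simp add: form_add_eq B'(2))
  have Zdiff: "\<omega> - \<eta> \<in> ?Z" and fdiff: "f (\<omega> - \<eta>) = f \<omega> - f \<eta>" if "\<omega> \<in> ?Z" "\<eta> \<in> ?Z" for \<omega> \<eta>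
    using Z[OF that] linear[OF that] by (simp_all only: form_diff_eq)
  have Zadd: "\<omega> + \<eta> \<in> ?Z" and fadd: "f (\<omega> + \<eta>) = f \<omega> + f \<eta>" if "\<omega> \<in> ?Z" "\<eta> \<in> ?Z" for \<omega> \<eta>
    using Z[OF that] linear[OF that] by (simp_all only: form_add_eq)
  \<comment> \<open>One direction is the well-definedness of the induced map, the other its
    injectivity.\<close>
  have classes: "?cl \<omega> = ?cl \<eta> \<longleftrightarrow> ?cl' (f \<omega>) = ?cl' (f \<eta>)" if "\<omega> \<in> ?Z" "\<eta> \<in> ?Z" for \<omega> \<eta>
    unfolding iff iff' fdiff[OF that, symmetric] using inj[OF Zdiff[OF that]] fB by blast
  \<comment> \<open>A representative is picked in each coset; by \<open>classes\<close> the result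
    does not depend on it.\<close>
  define \<Phi> where "\<Phi> X = ?cl' (f (SOME \<omega>. \<omega> \<in> ?Z \<and> ?cl \<omega> = X))" for X
  have \<Phi>: "\<Phi> (?cl \<omega>) = ?cl' (f \<omega>)" if \<omega>: "\<omega> \<in> ?Z" for \<omega>
  proof -
    have "\<exists>\<eta>. \<eta> \<in> ?Z \<and> ?cl \<eta> = ?cl \<omega>"
      using \<omega> by blast
    from someI_ex[OF this] show ?thesis
      unfolding \<Phi>_def using classes[OF _ \<omega>] by blast
  qed
  have "\<Phi> \<in> hom (cohomology \<Omega> d k) (cohomology \<Omega>' d' l)"
  proof (rule homI)
    fix x assume "x \<in> carrier (cohomology \<Omega> d k)"
    then obtain \<omega> where \<omega>: "\<omega> \<in> ?Z" "x = ?cl \<omega>"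
      unfolding carrier_cohomology by blast
    then show "\<Phi> x \<in> carrier (cohomology \<Omega>' d' l)"
      unfolding carrier_cohomology using \<Phi>[OF \<omega>(1)] fZ by blast
    fix y assume "y \<in> carrier (cohomology \<Omega> d k)"
    then obtain \<eta> where \<eta>: "\<eta> \<in> ?Z" "y = ?cl \<eta>"
      unfolding carrier_cohomology by blast
    show "\<Phi> (x \<otimes>\<^bsub>cohomology \<Omega> d k\<^esub> y) = \<Phi> x \<otimes>\<^bsub>cohomology \<Omega>' d' l\<^esub> \<Phi> y"
      unfolding \<omega>(2) \<eta>(2) mult \<Phi>[OF \<omega>(1)] \<Phi>[OF \<eta>(1)] mult' \<Phi>[OF Zadd[OF \<omega>(1) \<eta>(1)]] fadd[OF \<omega>(1) \<eta>(1)] ..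
  qed
  moreover have "bij_betw \<Phi> (carrier (cohomology \<Omega> d k)) (carrier (cohomology \<Omega>' d' l))"
    unfolding bij_betw_def
  proof
    show "inj_on \<Phi> (carrier (cohomology \<Omega> d k))"
    proof (rule inj_onI)
      fix x y assume "x \<in> carrier (cohomology \<Omega> d k)" "y \<in> carrier (cohomology \<Omega> d k)" and eq: "\<Phi> x = \<Phi> y"
      then obtain \<omega> \<eta> where *: "\<omega> \<in> ?Z" "x = ?cl \<omega>" "\<eta> \<in> ?Z" "y = ?cl \<eta>"
        unfolding carrier_cohomology by blast
      show "x = y"
        using eq unfolding *(2,4) \<Phi>[OF *(1)] \<Phi>[OF *(3)] classes[OF *(1,3)] .
    qed
    show "\<Phi> ` carrier (cohomology \<Omega> d k) = carrier (cohomology \<Omega>' d' l)"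
    proof (intro equalityI subsetI)
      fix z assume "z \<in> \<Phi> ` carrier (cohomology \<Omega> d k)"
      then obtain \<omega> where "\<omega> \<in> ?Z" "z = \<Phi> (?cl \<omega>)"
        unfolding carrier_cohomology by blast
      then show "z \<in> carrier (cohomology \<Omega>' d' l)"
        unfolding carrier_cohomology using \<Phi> fZ by blast
    next
      fix z assume "z \<in> carrier (cohomology \<Omega>' d' l)"
      then obtain \<phi> where \<phi>: "\<phi> \<in> cocycles \<Omega>' d' l" "z = ?cl' \<phi>"
        unfolding carrier_cohomology by blast
      then obtain \<omega> where "\<omega> \<in> ?Z" "f \<omega> = \<phi>"
        using surj by blast
      with \<phi>(2) \<Phi> have "z = \<Phi> (?cl \<omega>)"
        by simp
      with \<open>\<omega> \<in> ?Z\<close> show "z \<in> \<Phi> ` carrier (cohomology \<Omega> d k)"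
        unfolding carrier_cohomology by blast
    qed
  qed
  ultimately have "\<Phi> \<in> iso (cohomology \<Omega> d k) (cohomology \<Omega>' d' l)"
    by (simp add: iso_def)
  moreover have "\<Phi> (?cl (form_scale a \<omega>)) = ?cl' (form_scale a (f \<omega>))" if "\<omega> \<in> ?Z" for a \<omega>
    using \<Phi>[OF Z[OF that that, of a 0]] linear[OF that that, of a 0] unfolding form_scale_eq
    by (simp add: form_lincomb_def)
  ultimately show ?thesis
    unfolding induces_cohomology_iso_def by (intro conjI bexI[of _ \<Phi>] ballI allI fZ fB \<Phi>) simp_all
qed

lemma trivial_group_cohomology_0:
  assumes "cocycles \<Omega> d 0 = {0}" shows "trivial_group (cohomology \<Omega> d 0)"
proof -
  have B: "coboundaries \<Omega> d 0 = {0}"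
    by (simp add: coboundaries_def)
  have carrier: "carrier (cohomology \<Omega> d 0) = {coho_class \<Omega> d 0 0}"
    unfolding carrier_cohomology assms by simp
  have one: "\<one>\<^bsub>cohomology \<Omega> d 0\<^esub> = coho_class \<Omega> d 0 0"
    unfolding coho_class_eq B by (simp add: cohomology_def FactGroup_def B)
  have mult: "coho_class \<Omega> d 0 0 \<otimes>\<^bsub>cohomology \<Omega> d 0\<^esub> coho_class \<Omega> d 0 0 = coho_class \<Omega> d 0 0"
    using mult_cohomology[of \<Omega> d 0 0 0] unfolding B by simp
  have "group (cohomology \<Omega> d 0)"
    by (rule groupI) (simp_all add: carrier one mult)
  then show ?thesis
    unfolding trivial_group_def using carrier one by simp
qed

section \<open>The cohomology of the half-cylinder\<close>

context half_cylinder
begin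

lemma zero_forms: "0 \<in> forms k"
proof (rule formsI[of _ _ 1])
  fix c I
  show "\<exists>D. smooth_family n (chart_image c) D \<and> (\<forall>x\<in>chart_image c. D [] x = coef 0 c I x)"
    using smooth_family_zero by (intro exI[of _ "\<lambda>is x r. 0"]) simp
qed simp_all

lemma zero_diff_forms: "0 \<in> diff_forms n S k"
proof (rule diff_formsI)
  fix c and I :: "nat set" assume "c \<in> S"
  from smooth_coords_zero[where 'a = complex, OF nondegenerate_image[OF this]]
  show "smooth_coords n (chart_image c) ((0 :: 'm form) c I)"
    by (simp add: zero_fun_def)
qed simp_all

lemma form_lincomb_zero [simp]: "form_lincomb a 0 b 0 = 0"
  by (auto simp: form_lincomb_def fun_eq_iff)

lemma form_lincomb_0_0: "form_lincomb 0 \<omega> 0 \<eta> = 0"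
  by (auto simp: form_lincomb_def fun_eq_iff)

lemma wedge_zero: "wedge 0 = 0"
  by (auto simp: wedge_def fun_eq_iff)

lemma cyl_d_lincomb:
  "\<omega> \<in> forms k \<Longrightarrow> \<eta> \<in> forms k \<Longrightarrow> cyl_d (form_lincomb a \<omega> b \<eta>) = form_lincomb a (cyl_d \<omega>) b (cyl_d \<eta>)"
  by (intro ext_d_lincomb nondegenerate_cyl_image forms_diff_forms)

lemma ext_d_base_lincomb:
  "\<omega> \<in> diff_forms n S k \<Longrightarrow> \<eta> \<in> diff_forms n S k \<Longrightarrow> ext_d n S (form_lincomb a \<omega> b \<eta>) = form_lincomb a (ext_d n S \<omega>) b (ext_d n S \<eta>)"
  by (intro ext_d_lincomb nondegenerate_image)

lemma ext_d_base_zero: "ext_d n S 0 = 0"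
  using ext_d_base_lincomb[OF zero_diff_forms zero_diff_forms, where a = 0 and b = 0] unfolding form_lincomb_0_0 .

lemma cyl_d_zero: "cyl_d 0 = 0"
  using cyl_d_lincomb[OF zero_forms zero_forms, where a = 0 and b = 0] unfolding form_lincomb_0_0 .

lemma base_coboundaries_lincomb:
  assumes "\<alpha> \<in> coboundaries (diff_forms n S) (ext_d n S) k" "\<beta> \<in> coboundaries (diff_forms n S) (ext_d n S) k"
  shows "form_lincomb a \<alpha> b \<beta> \<in> coboundaries (diff_forms n S) (ext_d n S) k"
proof (cases k)
  case 0
  then show ?thesis
    using assms by (simp add: coboundaries_def)
next
  case (Suc j)
  then obtain \<phi> \<psi> where *: "\<phi> \<in> diff_forms n S j" "\<alpha> = ext_d n S \<phi>" "\<psi> \<in> diff_forms n S j" "\<beta> = ext_d n S \<psi>"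
    using assms by (auto simp: coboundaries_def)
  have "form_lincomb a \<alpha> b \<beta> = ext_d n S (form_lincomb a \<phi> b \<psi>)"
    unfolding *(2,4) ext_d_base_lincomb[OF *(1,3)] ..
  moreover have "form_lincomb a \<phi> b \<psi> \<in> diff_forms n S j"
    by (intro diff_forms_lincomb nondegenerate_image *)
  ultimately show ?thesis
    unfolding Suc coboundaries_def by simp
qed

lemma zero_base_coboundaries: "0 \<in> coboundaries (diff_forms n S) (ext_d n S) k"
  using zero_diff_forms ext_d_base_zero by (cases k) (auto simp: coboundaries_def intro: image_eqI[of _ _ 0])

text \<open>Surjectivity comes from the right inverse \<open>wedge\<close>, which maps cocycles to
  cocycles. For injectivity, if the fiber integral of a closed form is d \<psi>, then
  \<open>wedge\<close> turns it into the exact form d (\<psi> \<and> e dr), and the homotopy formula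
  makes the form itself exact.\<close>

lemma fiber_integral_iso:
  "induces_cohomology_iso push forms cyl_d (Suc k) (diff_forms n S) (ext_d n S) k"
proof (rule induces_cohomology_isoI)
  have B: "coboundaries forms cyl_d (Suc k) = cyl_d ` forms k"
    by (simp add: coboundaries_def)
  show "form_lincomb a \<omega> b \<eta> \<in> cocycles forms cyl_d (Suc k)"
    if "\<omega> \<in> cocycles forms cyl_d (Suc k)" "\<eta> \<in> cocycles forms cyl_d (Suc k)" for a b \<omega> \<eta>
    using that forms_lincomb[of \<omega> "Suc k" \<eta>] cyl_d_lincomb[of \<omega> "Suc k" \<eta>] by (simp add: cocycles_def)
  show "push (form_lincomb a \<omega> b \<eta>) = form_lincomb a (push \<omega>) b (push \<eta>)"
    if "\<omega> \<in> cocycles forms cyl_d (Suc k)" "\<eta> \<in> cocycles forms cyl_d (Suc k)" for a b \<omega> \<eta>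
    using that push_lincomb[of \<omega> "Suc k" \<eta>] by (simp add: cocycles_def)
  show "0 \<in> coboundaries forms cyl_d (Suc k)"
    unfolding B using zero_forms cyl_d_zero by (auto intro: image_eqI[of _ _ 0])
  show "form_lincomb a \<alpha> b \<beta> \<in> coboundaries forms cyl_d (Suc k)"
    if "\<alpha> \<in> coboundaries forms cyl_d (Suc k)" "\<beta> \<in> coboundaries forms cyl_d (Suc k)" for a b \<alpha> \<beta>
  proof -
    from that obtain \<omega> \<eta> where *: "\<omega> \<in> forms k" "\<alpha> = cyl_d \<omega>" "\<eta> \<in> forms k" "\<beta> = cyl_d \<eta>"
      unfolding B by blast
    show ?thesis
      unfolding B *(2,4) cyl_d_lincomb[OF *(1,3), symmetric] by (intro imageI forms_lincomb *)
  qed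
  show "0 \<in> coboundaries (diff_forms n S) (ext_d n S) k"
    by (rule zero_base_coboundaries)
  show "form_lincomb a \<alpha> b \<beta> \<in> coboundaries (diff_forms n S) (ext_d n S) k"
    if "\<alpha> \<in> coboundaries (diff_forms n S) (ext_d n S) k" "\<beta> \<in> coboundaries (diff_forms n S) (ext_d n S) k" for a b \<alpha> \<beta>
    using that by (rule base_coboundaries_lincomb)
  have push0: "push 0 = 0"
    using push_degree_0[OF zero_forms] .
  show "push ` cocycles forms cyl_d (Suc k) \<subseteq> cocycles (diff_forms n S) (ext_d n S) k"
  proof
    fix \<phi> assume "\<phi> \<in> push ` cocycles forms cyl_d (Suc k)"
    then obtain \<omega> where \<omega>: "\<omega> \<in> forms (Suc k)" "cyl_d \<omega> = 0" "\<phi> = push \<omega>"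
      by (auto simp: cocycles_def)
    have "ext_d n S (push \<omega>) = 0"
      unfolding push_ext_d[OF \<omega>(1), symmetric] \<omega>(2) push0 ..
    then show "\<phi> \<in> cocycles (diff_forms n S) (ext_d n S) k"
      unfolding \<omega>(3) cocycles_def using push_diff_forms[OF \<omega>(1)] by simp
  qed
  show "push ` coboundaries forms cyl_d (Suc k) \<subseteq> coboundaries (diff_forms n S) (ext_d n S) k"
  proof
    fix \<phi> assume "\<phi> \<in> push ` coboundaries forms cyl_d (Suc k)"
    then obtain \<omega> where \<omega>: "\<omega> \<in> forms k" "\<phi> = push (cyl_d \<omega>)"
      unfolding B by blast
    have eq: "\<phi> = ext_d n S (push \<omega>)"
      unfolding \<omega>(2) by (rule push_ext_d[OF \<omega>(1)])
    show "\<phi> \<in> coboundaries (diff_forms n S) (ext_d n S) k"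
    proof (cases k)
      case 0
      then have "push \<omega> = 0"
        using push_degree_0 \<omega>(1) by simp
      then show ?thesis
        unfolding eq 0 using ext_d_base_zero by (simp add: coboundaries_def)
    next
      case (Suc j)
      then show ?thesis
        unfolding eq using push_diff_forms[of \<omega> j] \<omega>(1) by (simp add: coboundaries_def)
    qed
  qed
  show "\<exists>\<omega>\<in>cocycles forms cyl_d (Suc k). push \<omega> = \<phi>" if "\<phi> \<in> cocycles (diff_forms n S) (ext_d n S) k" for \<phi>
  proof -
    have \<phi>: "\<phi> \<in> diff_forms n S k" "ext_d n S \<phi> = 0"
      using that by (auto simp: cocycles_def)
    have "cyl_d (wedge \<phi>) = 0"
      unfolding cyl_d_wedge[OF \<phi>(1)] \<phi>(2) by (rule wedge_zero)
    then have "wedge \<phi> \<in> cocycles forms cyl_d (Suc k)"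
      unfolding cocycles_def using wedge_forms[OF \<phi>(1)] by simp
    then show ?thesis
      using push_wedge[OF \<phi>(1)] by blast
  qed
  show "\<omega> \<in> coboundaries forms cyl_d (Suc k)"
    if "\<omega> \<in> cocycles forms cyl_d (Suc k)" and push: "push \<omega> \<in> coboundaries (diff_forms n S) (ext_d n S) k" for \<omega>
  proof -
    have \<omega>: "\<omega> \<in> forms (Suc k)" "cyl_d \<omega> = 0"
      using that by (auto simp: cocycles_def)
    have "\<exists>\<eta>\<in>forms k. wedge (push \<omega>) = cyl_d \<eta>"
    proof (cases k)
      \<comment> \<open>In degree 0 the only coboundary on M is 0, so the wedge term disappears from
        the homotopy formula.\<close>
      case 0
      then have "push \<omega> = 0"
        using push by (simp add: coboundaries_def)
      then have "wedge (push \<omega>) = 0"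
        using wedge_zero by simp
      with zero_forms cyl_d_zero show ?thesis
        by (intro bexI[of _ 0]) simp_all
    next
      case (Suc j)
      then obtain \<psi> where \<psi>: "\<psi> \<in> diff_forms n S j" "push \<omega> = ext_d n S \<psi>"
        using push by (auto simp: coboundaries_def)
      show ?thesis
        unfolding \<psi>(2) cyl_d_wedge[OF \<psi>(1), symmetric] Suc using wedge_forms[OF \<psi>(1)] by blast
    qed
    then obtain \<eta> where \<eta>: "\<eta> \<in> forms k" "wedge (push \<omega>) = cyl_d \<eta>"
      by blast
    have h: "homotopy \<omega> \<in> forms k"
      by (rule homotopy_forms[OF \<omega>(1)])
    have "\<omega> = cyl_d (homotopy \<omega>) + cyl_d \<eta>"
      using homotopy_formula[OF \<omega>] unfolding \<eta>(2) .
    also have "\<dots> = cyl_d (form_lincomb 1 (homotopy \<omega>) 1 \<eta>)"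
      unfolding cyl_d_lincomb[OF h \<eta>(1)] form_add_eq ..
    finally show ?thesis
      unfolding B using forms_lincomb[OF h \<eta>(1)] by (rule image_eqI)
  qed
qed

lemma trivial_cohomology_0: "trivial_group (cohomology forms cyl_d 0)"
proof (rule trivial_group_cohomology_0)
  show "cocycles forms cyl_d 0 = {0}"
    using closed_degree_0 zero_forms cyl_d_zero by (auto simp: cocycles_def)
qed

end

text \<open>Degrees are natural numbers, so the shift by one is written with \<open>Suc\<close>, and
  degree 0, where the target would be the zero group in degree -1, becomes a conjunct of its
  own.\<close>

theorem theorem7p10:
  fixes M :: "'m topology" and n :: nat and S :: "'m chart set"
    and sg :: "'m chart \<Rightarrow> 'm \<Rightarrow> real"
    and T :: "(real \<Rightarrow> complex) topology" and fint :: "(real \<Rightarrow> complex) \<Rightarrow> complex"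
  assumes "admissible T fint"
    and "smooth_manifold n M S"
    and "compact_space M"
    and "orientation n M S sg"
  shows "trivial_group (cohomology (forms_A0 n S T) (ext_d (Suc n) (cyl_chart n ` S)) 0) \<and>
    (\<forall>k. induces_cohomology_iso (fiber_integral n S fint)
       (forms_A0 n S T) (ext_d (Suc n) (cyl_chart n ` S)) (Suc k)
       (diff_forms n S) (ext_d n S) k)"
proof -
  interpret half_cylinder T fint n M S
  proof
    show "admissible T fint"
      by fact
    show "is_chart n M c" if "c \<in> S" for c
      using assms(2) that unfolding smooth_manifold_def by blast
  qed
  show ?thesis
    using trivial_cohomology_0 fiber_integral_iso by blast
qed

end
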